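(* Let $a\ge 1$ be a real number. For every real $c\ge 1$ let $n=n(c)>c$ be an integer, let $$A_j(c)=2+2\left(\frac{j}{c}\right)^a,\qquad j=1,\dots,n,$$ and let $A(c)$ be the $n\times n$ symmetric tridiagonal matrix with diagonal entries $A_1(c),\dots,A_n(c)$ and all sub- and superdiagonal entries equal to $1$. Suppose that, for every real $c>1$, $\lambda(c)$ is an eigenvalue of $A(c)$, $1<k(c)<n(c)$ is an integer such that $$2+A_{k(c)}(c)<\lambda(c)\le 2+A_{k(c)+1}(c),$$ and $X(c)=(X_1,\dots,X_n)\in\mathbb{R}^n$ is the unit-length eigenvector of $A(c)$ corresponding to $\lambda(c)$ (with $X_1>0$). Let $\varepsilon>0$ and suppose that, for every $c>1$, the entries of $A(c)$ are defined to relative precision $\varepsilon$. Then the first $k(c)$ coordinates $X_1,\dots,X_{k(c)}$ of $X(c)$ are defined to relative precision $R(c,a)$, where $$R(c,a)\le \varepsilon\cdot O(-\log X_1)\cdot O\!\left(c^{4a/(a+2)}\right),\qquad c\to\infty .$$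
   Context: "Entries defined to relative precision $\varepsilon$" means each entry $e$ of $A(c)$ is only known up to replacement by $e(1+\delta_e)$ with $|\delta_e|\le\varepsilon$ (symmetrically; zero entries stay zero). All eigenvalues of such tridiagonal matrices are simple, so $\lambda(c)$ and $X(c)$ depend smoothly on the perturbations $\delta_e$ (the eigenvalue keeps its index in the ordering, and the eigenvector is normalized to unit Euclidean length with positive first coordinate). A coordinate $X_j\neq 0$ is "defined to relative precision $R$" if its worst-case first-order relative error, namely $\varepsilon\cdot\max_{|d_e|\le 1}\left|\sum_e d_e\,\partial X_j/\partial\delta_e\right|/|X_j|$ evaluated at $\delta=0$, is at most $R$ (terms of order $\varepsilon^2$ are ignored). *)

theory Defs
  imports "Jordan_Normal_Form.Char_Poly" "HOL-Library.Landau_Symbols"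
begin

(* Vectors and matrices are 0-based: the coordinate X_j of the mathematical text is X $ (j - 1). *)

definition diag_entry :: "real \<Rightarrow> real \<Rightarrow> nat \<Rightarrow> real" where
  "diag_entry a c j = 2 + 2 * (real j / c) powr a"

definition tridiag_mat :: "real \<Rightarrow> real \<Rightarrow> nat \<Rightarrow> real mat" where
  "tridiag_mat a c n = mat n n (\<lambda>(i, j).
     if i = j then diag_entry a c (Suc i)
     else if j = Suc i \<or> i = Suc j then 1
     else 0)"

definition unit_eigenvector :: "real mat \<Rightarrow> real vec \<Rightarrow> real \<Rightarrow> bool" where
  "unit_eigenvector A v \<mu> \<longleftrightarrow> eigenvector A v \<mu> \<and> sqrt (v \<bullet> v) = 1 \<and> v $ 0 > 0"

(* The entries of a symmetric matrix that may be perturbed independently: one index pair (i, j)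
   with i \<le> j for each pair of mirror-image entries. *)
definition sym_entries :: "real mat \<Rightarrow> (nat \<times> nat) set" where
  "sym_entries A = {(i, j). i \<le> j \<and> j < dim_row A \<and> A $$ (i, j) \<noteq> 0}"

definition perturb_mat :: "real mat \<Rightarrow> (nat \<times> nat \<Rightarrow> real) \<Rightarrow> real mat" where
  "perturb_mat A \<delta> = mat (dim_row A) (dim_col A)
     (\<lambda>(i, j). A $$ (i, j) * (1 + \<delta> (min i j, max i j)))"

definition eigenvalue_index :: "real mat \<Rightarrow> real \<Rightarrow> nat" where
  "eigenvalue_index A \<mu> = card {\<nu>. eigenvalue A \<nu> \<and> \<nu> < \<mu>}"

(* The eigenvector of the perturbed matrix for the eigenvalue with the same index in the ordering
   as the eigenvalue l of A. Only small \<delta> matter below; for symmetric tridiagonal A with nonzero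
   off-diagonal entries the perturbed eigenvalues are then simple and the description is unique. *)
definition perturbed_eigenvector ::
    "real mat \<Rightarrow> real \<Rightarrow> (nat \<times> nat \<Rightarrow> real) \<Rightarrow> real vec" where
  "perturbed_eigenvector A l \<delta> =
     (THE v. \<exists>\<mu>. unit_eigenvector (perturb_mat A \<delta>) v \<mu> \<and>
                 eigenvalue_index (perturb_mat A \<delta>) \<mu> = eigenvalue_index A l)"

(* The coordinate X $ j of the unit eigenvector X of A for the eigenvalue l is defined to relative
   precision R, when the entries of A are defined to relative precision \<epsilon>. Here D e is the partial
   derivative of the coordinate with respect to the relative perturbation of the entry e, at 0. *)
definition defined_to_rel_precision ::
    "real \<Rightarrow> real mat \<Rightarrow> real \<Rightarrow> real vec \<Rightarrow> nat \<Rightarrow> real \<Rightarrow> bool" where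
  "defined_to_rel_precision \<epsilon> A l X j R \<longleftrightarrow>
     X $ j \<noteq> 0 \<and>
     (\<exists>D. (\<forall>e\<in>sym_entries A.
             ((\<lambda>t. perturbed_eigenvector A l ((\<lambda>_. 0)(e := t)) $ j)
                has_real_derivative D e) (at 0)) \<and>
          \<epsilon> * (SUP d\<in>{d. \<forall>e\<in>sym_entries A. \<bar>d e\<bar> \<le> 1}. \<bar>\<Sum>e\<in>sym_entries A. d e * D e\<bar>) / \<bar>X $ j\<bar>
            \<le> R)"

end

theory Submission
  imports Defs "HOL-Analysis.Elementary_Topology"
begin

text \<open>Let Y be the derivative of the eigenvector X in the direction of a perturbation. It solves the
  inhomogeneous three-term recurrence of X with a right-hand side f bounded by \<lambda> times neighbouring
  values of X, and it is orthogonal to X. By the discrete Wronskian, the quotient Y / X changes from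
  one index to the next by the partial sum of X f divided by the product of two neighbouring values of
  X. On the first k coordinates X is positive and increasing, which controls the variation of Y / X
  there, and it remains to bound Y / X at the first turning point. To that end, Y is written as a
  controlled solution plus a multiple of X separately in the left half and in the (reflected) right
  half of the index range; energy estimates for the quadratic form of the recurrence bound the two
  controlled solutions by X, and matching in the middle together with orthogonality bounds the two
  multiples. For k larger than c all bounds acquire a factor k, which is absorbed by the
  logarithm of the first coordinate.\<close>

section \<open>Three-term recurrences\<close>

text \<open>The error is measured against coordinates that may be exponentially small, and nothing
  is known about gaps between eigenvalues, so expanding the derivative in the eigenbasis is no
  option. The exponent comes from one length: \<open>x0\<close> solves x0^(a+2) = c^a. Up to j =
  x0/2 the potential 2 (j/c)^a stays below the Hardy threshold 1/(4 j^2), under which X grows like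
  sqrt j even without a forbidden region; hence the turning index \<open>q\<close> can be kept above
  x0/4. Consequently partial sums of X are O(x0) times their last term, and the decrement
  \<open>H\<close> of the coefficient is at least of order x0^(-3). For k \<le> c the oscillating
  part costs x0 / H, of order x0^4, and each of the q steps of the growing part costs O(x0), where q
  \<le> c \<le> x0^3 because a \<ge> 1. Both give x0^4 = c^(4a/(a+2)). A further obstacle is that n
  has no upper bound, so diagonal entries may exceed \<lambda> by any amount; the equation itself is
  used to trade them for \<lambda> and neighbouring coordinates.\<close>

lemma jacobi_green:
  fixes x y g \<alpha> \<beta> :: "nat \<Rightarrow> real" and \<mu> \<nu> :: real
  assumes "x 0 = 0" "y 0 = 0"
    and "\<And>j. 1 \<le> j \<Longrightarrow> j \<le> n \<Longrightarrow> \<beta> j * x (Suc j) = (\<mu> - \<alpha> j) * x j - \<beta> (j - 1) * x (j - 1)"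
    and "\<And>j. 1 \<le> j \<Longrightarrow> j \<le> n \<Longrightarrow> \<beta> j * y (Suc j) = (\<nu> - \<alpha> j) * y j - \<beta> (j - 1) * y (j - 1) + g j"
  shows "\<beta> n * (x n * y (Suc n) - x (Suc n) * y n) = (\<Sum>i=1..n. (\<nu> - \<mu>) * (x i * y i) + x i * g i)"
  using assms(3,4)
proof (induction n)
  case 0
  then show ?case using assms(1,2) by simp
next
  case (Suc n)
  have IH: "\<beta> n * (x n * y (Suc n) - x (Suc n) * y n) = (\<Sum>i=1..n. (\<nu> - \<mu>) * (x i * y i) + x i * g i)"
    by (rule Suc.IH) (use Suc.prems in auto)
  have e1: "\<beta> (Suc n) * x (Suc (Suc n)) = (\<mu> - \<alpha> (Suc n)) * x (Suc n) - \<beta> n * x n"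
    using Suc.prems(1)[of "Suc n"] by simp
  have e2: "\<beta> (Suc n) * y (Suc (Suc n)) = (\<nu> - \<alpha> (Suc n)) * y (Suc n) - \<beta> n * y n + g (Suc n)"
    using Suc.prems(2)[of "Suc n"] by simp
  have "\<beta> (Suc n) * (x (Suc n) * y (Suc (Suc n)) - x (Suc (Suc n)) * y (Suc n))
      = x (Suc n) * (\<beta> (Suc n) * y (Suc (Suc n))) - y (Suc n) * (\<beta> (Suc n) * x (Suc (Suc n)))"
    by (simp add: algebra_simps)
  also have "\<dots> = \<beta> n * (x n * y (Suc n) - x (Suc n) * y n)
      + ((\<nu> - \<mu>) * (x (Suc n) * y (Suc n)) + x (Suc n) * g (Suc n))"
    unfolding e1 e2 by (simp add: algebra_simps)
  finally show ?case using IH by simp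
qed

lemma harmonic_le:
  "(\<Sum>i=1..m. 1 / real i) \<le> 1 + ln (real m)"
proof (induction m)
  case (Suc m)
  show ?case
  proof (cases "m = 0")
    case False
    have "ln (real m) - ln (real m + 1) = ln (real m / (real m + 1))"
      using False by (simp add: ln_div)
    also have "\<dots> \<le> real m / (real m + 1) - 1"
      by (rule ln_le_minus_one) (use False in auto)
    also have "\<dots> = - (1 / (real m + 1))" by (simp add: field_simps)
    finally show ?thesis using Suc.IH by (simp add: add.commute)
  qed simp
qed simp

section \<open>Energy estimates\<close>

text \<open>The quadratic form preserved by one step (x, y) -> (y, \<beta> y - x) of the recurrence
  with frozen coefficient. It equals ((2 - \<beta>)(x + y)^2 + (2 + \<beta>)(x - y)^2) / 4, from
  which both monotonicity statements below can be read off.\<close>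

definition jform :: "real \<Rightarrow> real \<Rightarrow> real \<Rightarrow> real" where
  "jform \<beta> x y = x\<^sup>2 + y\<^sup>2 - \<beta> * x * y"

lemma jform_step: "jform \<beta> y (\<beta> * y - x) = jform \<beta> x y"
  by (simp add: jform_def power2_eq_square algebra_simps)

text \<open>Minimising over the other variable leaves (2 - \<beta>)(2 + \<beta>)/4 times the square,
  and 2 + \<beta> \<ge> 2.\<close>

lemma jform_lower:
  assumes "0 \<le> \<beta>" "\<beta> \<le> 2"
  shows "(2 - \<beta>) / 2 * x\<^sup>2 \<le> jform \<beta> x y" "(2 - \<beta>) / 2 * y\<^sup>2 \<le> jform \<beta> x y"
proof -
  have *: "(2 - \<beta>) / 2 * x\<^sup>2 \<le> jform \<beta> x y" for x y
  proof -
    have "jform \<beta> x y - (2 - \<beta>) / 2 * x\<^sup>2 = (y - \<beta> / 2 * x)\<^sup>2 + \<beta> / 2 * ((2 - \<beta>) / 2) * x\<^sup>2"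
      by (simp add: jform_def power2_eq_square field_simps)
    moreover have "\<dots> \<ge> 0" using assms by (intro add_nonneg_nonneg mult_nonneg_nonneg) auto
    ultimately show ?thesis by linarith
  qed
  show "(2 - \<beta>) / 2 * x\<^sup>2 \<le> jform \<beta> x y" by (rule *)
  show "(2 - \<beta>) / 2 * y\<^sup>2 \<le> jform \<beta> x y"
    using *[of y x] by (simp add: jform_def algebra_simps)
qed

lemma jform_nonneg: "0 \<le> \<beta> \<Longrightarrow> \<beta> \<le> 2 \<Longrightarrow> 0 \<le> jform \<beta> x y"
  by (rule order_trans[OF _ jform_lower(1)]) auto

text \<open>Division by 2 + \<beta> fixes the weight of (x - y)^2; that of (x + y)^2 becomes a
  multiple of (2 - \<beta>)/(2 + \<beta>), which decreases in \<beta>. For X this means that the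
  energy cannot drop while b decreases.\<close>

lemma jform_over_plus_antimono:
  assumes "-2 < \<beta>'" "\<beta>' \<le> \<beta>"
  shows "jform \<beta> x y / (2 + \<beta>) \<le> jform \<beta>' x y / (2 + \<beta>')"
proof -
  have "jform \<beta>' x y * (2 + \<beta>) - jform \<beta> x y * (2 + \<beta>') = (\<beta> - \<beta>') * (x + y)\<^sup>2"
    by (simp add: jform_def power2_eq_square algebra_simps)
  also have "\<dots> \<ge> 0" using assms by simp
  finally show ?thesis using assms by (simp add: field_simps)
qed

text \<open>Now the weight of (x + y)^2 is fixed and that of (x - y)^2 is a multiple of (2 +
  \<beta>)/(2 - \<beta>), which increases in \<beta>. A decreasing coefficient never raises this
  energy, so for Z only the forcing does.\<close>

lemma jform_over_minus_mono:
  assumes "\<beta> < 2" "\<beta>' \<le> \<beta>"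
  shows "jform \<beta>' x y / (2 - \<beta>') \<le> jform \<beta> x y / (2 - \<beta>)"
proof -
  have "jform \<beta> x y * (2 - \<beta>') - jform \<beta>' x y * (2 - \<beta>) = (\<beta> - \<beta>') * (x - y)\<^sup>2"
    by (simp add: jform_def power2_eq_square algebra_simps)
  also have "\<dots> \<ge> 0" using assms by simp
  finally show ?thesis using assms by (simp add: field_simps)
qed

text \<open>Triangle inequality for the seminorm sqrt(jform), in which (0, g) has length
  |g|.\<close>

lemma sqrt_jform_add:
  assumes "0 \<le> \<beta>" "\<beta> \<le> 2"
  shows "sqrt (jform \<beta> x (y + g)) \<le> sqrt (jform \<beta> x y) + \<bar>g\<bar>"
proof -
  define q where "q = jform \<beta> x y"
  have q0: "q \<ge> 0" using jform_nonneg[OF assms] by (simp add: q_def)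
  have "(2 * y - \<beta> * x)\<^sup>2 = 4 * q - (4 - \<beta>\<^sup>2) * x\<^sup>2"
    by (simp add: q_def jform_def power2_eq_square algebra_simps)
  also have "\<dots> \<le> 4 * q"
  proof -
    have "\<beta>\<^sup>2 \<le> 2\<^sup>2" using assms by (intro power_mono) auto
    then show ?thesis by simp
  qed
  finally have "sqrt ((2 * y - \<beta> * x)\<^sup>2) \<le> sqrt (4 * q)" by (rule real_sqrt_le_mono)
  then have d: "\<bar>2 * y - \<beta> * x\<bar> \<le> 2 * sqrt q" by (simp add: real_sqrt_mult)
  have "jform \<beta> x (y + g) = q + g * (2 * y - \<beta> * x) + g\<^sup>2"
    by (simp add: q_def jform_def power2_eq_square algebra_simps)
  also have "\<dots> \<le> q + \<bar>g\<bar> * (2 * sqrt q) + \<bar>g\<bar>\<^sup>2"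
  proof -
    have "g * (2 * y - \<beta> * x) \<le> \<bar>g\<bar> * \<bar>2 * y - \<beta> * x\<bar>" by (simp add: abs_mult[symmetric])
    also have "\<dots> \<le> \<bar>g\<bar> * (2 * sqrt q)" using d by (intro mult_left_mono) auto
    finally show ?thesis by simp
  qed
  also have "\<dots> = (sqrt q + \<bar>g\<bar>)\<^sup>2" using q0 by (simp add: power2_eq_square algebra_simps)
  finally have "sqrt (jform \<beta> x (y + g)) \<le> sqrt ((sqrt q + \<bar>g\<bar>)\<^sup>2)" by (rule real_sqrt_le_mono)
  also have "\<dots> = sqrt q + \<bar>g\<bar>" using q0 by simp
  finally show ?thesis by (simp add: q_def)
qed

text \<open>Left half of the problem: X grows on the indices up to q + 1, and Z is the response to the
  perturbation, normalised to vanish at q + 1 by subtracting a multiple of X.\<close>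

locale half_line =
  fixes X Z b f :: "nat \<Rightarrow> real" and q m :: nat and L S \<rho> :: real
  assumes X0: "X 0 = 0" and X1: "X 1 > 0"
    and recX: "\<And>j. 1 \<le> j \<Longrightarrow> j \<le> m \<Longrightarrow> X (Suc j) = b j * X j - X (j - 1)"
    and Z0: "Z 0 = 0" and Zq: "Z (Suc q) = 0"
    and recZ: "\<And>j. 1 \<le> j \<Longrightarrow> j \<le> m \<Longrightarrow> Z (Suc j) = b j * Z j - Z (j - 1) + f j"
    and qm: "q \<le> m"
    and Xstep: "\<And>j. 1 \<le> j \<Longrightarrow> j \<le> q \<Longrightarrow> X j \<le> X (Suc j)"
    and f_le: "\<And>j. 1 \<le> j \<Longrightarrow> j \<le> m \<Longrightarrow> \<bar>f j\<bar> \<le> 3 * L * \<bar>X j\<bar> + 2 * (\<bar>X (j - 1)\<bar> + \<bar>X (Suc j)\<bar>)"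
    and L4: "L \<ge> 4"
    and S: "\<And>l. l \<le> q \<Longrightarrow> (\<Sum>i=1..l. X i) \<le> S * X l" and S0: "S \<ge> 0"
    and rho: "\<And>l. 1 \<le> l \<Longrightarrow> l \<le> q \<Longrightarrow> 3 * L * X l + 4 * X (Suc l) \<le> \<rho> * X (Suc l)" and rho0: "\<rho> \<ge> 0"
begin

lemma X_mono: "1 \<le> i \<Longrightarrow> i \<le> j \<Longrightarrow> j \<le> Suc q \<Longrightarrow> X i \<le> X j"
proof (induction j)
  case (Suc j)
  show ?case
  proof (cases "i = Suc j")
    case False
    then have "X i \<le> X j" using Suc by auto
    also have "\<dots> \<le> X (Suc j)" using Xstep[of j] Suc.prems False by auto
    finally show ?thesis .
  qed simp
qed simp

lemma X_pos: "1 \<le> j \<Longrightarrow> j \<le> Suc q \<Longrightarrow> X j > 0"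
  using X_mono[of 1 j] X1 by linarith

lemma X_nonneg: "j \<le> Suc q \<Longrightarrow> X j \<ge> 0"
  using X_pos[of j] X0 by (cases j) (auto intro: less_imp_le)

definition "F l = (\<Sum>i=1..l. X i * f i)"

lemma wronskian: "j \<le> m \<Longrightarrow> X j * Z (Suc j) - X (Suc j) * Z j = F j"
  using jacobi_green[where x=X and y=Z and \<beta>="\<lambda>_. 1" and \<alpha>="\<lambda>j. - b j" and \<mu>=0 and \<nu>=0 and g=f and n=j]
    X0 Z0 recX recZ by (auto simp: F_def)

lemma F_le: assumes "l \<le> q" shows "\<bar>F l\<bar> \<le> (3 * L * X l + 4 * X (Suc l)) * (\<Sum>i=1..l. X i)"
proof -
  have "\<bar>F l\<bar> \<le> (\<Sum>i=1..l. \<bar>X i * f i\<bar>)" unfolding F_def by (rule sum_abs)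
  also have "\<dots> \<le> (\<Sum>i=1..l. X i * (3 * L * X l + 4 * X (Suc l)))"
  proof (rule sum_mono)
    fix i assume i: "i \<in> {1..l}"
    have p: "X i > 0" "X (Suc i) > 0" "X (i - 1) \<ge> 0" using i assms X_pos X_nonneg by auto
    have le: "X i \<le> X l" "X (Suc i) \<le> X (Suc l)" using i assms X_mono by auto
    have "X (i - 1) \<le> X (Suc i)"
    proof (cases "i = 1")
      case True then show ?thesis using X0 p by simp
    next
      case False then show ?thesis using i assms by (intro X_mono) auto
    qed
    then have "\<bar>f i\<bar> \<le> 3 * L * X i + 4 * X (Suc i)" using f_le[of i] i assms qm p by auto
    also have "\<dots> \<le> 3 * L * X l + 4 * X (Suc l)" using le L4 by (intro add_mono mult_left_mono) auto
    finally show "\<bar>X i * f i\<bar> \<le> X i * (3 * L * X l + 4 * X (Suc l))"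
      using p by (simp add: abs_mult)
  qed
  finally show ?thesis by (simp add: sum_distrib_right[symmetric] mult.commute)
qed

text \<open>In F l / (X l X (l + 1)) the factor X l absorbs the partial sum of X and X (l + 1) the
  bound on f. The quotient X l / X (l + 1) is kept: it is small where X grows fast, which matters
  when L is large.\<close>

lemma ratio_step:
  assumes "1 \<le> l" "l \<le> q"
  shows "\<bar>Z l / X l - Z (Suc l) / X (Suc l)\<bar> \<le> (3 * L * (X l / X (Suc l)) + 4) * S"
proof -
  have p: "X l > 0" "X (Suc l) > 0" using assms X_pos by auto
  have "Z l / X l - Z (Suc l) / X (Suc l) = - F l / (X l * X (Suc l))"
    using wronskian[of l] assms qm p by (simp add: field_simps)
  then have "\<bar>Z l / X l - Z (Suc l) / X (Suc l)\<bar> = \<bar>F l\<bar> / (X l * X (Suc l))"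
    using p by (simp add: abs_mult)
  also have "\<dots> \<le> (3 * L * X l + 4 * X (Suc l)) * (S * X l) / (X l * X (Suc l))"
  proof (rule divide_right_mono)
    have "(3 * L * X l + 4 * X (Suc l)) * (\<Sum>i=1..l. X i) \<le> (3 * L * X l + 4 * X (Suc l)) * (S * X l)"
      using S[OF assms(2)] p L4 by (intro mult_left_mono) auto
    then show "\<bar>F l\<bar> \<le> (3 * L * X l + 4 * X (Suc l)) * (S * X l)"
      using F_le[OF assms(2)] by linarith
  qed (use p in auto)
  also have "\<dots> = (3 * L * (X l / X (Suc l)) + 4) * S" using p by (simp add: field_simps)
  finally show ?thesis .
qed

lemma ratio_bound:
  assumes "1 \<le> j" "j \<le> Suc q"
  shows "\<bar>Z j / X j\<bar> \<le> (\<Sum>l=j..q. (3 * L * (X l / X (Suc l)) + 4) * S)"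
  using assms(2,1)
proof (induction rule: inc_induct)
  case base
  then show ?case using Zq by simp
next
  case (step j)
  have "{j..q} = insert j {Suc j..q}" using step by auto
  then have "(\<Sum>l=j..q. (3 * L * (X l / X (Suc l)) + 4) * S)
     = (3 * L * (X j / X (Suc j)) + 4) * S + (\<Sum>l=Suc j..q. (3 * L * (X l / X (Suc l)) + 4) * S)"
    by simp
  moreover have "\<bar>Z j / X j - Z (Suc j) / X (Suc j)\<bar> \<le> (3 * L * (X j / X (Suc j)) + 4) * S"
    using step by (intro ratio_step) auto
  moreover have "\<bar>Z (Suc j) / X (Suc j)\<bar> \<le> (\<Sum>l=Suc j..q. (3 * L * (X l / X (Suc l)) + 4) * S)"
    using step by auto
  ultimately show ?case by linarith
qed

lemma rho_step:
  assumes "1 \<le> l" "l \<le> q"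
  shows "(3 * L * (X l / X (Suc l)) + 4) * S \<le> \<rho> * S"
proof -
  have p: "X (Suc l) > 0" using assms X_pos by auto
  have "3 * L * (X l / X (Suc l)) + 4 = (3 * L * X l + 4 * X (Suc l)) / X (Suc l)"
    using p by (simp add: field_simps)
  also have "\<dots> \<le> \<rho>" using rho[OF assms] p by (simp add: field_simps)
  finally show ?thesis using S0 by (rule mult_right_mono)
qed

text \<open>The number of steps from j to q + 1 is kept as an inner sum. Exchanging the summations
  turns it into sums of (X j)^2 over j \<le> l, again controlled through S, so the price is a second
  factor S rather than q.\<close>

lemma inner_left: "(\<Sum>j=1..q. \<bar>X j * Z j\<bar>) \<le> \<rho> * S\<^sup>2 * (\<Sum>j=1..q. (X j)\<^sup>2)"
proof -
  have "(\<Sum>j=1..q. \<bar>X j * Z j\<bar>) \<le> (\<Sum>j=1..q. \<Sum>l | l \<in> {1..q} \<and> j \<le> l. (X j)\<^sup>2 * (\<rho> * S))"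
  proof (rule sum_mono)
    fix j assume j: "j \<in> {1..q}"
    have p: "X j > 0" using j X_pos by auto
    have e: "{l. l \<in> {1..q} \<and> j \<le> l} = {j..q}" using j by auto
    have "(\<Sum>l=j..q. (3 * L * (X l / X (Suc l)) + 4) * S) \<le> (\<Sum>l=j..q. \<rho> * S)"
      using j by (intro sum_mono rho_step) auto
    then have "\<bar>Z j / X j\<bar> \<le> (\<Sum>l=j..q. \<rho> * S)"
      using ratio_bound[of j] j by (intro order_trans[OF ratio_bound]) auto
    then have "(X j)\<^sup>2 * \<bar>Z j / X j\<bar> \<le> (X j)\<^sup>2 * (\<Sum>l=j..q. \<rho> * S)" by (rule mult_left_mono) simp
    then show "\<bar>X j * Z j\<bar> \<le> (\<Sum>l | l \<in> {1..q} \<and> j \<le> l. (X j)\<^sup>2 * (\<rho> * S))"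
      unfolding e using p by (simp add: abs_mult power2_eq_square sum_distrib_left mult_ac)
  qed
  also have "\<dots> = (\<Sum>l=1..q. \<Sum>j | j \<in> {1..q} \<and> j \<le> l. (X j)\<^sup>2 * (\<rho> * S))"
    by (rule sum.swap_restrict) auto
  also have "\<dots> \<le> (\<Sum>l=1..q. \<rho> * S * (S * (X l)\<^sup>2))"
  proof (rule sum_mono)
    fix l assume l: "l \<in> {1..q}"
    have e: "{j. j \<in> {1..q} \<and> j \<le> l} = {1..l}" using l by auto
    have "(\<Sum>j=1..l. (X j)\<^sup>2) \<le> (\<Sum>j=1..l. X l * X j)"
      using l by (intro sum_mono) (auto simp: power2_eq_square intro!: mult_right_mono X_mono X_nonneg)
    also have "\<dots> = X l * (\<Sum>j=1..l. X j)" by (simp add: sum_distrib_left)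
    also have "\<dots> \<le> X l * (S * X l)" using l S[of l] X_nonneg[of l] by (intro mult_left_mono) auto
    finally have "(\<Sum>j=1..l. (X j)\<^sup>2) \<le> S * (X l)\<^sup>2" by (simp add: power2_eq_square mult_ac)
    then show "(\<Sum>j | j \<in> {1..q} \<and> j \<le> l. (X j)\<^sup>2 * (\<rho> * S)) \<le> \<rho> * S * (S * (X l)\<^sup>2)"
      unfolding e sum_distrib_right[symmetric] using rho0 S0
      by (subst mult.commute) (intro mult_left_mono mult_nonneg_nonneg)
  qed
  also have "\<dots> = \<rho> * S\<^sup>2 * (\<Sum>j=1..q. (X j)\<^sup>2)"
    by (simp add: sum_distrib_left power2_eq_square mult_ac)
  finally show ?thesis .
qed

lemma turn_q: "\<bar>Z q\<bar> \<le> \<rho> * S * X q"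
proof (cases "q = 0")
  case False
  have p: "X q > 0" using False X_pos by auto
  have "\<bar>Z q / X q\<bar> \<le> \<rho> * S"
    using ratio_bound[of q] rho_step[of q] False by auto
  then show ?thesis using p by (simp add: field_simps)
qed (use X0 Z0 in auto)

end

text \<open>Between q + 1 and m the solution oscillates. The energy jform b of X divided by 2 + b is nondecreasing,
  the energy of Z divided by 2 - b grows only through f; comparing the two bounds Z by X without any
  information on spectral gaps.\<close>

locale half_line_osc = half_line +
  fixes H :: real
  assumes b0: "\<And>j. 1 \<le> j \<Longrightarrow> j \<le> m \<Longrightarrow> 0 \<le> b j"
    and b_step: "\<And>j. q < j \<Longrightarrow> j < m \<Longrightarrow> b (Suc j) \<le> b j"
    and H0: "H > 0"
    and sH: "\<And>j. q < j \<Longrightarrow> j \<le> m \<Longrightarrow> 2 - b j \<ge> H * (real j - real q - 1)"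
begin

text \<open>Bound for the first value of Z after its zero at q + 1: (3 L + 4) S from the Wronskian
  sum up to q and 3 L + 6 from the forcing at q + 1, rounded up with L \<ge> 4.\<close>

definition "G = 5 * L * (S + 1)"

lemma G0: "G \<ge> 0" using L4 S0 by (simp add: G_def)

lemma b2: "q < j \<Longrightarrow> j \<le> m \<Longrightarrow> b j \<le> 2"
proof -
  assume *: "q < j" "j \<le> m"
  then have "0 \<le> H * (real j - real q - 1)" using H0 by (intro mult_nonneg_nonneg) auto
  then show "b j \<le> 2" using sH[OF *] by linarith
qed

lemma turn_Suc_q:
  assumes "q < m"
  shows "\<bar>Z (Suc (Suc q))\<bar> \<le> G * X (Suc q)"
proof -
  have p: "X (Suc q) > 0" "X q \<ge> 0" using X_pos X_nonneg by auto
  have le: "X q \<le> X (Suc q)"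
    using Xstep[of q] X0 p by (cases "q = 0") auto
  have bb: "0 \<le> b (Suc q)" "b (Suc q) \<le> 2" using b0[of "Suc q"] b2[of "Suc q"] assms by auto
  have x2: "X (Suc (Suc q)) = b (Suc q) * X (Suc q) - X q" using recX[of "Suc q"] assms by simp
  have "\<bar>b (Suc q) * X (Suc q)\<bar> \<le> 2 * X (Suc q)" using bb p by (simp add: abs_mult mult_right_mono)
  then have x2b: "\<bar>X (Suc (Suc q))\<bar> \<le> 2 * X (Suc q)" 
    using bb p le unfolding x2 by (smt (verit) mult_nonneg_nonneg)
  have f1: "\<bar>f (Suc q)\<bar> \<le> (3 * L + 6) * X (Suc q)"
    using f_le[of "Suc q"] assms p le x2b by (simp add: algebra_simps)
  have "\<bar>F q\<bar> \<le> (3 * L * X q + 4 * X (Suc q)) * (S * X q)"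
    using F_le[of q] S[of q] p L4 by (auto intro!: order_trans[OF F_le] mult_left_mono)
  also have "\<dots> \<le> (3 * L * X (Suc q) + 4 * X (Suc q)) * (S * X (Suc q))"
    using le p L4 S0 by (intro mult_mono add_mono mult_left_mono mult_nonneg_nonneg) auto
  finally have Fq: "\<bar>F q\<bar> \<le> (3 * L + 4) * S * (X (Suc q))\<^sup>2" by (simp add: power2_eq_square algebra_simps)
  have "X (Suc q) * Z (Suc (Suc q)) = F q + X (Suc q) * f (Suc q)"
    using wronskian[of "Suc q"] assms Zq by (simp add: F_def)
  then have "X (Suc q) * \<bar>Z (Suc (Suc q))\<bar> \<le> \<bar>F q\<bar> + X (Suc q) * \<bar>f (Suc q)\<bar>"
    using p by (metis abs_mult abs_of_pos abs_triangle_ineq)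
  also have "\<dots> \<le> (3 * L + 4) * S * (X (Suc q))\<^sup>2 + X (Suc q) * ((3 * L + 6) * X (Suc q))"
    using Fq f1 p by (intro add_mono mult_left_mono) auto
  also have "\<dots> = ((3 * L + 4) * S + (3 * L + 6)) * (X (Suc q))\<^sup>2" by (simp add: power2_eq_square algebra_simps)
  also have "\<dots> \<le> G * (X (Suc q))\<^sup>2"
  proof (rule mult_right_mono)
    have "(3 * L + 4) * S \<le> 5 * L * S" using L4 S0 by (intro mult_right_mono) auto
    then show "(3 * L + 4) * S + (3 * L + 6) \<le> G" using L4 by (simp add: G_def algebra_simps)
  qed simp
  finally show ?thesis using p by (simp add: power2_eq_square)
qed

definition "v i = sqrt (jform (b i) (X (i - 1)) (X i) / (2 + b i))"

text \<open>Amplitude ratio of Z and X along the oscillating range: the initial value at q + 2, then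
  a gain of 12 L / (2 - b l) per index caused by the forcing.\<close>

definition "\<kappa> i = 3 * G / H + 12 * L * (\<Sum>l=q+2..<i. 1 / (2 - b l))"

lemma b_lt2: "q + 2 \<le> i \<Longrightarrow> i \<le> m \<Longrightarrow> b i < 2"
proof -
  assume *: "q + 2 \<le> i" "i \<le> m"
  then have "0 < H * (real i - real q - 1)" using H0 by (intro mult_pos_pos) auto
  then show "b i < 2" using sH[of i] * by linarith
qed

lemma v_nonneg: "1 \<le> i \<Longrightarrow> q < i \<Longrightarrow> i \<le> m \<Longrightarrow> 0 \<le> v i"
  using jform_nonneg[of "b i"] b0[of i] b2[of i] by (auto simp: v_def)

lemma X_le_v:
  assumes "q + 2 \<le> i" "i \<le> m"
  shows "\<bar>X (i - 1)\<bar> \<le> 3 * v i / sqrt (2 - b i)" "\<bar>X i\<bar> \<le> 3 * v i / sqrt (2 - b i)"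
    "\<bar>X (Suc i)\<bar> \<le> 3 * v i / sqrt (2 - b i)"
proof -
  have b: "0 \<le> b i" "b i < 2" using assms b0 b_lt2 by auto
  have v0: "0 \<le> v i" using v_nonneg assms by auto
  have q0: "jform (b i) (X (i - 1)) (X i) \<ge> 0" using jform_nonneg b by simp
  have Q: "jform (b i) (X (i - 1)) (X i) = (v i)\<^sup>2 * (2 + b i)"
    using b q0 by (simp add: v_def)
  have Q': "jform (b i) (X i) (X (Suc i)) = (v i)\<^sup>2 * (2 + b i)"
    using recX[of i] assms jform_step[of "b i" "X i" "X (i - 1)"] Q by simp
  have *: "\<bar>x\<bar> \<le> 3 * v i / sqrt (2 - b i)" if "(2 - b i) / 2 * x\<^sup>2 \<le> (v i)\<^sup>2 * (2 + b i)" for x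
  proof -
    have "(2 - b i) / 2 * x\<^sup>2 \<le> (v i)\<^sup>2 * 4"
      using that b by (elim order_trans) (auto intro!: mult_left_mono)
    moreover have "(2 - b i) / 2 * x\<^sup>2 = x\<^sup>2 * (2 - b i) / 2" by simp
    \<comment> \<open>The inequalities give 8; rounding up to 9 makes the square root
      rational.\<close>
    ultimately have "x\<^sup>2 * (2 - b i) \<le> 9 * (v i)\<^sup>2" using zero_le_power2[of "v i"] by linarith
    then have "sqrt (x\<^sup>2 * (2 - b i)) \<le> sqrt (9 * (v i)\<^sup>2)" by (rule real_sqrt_le_mono)
    then have "\<bar>x\<bar> * sqrt (2 - b i) \<le> 3 * v i" using v0 by (simp add: real_sqrt_mult)
    then show ?thesis using b by (simp add: field_simps)
  qed
  show "\<bar>X (i - 1)\<bar> \<le> 3 * v i / sqrt (2 - b i)" "\<bar>X i\<bar> \<le> 3 * v i / sqrt (2 - b i)"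
    "\<bar>X (Suc i)\<bar> \<le> 3 * v i / sqrt (2 - b i)"
    using jform_lower(1)[of "b i" "X (i - 1)" "X i"] jform_lower(2)[of "b i" "X i" "X (i - 1)"]
      jform_lower(2)[of "b i" "X (Suc i)" "X i"] b Q Q' by (auto intro!: *)
qed

lemma kappa_nonneg:
  assumes "i \<le> Suc m"
  shows "\<kappa> i \<ge> 0"
proof -
  have "0 \<le> (\<Sum>l=q+2..<i. 1 / (2 - b l))"
    using assms by (intro sum_nonneg) (use b2 in fastforce)
  then show ?thesis using G0 H0 L4 by (simp add: \<kappa>_def)
qed

text \<open>The homogeneous step preserves the energy of Z, and the forcing adds at most |f i| to
  its square root. Since |f i| is O(L v i / sqrt (2 - b i)) and the normalisation contributes
  another 1 / sqrt (2 - b i), the gain relative to v i is of order L / (2 - b i).\<close>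

lemma osc_step:
  assumes i: "q + 2 \<le> i" "i \<le> m"
    and "sqrt (jform (b i) (Z (i - 1)) (Z i) / (2 - b i)) \<le> \<kappa> i * v i"
  shows "sqrt (jform (b i) (Z i) (Z (Suc i)) / (2 - b i)) \<le> \<kappa> (Suc i) * v i"
proof -
  have b: "0 \<le> b i" "b i < 2" using i b0 b_lt2 by auto
  define s where "s = sqrt (2 - b i)"
  have s: "s > 0" "s\<^sup>2 = 2 - b i" using b by (auto simp: s_def)
  have v0: "0 \<le> v i" using v_nonneg i by auto
  define w where "w = 3 * v i / s"
  have w: "\<bar>X (i - 1)\<bar> \<le> w" "\<bar>X i\<bar> \<le> w" "\<bar>X (Suc i)\<bar> \<le> w" "w \<ge> 0"
    using X_le_v[OF i] v0 s by (auto simp: w_def s_def)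
  have "\<bar>f i\<bar> \<le> 3 * L * \<bar>X i\<bar> + 2 * (\<bar>X (i - 1)\<bar> + \<bar>X (Suc i)\<bar>)" using f_le i by auto
  also have "\<dots> \<le> 3 * L * w + 2 * (w + w)"
    using w L4 by (intro add_mono mult_left_mono) auto
  also have "\<dots> = (3 * L + 4) * w" by (simp add: algebra_simps)
  also have "\<dots> \<le> (4 * L) * w" using L4 w by (intro mult_right_mono) auto
  finally have f: "\<bar>f i\<bar> \<le> 12 * L * v i / s" by (simp add: w_def)
  have "Z (Suc i) = (b i * Z i - Z (i - 1)) + f i" using recZ i by auto
  then have "sqrt (jform (b i) (Z i) (Z (Suc i))) \<le> sqrt (jform (b i) (Z (i - 1)) (Z i)) + \<bar>f i\<bar>"
    using sqrt_jform_add[of "b i" "Z i" "b i * Z i - Z (i - 1)" "f i"] b jform_step by simp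
  then have "sqrt (jform (b i) (Z i) (Z (Suc i))) / s \<le> (sqrt (jform (b i) (Z (i - 1)) (Z i)) + \<bar>f i\<bar>) / s"
    using s by (intro divide_right_mono) auto
  also have "\<dots> \<le> \<kappa> i * v i + (12 * L * v i / s) / s"
  proof -
    have "sqrt (jform (b i) (Z (i - 1)) (Z i)) / s \<le> \<kappa> i * v i"
      using assms(3) by (simp add: real_sqrt_divide s_def)
    moreover have "\<bar>f i\<bar> / s \<le> (12 * L * v i / s) / s" using f s by (intro divide_right_mono) auto
    ultimately show ?thesis unfolding add_divide_distrib by (rule add_mono)
  qed
  also have "\<dots> = (\<kappa> i + 12 * L * (1 / (2 - b i))) * v i"
    using s by (simp add: power2_eq_square[symmetric] algebra_simps)
  also have "\<dots> = \<kappa> (Suc i) * v i" using i by (simp add: \<kappa>_def algebra_simps)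
  finally show ?thesis by (simp add: real_sqrt_divide s_def)
qed

lemma osc_bound:
  assumes "q + 2 \<le> i" "i \<le> m"
  shows "sqrt (jform (b i) (Z (i - 1)) (Z i) / (2 - b i)) \<le> \<kappa> i * v i"
  using assms
proof (induction i rule: dec_induct)
  case base
  let ?i = "q + 2"
  have b: "0 \<le> b ?i" "b ?i < 2" using base b0 b_lt2 by auto
  have v0: "0 \<le> v ?i" using v_nonneg base by auto
  have sH': "2 - b ?i \<ge> H" using sH[of ?i] base by simp
  have "sqrt (jform (b ?i) (Z (?i - 1)) (Z ?i) / (2 - b ?i)) = \<bar>Z ?i\<bar> / sqrt (2 - b ?i)"
    using Zq by (simp add: jform_def real_sqrt_divide)
  also have "\<dots> \<le> G * (3 * v ?i / sqrt (2 - b ?i)) / sqrt (2 - b ?i)"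
  proof (rule divide_right_mono)
    have "\<bar>Z ?i\<bar> \<le> G * \<bar>X (Suc q)\<bar>" using turn_Suc_q X_pos[of "Suc q"] base by simp
    also have "\<dots> \<le> G * (3 * v ?i / sqrt (2 - b ?i))"
      using X_le_v(1)[of ?i] base G0 by (intro mult_left_mono) auto
    finally show "\<bar>Z ?i\<bar> \<le> G * (3 * v ?i / sqrt (2 - b ?i))" .
  qed (use b in auto)
  also have "\<dots> = 3 * G * v ?i / (2 - b ?i)" using b by simp
  also have "\<dots> \<le> 3 * G * v ?i / H" using sH' H0 G0 v0 by (intro divide_left_mono) auto
  also have "\<dots> = \<kappa> ?i * v ?i" by (simp add: \<kappa>_def)
  finally show ?case .
next
  case (step i)
  have i: "q + 2 \<le> i" "i \<le> m" "i < m" using step by auto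
  have b: "0 \<le> b i" "b i < 2" "0 \<le> b (Suc i)" "b (Suc i) \<le> b i"
    using i b0 b_lt2 b_step by auto
  \<comment> \<open>Passing from b i to b (i + 1) lowers the normalised energy of Z and raises v,
    both in favour of the bound.\<close>
  have "sqrt (jform (b (Suc i)) (Z i) (Z (Suc i)) / (2 - b (Suc i)))
      \<le> sqrt (jform (b i) (Z i) (Z (Suc i)) / (2 - b i))"
    using jform_over_minus_mono b by (intro real_sqrt_le_mono) auto
  also have "\<dots> \<le> \<kappa> (Suc i) * v i" by (rule osc_step) (use i step in auto)
  also have "\<dots> \<le> \<kappa> (Suc i) * v (Suc i)"
  proof (rule mult_left_mono)
    have "jform (b i) (X (i - 1)) (X i) = jform (b i) (X i) (X (Suc i))"
      using recX[of i] i jform_step[of "b i" "X i" "X (i - 1)"] by simp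
    then show "v i \<le> v (Suc i)"
      using jform_over_plus_antimono[of "b (Suc i)" "b i" "X i" "X (Suc i)"] b
      by (auto simp: v_def intro!: real_sqrt_le_mono)
  qed (use kappa_nonneg i in auto)
  finally show ?case by simp
qed

definition "K = G + 3 * G / H + 12 * (L / H) * (1 + \<bar>ln (2 / H)\<bar>)"

text \<open>As 2 - b l grows at least linearly with slope H, the sum is harmonic with factor 1 / H;
  as b stays nonnegative, 2 - b l never exceeds 2, so there are at most 2 / H terms. This puts ln (2
  / H) into \<open>K\<close>.\<close>

lemma kappa_le: assumes "i \<le> m" shows "\<kappa> (Suc i) \<le> K"
proof -
  have "(\<Sum>l=q+2..<Suc i. 1 / (2 - b l)) \<le> (\<Sum>l=q+2..<Suc i. (1 / H) * (1 / real (l - (q + 1))))"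
  proof (rule sum_mono)
    fix l assume l: "l \<in> {q+2..<Suc i}"
    have "H * real (l - (q + 1)) \<le> 2 - b l" using sH[of l] l assms by (simp add: of_nat_diff algebra_simps)
    moreover have "H * real (l - (q + 1)) > 0" using H0 l by simp
    ultimately show "1 / (2 - b l) \<le> (1 / H) * (1 / real (l - (q + 1)))"
      using frac_le[of 1 1 "H * real (l - (q + 1))" "2 - b l"] by (simp del: of_nat_diff)
  qed
  also have "\<dots> = (1 / H) * (\<Sum>l=q+2..<Suc i. 1 / real (l - (q + 1)))" by (rule sum_distrib_left[symmetric])
  also have "(\<Sum>l=q+2..<Suc i. 1 / real (l - (q + 1))) = (\<Sum>r=1..i-(q+1). 1 / real r)"
    by (rule sum.reindex_bij_witness[where i="\<lambda>r. r + (q + 1)" and j="\<lambda>l. l - (q + 1)"]) auto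
  also have "(1 / H) * \<dots> \<le> (1 / H) * (1 + \<bar>ln (2 / H)\<bar>)"
  proof (rule mult_left_mono)
    have "(\<Sum>r=1..i-(q+1). 1 / real r) \<le> 1 + ln (real (i - (q + 1)))" by (rule harmonic_le)
    also have "ln (real (i - (q + 1))) \<le> \<bar>ln (2 / H)\<bar>"
    proof (cases "i - (q + 1) = 0")
      case False
      have "H * real (i - (q + 1)) \<le> 2" using sH[of i] b0[of i] False assms by (auto simp: of_nat_diff algebra_simps)
      then have "real (i - (q + 1)) \<le> 2 / H" using H0 by (simp add: field_simps)
      then have "ln (real (i - (q + 1))) \<le> ln (2 / H)" using False by (intro ln_mono) auto
      then show ?thesis by simp
    \<comment> \<open>The sum is empty here, and \<open>ln 0\<close> is 0.\<close>
    qed (simp add: ln_real_def)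
    finally show "(\<Sum>r=1..i-(q+1). 1 / real r) \<le> 1 + \<bar>ln (2 / H)\<bar>" by simp
  qed (use H0 in auto)
  finally have "12 * L * (\<Sum>l=q+2..<Suc i. 1 / (2 - b l)) \<le> 12 * L * ((1 / H) * (1 + \<bar>ln (2 / H)\<bar>))"
    using L4 by (intro mult_left_mono) auto
  then show ?thesis using G0 by (simp add: \<kappa>_def K_def)
qed

lemma K_ge_G: "G \<le> K" "0 \<le> K"
proof -
  have "0 \<le> 3 * G / H + 12 * (L / H) * (1 + \<bar>ln (2 / H)\<bar>)" using G0 H0 L4 by (intro add_nonneg_nonneg mult_nonneg_nonneg) auto
  then show "G \<le> K" by (simp add: K_def)
  then show "0 \<le> K" using G0 by simp
qed

text \<open>At coefficient 0 the two normalised energies of a pair coincide: both are half its sum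
  of squares. Since b i \<ge> 0, lowering the coefficient to 0 decreases the energy of Z and
  increases that of X, so both normalisations disappear from the comparison.\<close>

lemma amplitude:
  assumes "q < i" "i \<le> m"
  shows "(Z i)\<^sup>2 + (Z (Suc i))\<^sup>2 \<le> K\<^sup>2 * ((X i)\<^sup>2 + (X (Suc i))\<^sup>2)"
proof (cases "i = Suc q")
  case True
  have "\<bar>Z (Suc i)\<bar> \<le> K * X i"
  proof -
    have "\<bar>Z (Suc i)\<bar> \<le> G * X i" using turn_Suc_q assms True by simp
    also have "\<dots> \<le> K * X i" using K_ge_G X_pos[of "Suc q"] True by (intro mult_right_mono) auto
    finally show ?thesis .
  qed
  then have "\<bar>Z (Suc i)\<bar>\<^sup>2 \<le> (K * X i)\<^sup>2" by (rule power_mono) simp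
  moreover have "0 \<le> K\<^sup>2 * (X (Suc i))\<^sup>2" by simp
  ultimately have "(Z (Suc i))\<^sup>2 \<le> K\<^sup>2 * ((X i)\<^sup>2 + (X (Suc i))\<^sup>2)"
    by (simp only: power2_abs power_mult_distrib distrib_left)
  then show ?thesis using True Zq by simp
next
  case False
  then have i: "q + 2 \<le> i" "i \<le> m" using assms by auto
  have b: "0 \<le> b i" "b i < 2" using i b0 b_lt2 by auto
  have v0: "0 \<le> v i" using v_nonneg i by auto
  have "sqrt (jform (b i) (Z i) (Z (Suc i)) / (2 - b i)) \<le> K * v i"
    by (rule order_trans[OF osc_step[OF i osc_bound[OF i]]]) (use kappa_le i v0 in \<open>auto intro!: mult_right_mono\<close>)
  then have "jform (b i) (Z i) (Z (Suc i)) / (2 - b i) \<le> (K * v i)\<^sup>2"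
    by (rule sqrt_le_D)
  moreover have "jform 0 (Z i) (Z (Suc i)) / (2 - 0) \<le> jform (b i) (Z i) (Z (Suc i)) / (2 - b i)"
    using b by (intro jform_over_minus_mono) auto
  ultimately have "jform 0 (Z i) (Z (Suc i)) / (2 - 0) \<le> (K * v i)\<^sup>2" by (rule order_trans[rotated])
  then have "(Z i)\<^sup>2 + (Z (Suc i))\<^sup>2 \<le> 2 * (K * v i)\<^sup>2" by (simp add: jform_def)
  also have "\<dots> = K\<^sup>2 * (2 * (v i)\<^sup>2)" by (simp add: power_mult_distrib)
  also have "\<dots> \<le> K\<^sup>2 * ((X i)\<^sup>2 + (X (Suc i))\<^sup>2)"
  proof (rule mult_left_mono)
    have "(v i)\<^sup>2 = jform (b i) (X (i - 1)) (X i) / (2 + b i)"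
      using jform_nonneg[of "b i"] b by (simp add: v_def)
    also have "\<dots> = jform (b i) (X i) (X (Suc i)) / (2 + b i)"
      using recX[of i] i jform_step[of "b i" "X i" "X (i - 1)"] by simp
    also have "\<dots> \<le> jform 0 (X i) (X (Suc i)) / (2 + 0)"
      using b by (intro jform_over_plus_antimono) auto
    finally show "2 * (v i)\<^sup>2 \<le> (X i)\<^sup>2 + (X (Suc i))\<^sup>2" by (simp add: jform_def)
  qed simp
  finally show ?thesis .
qed

lemma inner_right: "(\<Sum>j=Suc q..m. \<bar>X j * Z j\<bar>) \<le> 2 * K * (\<Sum>j=1..m. (X j)\<^sup>2)"
proof -
  have "(\<Sum>j=Suc q..m. \<bar>X j * Z j\<bar>) \<le> (\<Sum>j=Suc q..m. K * ((X (j - 1))\<^sup>2 + (X j)\<^sup>2))"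
  proof (rule sum_mono)
    fix j assume j: "j \<in> {Suc q..m}"
    show "\<bar>X j * Z j\<bar> \<le> K * ((X (j - 1))\<^sup>2 + (X j)\<^sup>2)"
    proof (cases "j = Suc q")
      case True
      then show ?thesis using Zq K_ge_G by simp
    next
      case False
      define R where "R = (X (j - 1))\<^sup>2 + (X j)\<^sup>2"
      have R: "R \<ge> 0" by (simp add: R_def)
      have "(Z (j - 1))\<^sup>2 + (Z j)\<^sup>2 \<le> K\<^sup>2 * R"
        using amplitude[of "j - 1"] j False by (auto simp: R_def)
      then have "(Z j)\<^sup>2 \<le> K\<^sup>2 * R" using zero_le_power2[of "Z (j - 1)"] by linarith
      moreover have "(X j)\<^sup>2 \<le> R" by (simp add: R_def)
      ultimately have "(X j)\<^sup>2 * (Z j)\<^sup>2 \<le> R * (K\<^sup>2 * R)" using R by (intro mult_mono) auto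
      then have "(X j * Z j)\<^sup>2 \<le> (K * R)\<^sup>2" by (simp add: power2_eq_square mult_ac)
      then have "\<bar>X j * Z j\<bar> \<le> \<bar>K * R\<bar>" by (simp only: abs_le_square_iff)
      then show ?thesis using K_ge_G(2) R by (simp add: R_def)
    qed
  qed
  also have "\<dots> = K * ((\<Sum>j=Suc q..m. (X (j - 1))\<^sup>2) + (\<Sum>j=Suc q..m. (X j)\<^sup>2))"
    by (simp only: sum_distrib_left sum.distrib[symmetric] distrib_left)
  finally have 1: "(\<Sum>j=Suc q..m. \<bar>X j * Z j\<bar>)
    \<le> K * ((\<Sum>j=Suc q..m. (X (j - 1))\<^sup>2) + (\<Sum>j=Suc q..m. (X j)\<^sup>2))" .
  have 2: "(\<Sum>j=Suc q..m. (X (j - 1))\<^sup>2) \<le> (\<Sum>j=1..m. (X j)\<^sup>2)"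
  proof -
    have "(\<Sum>j=Suc q..m. (X (j - 1))\<^sup>2) \<le> (\<Sum>j=1..m. (X (j - 1))\<^sup>2)"
      by (rule sum_mono2) auto
    also have "\<dots> = (\<Sum>j<m. (X j)\<^sup>2)" by (rule sum.reindex_bij_witness[where i=Suc and j="\<lambda>j. j - 1"]) auto
    also have "\<dots> \<le> (\<Sum>j\<in>{0..m}. (X j)\<^sup>2)" by (rule sum_mono2) auto
    also have "\<dots> = (\<Sum>j=1..m. (X j)\<^sup>2)" using X0 by (simp add: sum.atLeast_Suc_atMost)
    finally show ?thesis .
  qed
  have 3: "(\<Sum>j=Suc q..m. (X j)\<^sup>2) \<le> (\<Sum>j=1..m. (X j)\<^sup>2)"
    by (rule sum_mono2) auto
  have "K * ((\<Sum>j=Suc q..m. (X (j - 1))\<^sup>2) + (\<Sum>j=Suc q..m. (X j)\<^sup>2))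
    \<le> K * ((\<Sum>j=1..m. (X j)\<^sup>2) + (\<Sum>j=1..m. (X j)\<^sup>2))"
    using K_ge_G(2) 2 3 by (intro mult_left_mono add_mono)
  then show ?thesis using 1 by simp
qed

lemma inner_bound: "(\<Sum>j=1..m. \<bar>X j * Z j\<bar>) \<le> (\<rho> * S\<^sup>2 + 2 * K) * (\<Sum>j=1..m. (X j)\<^sup>2)"
proof -
  have "(\<Sum>j=1..m. \<bar>X j * Z j\<bar>) = (\<Sum>j=1..q. \<bar>X j * Z j\<bar>) + (\<Sum>j=Suc q..m. \<bar>X j * Z j\<bar>)"
    using qm by (subst sum.union_disjoint[symmetric]) (auto intro!: sum.cong)
  also have "\<dots> \<le> \<rho> * S\<^sup>2 * (\<Sum>j=1..m. (X j)\<^sup>2) + 2 * K * (\<Sum>j=1..m. (X j)\<^sup>2)"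
    using qm rho0 by (intro add_mono inner_right order_trans[OF inner_left] mult_left_mono sum_mono2) auto
  finally show ?thesis by (simp add: algebra_simps)
qed

lemma end_bound: "(Z m)\<^sup>2 + (Z (Suc m))\<^sup>2 \<le> (\<rho> * S + K)\<^sup>2 * ((X m)\<^sup>2 + (X (Suc m))\<^sup>2)"
proof (cases "q = m")
  \<comment> \<open>No oscillating index at all: Z (m + 1) vanishes and Z m is bounded from the
    growing side.\<close>
  case True
  have "\<bar>Z m\<bar> \<le> (\<rho> * S + K) * \<bar>X m\<bar>"
  proof -
    have "\<bar>Z m\<bar> \<le> \<rho> * S * X m" using turn_q True by simp
    also have "\<dots> \<le> (\<rho> * S + K) * X m" using K_ge_G X_nonneg[of q] True by (intro mult_right_mono) auto
    finally show ?thesis using X_nonneg[of q] True by simp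
  qed
  then have "\<bar>Z m\<bar>\<^sup>2 \<le> ((\<rho> * S + K) * \<bar>X m\<bar>)\<^sup>2" by (rule power_mono) simp
  moreover have "0 \<le> (\<rho> * S + K)\<^sup>2 * (X (Suc m))\<^sup>2" by simp
  ultimately have "(Z m)\<^sup>2 \<le> (\<rho> * S + K)\<^sup>2 * ((X m)\<^sup>2 + (X (Suc m))\<^sup>2)"
    by (simp only: power2_abs power_mult_distrib distrib_left)
  then show ?thesis using True Zq by simp
next
  case False
  have "(Z m)\<^sup>2 + (Z (Suc m))\<^sup>2 \<le> K\<^sup>2 * ((X m)\<^sup>2 + (X (Suc m))\<^sup>2)"
    using amplitude[of m] False qm by simp
  also have "\<dots> \<le> (\<rho> * S + K)\<^sup>2 * ((X m)\<^sup>2 + (X (Suc m))\<^sup>2)"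
    using rho0 S0 K_ge_G(2) by (intro mult_right_mono power_mono) auto
  finally show ?thesis .
qed

end

section \<open>Growth in the forbidden region\<close>

locale forbidden_region =
  fixes X b :: "nat \<Rightarrow> real" and q :: nat
  assumes X0: "X 0 = 0" and X1: "X 1 > 0"
    and recX: "\<And>j. 1 \<le> j \<Longrightarrow> j \<le> q \<Longrightarrow> X (Suc j) = b j * X j - X (j - 1)"
    and b2: "\<And>j. 1 \<le> j \<Longrightarrow> j \<le> q \<Longrightarrow> 2 \<le> b j"
    and b_anti: "\<And>i j. 1 \<le> i \<Longrightarrow> i \<le> j \<Longrightarrow> j \<le> q \<Longrightarrow> b j \<le> b i"
begin

text \<open>The quotient r of consecutive values obeys r' = 2 + s^2 - 1 / r with s = sqrt (b - 2).
  The bound r \<ge> 1 + s survives because (1 + s)(1 - s + s^2) = 1 + s^3 \<ge> 1 and s does not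
  increase along the indices.\<close>

lemma growth_sqrt: "1 \<le> j \<Longrightarrow> j \<le> q \<Longrightarrow> X j > 0 \<and> (1 + sqrt (b j - 2)) * X j \<le> X (Suc j)"
proof (induction j rule: nat_induct_at_least)
  case base
  define s where "s = sqrt (b 1 - 2)"
  have s: "s \<ge> 0" "b 1 = 2 + s\<^sup>2" using b2[of 1] base by (auto simp: s_def)
  have "X 2 = (2 + s\<^sup>2) * X 1" using recX[of 1] base X0 s by (simp add: numeral_2_eq_2)
  moreover have "1 + s \<le> 2 + s\<^sup>2"
    using zero_le_power2[of "s - 1/2"] by (simp add: power2_eq_square algebra_simps)
  ultimately show ?case using X1 by (simp add: s_def numeral_2_eq_2)
next
  case (Suc j)
  have IH: "X j > 0" "(1 + sqrt (b j - 2)) * X j \<le> X (Suc j)" using Suc by auto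
  define s where "s = sqrt (b (Suc j) - 2)"
  have s: "s \<ge> 0" "b (Suc j) = 2 + s\<^sup>2" using b2[of "Suc j"] Suc by (auto simp: s_def)
  have "s \<le> sqrt (b j - 2)" using b_anti[of j "Suc j"] Suc by (auto simp: s_def)
  then have 1: "(1 + s) * X j \<le> X (Suc j)"
    using IH by (elim order_trans[rotated]) (intro mult_right_mono, auto)
  have pos: "X (Suc j) > 0" using 1 IH s by (smt (verit) mult_pos_pos)
  have "(1 + s) * ((1 + s) * X (Suc j)) \<le> (1 + s) * ((2 + s\<^sup>2) * X (Suc j) - X j)"
  proof -
    have "(1 + s) * ((2 + s\<^sup>2) * X (Suc j) - X j) - (1 + s) * ((1 + s) * X (Suc j))
        = (X (Suc j) - (1 + s) * X j) + s ^ 3 * X (Suc j)"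
      by (simp add: power2_eq_square power3_eq_cube algebra_simps)
    also have "\<dots> \<ge> 0" using 1 s pos by (intro add_nonneg_nonneg mult_nonneg_nonneg) auto
    finally show ?thesis by linarith
  qed
  then have "(1 + s) * X (Suc j) \<le> (2 + s\<^sup>2) * X (Suc j) - X j"
    using s by (subst (asm) mult_le_cancel_left_pos) auto
  moreover have "X (Suc (Suc j)) = (2 + s\<^sup>2) * X (Suc j) - X j" using recX[of "Suc j"] Suc.prems s by simp
  ultimately show ?case using pos by (simp add: s_def[symmetric])
qed

lemma X_pos: "1 \<le> j \<Longrightarrow> j \<le> q \<Longrightarrow> X j > 0"
  using growth_sqrt by auto

lemma X_step: "1 \<le> j \<Longrightarrow> j \<le> q \<Longrightarrow> X j \<le> X (Suc j)"
proof -
  assume j: "1 \<le> j" "j \<le> q"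
  have "0 \<le> sqrt (b j - 2) * X j" using growth_sqrt[OF j] b2[OF j] by simp
  then show ?thesis using growth_sqrt[OF j] by (simp add: algebra_simps)
qed

text \<open>Weaker than the square-root bound when b is close to 2, but linear in b, as is needed
  when b is large.\<close>

lemma growth_linear: "1 \<le> j \<Longrightarrow> j \<le> q \<Longrightarrow> (b j - 1) * X j \<le> X (Suc j)"
proof -
  assume j: "1 \<le> j" "j \<le> q"
  have "X (j - 1) \<le> X j" using X_step[of "j - 1"] j X0 X1 by (cases "j = 1") auto
  then show ?thesis using recX[OF j] by (simp add: algebra_simps)
qed

text \<open>Farther than w from q the growth factor is at least 1 + sqrt (H w), which makes the sum
  geometric; each of the last w indices adds at most one more copy of the last term, by
  monotonicity.\<close>

lemma partial_sum_le:
  fixes H :: real and w :: nat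
  assumes H: "H > 0" and w: "w \<ge> 1"
    and bH: "\<And>j. 1 \<le> j \<Longrightarrow> j \<le> q \<Longrightarrow> b j \<ge> 2 + H * (real q - real j)"
    and l: "l \<le> q"
  shows "(\<Sum>i=1..l. X i) \<le> (1 + 1 / sqrt (H * w) + w) * X l"
proof (cases "l = 0")
  case False
  define \<sigma> where "\<sigma> = sqrt (H * w)"
  have \<sigma>: "\<sigma> > 0" using H w by (simp add: \<sigma>_def)
  have main: "(\<Sum>i=1..l. X i) \<le> (1 + 1 / \<sigma> + real (l - (q - w))) * X l" if "1 \<le> l" "l \<le> q" for l
    using that
  proof (induction l rule: nat_induct_at_least)
    case base
    have "0 \<le> (1 / \<sigma> + real (1 - (q - w))) * X 1" using \<sigma> X1 by simp
    then show ?case by (simp add: algebra_simps)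
  next
    case (Suc l)
    have l: "1 \<le> l" "l \<le> q" using Suc by auto
    have p: "X l > 0" "X (Suc l) > 0" using X_pos Suc by auto
    have IH: "(\<Sum>i=1..l. X i) \<le> (1 + 1 / \<sigma> + real (l - (q - w))) * X l" using Suc by auto
    have step: "(\<Sum>i=1..Suc l. X i) = (\<Sum>i=1..l. X i) + X (Suc l)" by simp
    show ?case
    proof (cases "l \<le> q - w")
      case True
      have "\<sigma> \<le> sqrt (b l - 2)"
        unfolding \<sigma>_def
      proof (rule real_sqrt_le_mono)
        have "H * w \<le> H * (real q - real l)"
          using True H l Suc.prems by (intro mult_left_mono) linarith+
        then show "H * w \<le> b l - 2" using bH[of l] l by linarith
      qed
      then have "(1 + \<sigma>) * X l \<le> (1 + sqrt (b l - 2)) * X l" using p by (intro mult_right_mono) auto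
      also have "\<dots> \<le> X (Suc l)" using growth_sqrt l by auto
      finally have g: "(1 + \<sigma>) * X l \<le> X (Suc l)" .
      have "(1 + 1 / \<sigma>) * X l = (1 / \<sigma>) * ((1 + \<sigma>) * X l)" using \<sigma> by (simp add: field_simps)
      also have "\<dots> \<le> (1 / \<sigma>) * X (Suc l)" using g \<sigma> by (intro mult_left_mono) auto
      finally have "(\<Sum>i=1..Suc l. X i) \<le> (1 + 1 / \<sigma>) * X (Suc l)"
        using IH True unfolding step by (simp add: algebra_simps)
      also have "\<dots> \<le> (1 + 1 / \<sigma> + real (Suc l - (q - w))) * X (Suc l)"
        using p by (intro mult_right_mono) auto
      finally show ?thesis .
    next
      case False
      have "(\<Sum>i=1..Suc l. X i) \<le> (1 + 1 / \<sigma> + real (l - (q - w))) * X (Suc l) + X (Suc l)"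
        unfolding step using IH X_step[OF l] \<sigma>
        by (intro add_mono order_refl order_trans[OF IH] mult_left_mono) auto
      also have "\<dots> = (1 + 1 / \<sigma> + real (Suc l - (q - w))) * X (Suc l)"
        using False by (simp add: Suc_diff_le algebra_simps)
      finally show ?thesis .
    qed
  qed
  have "(\<Sum>i=1..l. X i) \<le> (1 + 1 / \<sigma> + real (l - (q - w))) * X l" using main False l by auto
  also have "\<dots> \<le> (1 + 1 / \<sigma> + w) * X l" using X_pos[of l] False l by (intro mult_right_mono) auto
  finally show ?thesis by (simp add: \<sigma>_def)
qed (use X0 in auto)

end

text \<open>The constant 1/4 is the critical one of Hardy's inequality: sqrt j solves the continuous
  equation y'' = - y / (4 j^2), and its growth rate 1 + 1 / (2 j) is what the induction carries.
  Growth is obtained although b may lie below 2.\<close>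

lemma growth_near_turning_point:
  fixes X b :: "nat \<Rightarrow> real"
  assumes "X 0 = 0" "X 1 > 0"
    and "\<And>j. 1 \<le> j \<Longrightarrow> j \<le> q \<Longrightarrow> X (Suc j) = b j * X j - X (j - 1)"
    and "\<And>j. 1 \<le> j \<Longrightarrow> j \<le> q \<Longrightarrow> 2 - b j \<le> 1 / (4 * (real j)\<^sup>2)"
    and "1 \<le> j" "j \<le> q"
  shows "X j > 0 \<and> (1 + 1 / (2 * real j)) * X j \<le> X (Suc j)"
  using assms(5,6)
proof (induction j rule: nat_induct_at_least)
  case base
  have "b 1 \<ge> 3/2" using assms(4)[of 1] base by simp
  then have "3/2 * X 1 \<le> b 1 * X 1" using assms(2) by (intro mult_right_mono) auto
  then show ?case using assms(1,2) assms(3)[of 1] base by simp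
next
  case (Suc j)
  define J where "J = real j"
  have J: "J \<ge> 1" using Suc by (simp add: J_def)
  have IH: "X j > 0" "(1 + 1 / (2 * J)) * X j \<le> X (Suc j)" using Suc by (auto simp: J_def)
  have p: "X (Suc j) > 0" using IH J by (smt (verit) mult_pos_pos divide_pos_pos)
  have "X j \<le> 2 * J / (2 * J + 1) * X (Suc j)"
    using IH J by (simp add: field_simps)
  moreover have "b (Suc j) * X (Suc j) \<ge> (2 - 1 / (4 * (J + 1)\<^sup>2)) * X (Suc j)"
    using assms(4)[of "Suc j"] Suc p by (intro mult_right_mono) (auto simp: J_def add.commute)
  \<comment> \<open>Here 2 J / (2 J + 1) is the reciprocal of the inductive growth factor 1 + 1 / (2
    J).\<close>
  moreover have "(1 + 1 / (2 * (J + 1))) \<le> (2 - 1 / (4 * (J + 1)\<^sup>2)) - 2 * J / (2 * J + 1)"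
  proof -
    have "1 - 2 * J / (2 * J + 1) = 1 / (2 * J + 1)" using J by (simp add: field_simps)
    moreover have "1 / (2 * J + 1) - 1 / (2 * (J + 1)) = 1 / ((2 * J + 1) * (2 * (J + 1)))"
      using J by (simp add: divide_simps)
    moreover have "1 / (4 * (J + 1)\<^sup>2) \<le> 1 / ((2 * J + 1) * (2 * (J + 1)))"
      using J by (intro divide_left_mono) (auto simp: power2_eq_square algebra_simps intro!: add_pos_pos mult_pos_pos)
    ultimately show ?thesis by linarith
  qed
  then have "(1 + 1 / (2 * (J + 1))) * X (Suc j) \<le> ((2 - 1 / (4 * (J + 1)\<^sup>2)) - 2 * J / (2 * J + 1)) * X (Suc j)"
    using p by (intro mult_right_mono) auto
  ultimately have "(1 + 1 / (2 * (J + 1))) * X (Suc j) \<le> b (Suc j) * X (Suc j) - X j"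
    by (simp only: left_diff_distrib)
  moreover have "X (Suc (Suc j)) = b (Suc j) * X (Suc j) - X j" using assms(3)[of "Suc j"] Suc.prems by simp
  moreover have "real (Suc j) = J + 1" by (simp add: J_def)
  ultimately show ?case using p by (simp only: add.commute[of J 1])
qed

text \<open>Two neighbouring zeros propagate backwards. This yields X n \<noteq> 0 and a positive
  sum of squares at the matching pair m, m + 1.\<close>

lemma two_term_zero:
  fixes X b :: "nat \<Rightarrow> real"
  assumes "\<And>j. 1 \<le> j \<Longrightarrow> j \<le> n \<Longrightarrow> X (Suc j) = b j * X j - X (j - 1)"
    and "X m = 0" "X (Suc m) = 0" "1 \<le> m" "m \<le> n"
  shows "X 1 = 0"
proof -
  have "X i = 0 \<and> X (Suc i) = 0" if "i \<le> m" for i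
    using that
  proof (induction rule: inc_induct)
    case base
    then show ?case using assms(2,3) by simp
  next
    case (step i)
    have "X (Suc (Suc i)) = b (Suc i) * X (Suc i) - X i" using assms(1)[of "Suc i"] assms(5) step.hyps by simp
    then show ?case using step.IH by simp
  qed
  from this[of 1] assms(4) show ?thesis by simp
qed

section \<open>Scales of the eigenvalue problem\<close>

text \<open>A cheap form of convexity, x^(a-1) (x + 1) \<le> (x + 1)^a, giving up the factor a of
  the derivative.\<close>

lemma powr_Suc_ge:
  assumes "a \<ge> 1" "x \<ge> (0::real)"
  shows "x powr a + x powr (a - 1) \<le> (x + 1) powr a"
proof (cases "x = 0")
  case False
  have "x powr a + x powr (a - 1) = x powr (a - 1) * (x + 1)"
    using False assms powr_add[of x "a - 1" 1] by (simp add: algebra_simps)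
  also have "\<dots> \<le> (x + 1) powr (a - 1) * (x + 1)"
    using assms by (intro mult_right_mono powr_mono2) auto
  also have "\<dots> = (x + 1) powr a"
    using assms powr_add[of "x + 1" "a - 1" 1] by (simp add: add_nonneg_eq_0_iff)
  finally show ?thesis .
qed simp

locale eig_problem =
  fixes a c lam :: real and n k :: nat and X Y f :: "nat \<Rightarrow> real"
  assumes a1: "1 \<le> a" and c1: "1 < c" and k1: "1 < k" and kn: "k < n"
    and lam_gt: "4 + 2 * (real k / c) powr a < lam"
    and lam_le: "lam \<le> 4 + 2 * (real (k + 1) / c) powr a"
    and X0: "X 0 = 0" and Xn: "X (Suc n) = 0" and X1: "X 1 > 0"
    and recX': "\<And>j. 1 \<le> j \<Longrightarrow> j \<le> n \<Longrightarrow> X (Suc j) = (lam - (2 + 2 * (real j / c) powr a)) * X j - X (j - 1)"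
    and normX: "(\<Sum>j=1..n. (X j)\<^sup>2) = 1"
    and Y0: "Y 0 = 0" and Yn: "Y (Suc n) = 0"
    and recY': "\<And>j. 1 \<le> j \<Longrightarrow> j \<le> n \<Longrightarrow> Y (Suc j) = (lam - (2 + 2 * (real j / c) powr a)) * Y j - Y (j - 1) + f j"
    and orth: "(\<Sum>j=1..n. X j * Y j) = 0"
    and f_le: "\<And>j. 1 \<le> j \<Longrightarrow> j \<le> n \<Longrightarrow> \<bar>f j\<bar> \<le> 3 * lam * \<bar>X j\<bar> + 2 * (\<bar>X (j - 1)\<bar> + \<bar>X (Suc j)\<bar>)"
begin

text \<open>The scale x0 is the width of the turning point region when k is small; P0 is an index up to
  which X grows in any case, so that X grows up to q + 1. H bounds from below the decrements of b
  beyond q. The last indices, from p on, form the right forbidden region (b below -2) of length kr; the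
  reflection W maps it to a left one. \<Psi> is the price for k being large compared with c.\<close>

definition "b j = lam - (2 + 2 * (real j / c) powr a)"
definition "x0 = c powr (a / (a + 2))"
definition "P0 = nat \<lfloor>x0 / 2\<rfloor>"
definition "q = max k P0"
definition "H = 2 * real q powr (a - 1) / c powr a"
definition "C1 = (4::real) powr a"
definition "C2 = 8 * (2::real) powr a"
definition "\<Psi> = (if real k \<le> c then 1 else 1 + real k)"
text \<open>The terms of 1 + 1 / sqrt (H w) + w at w of order x0 are at most x0, \<open>C1\<close>
  x0 and 2 x0.\<close>

definition "S = (3 + C1) * x0"
definition "\<rho> = 7 * C2 * \<Psi>"
definition "p = (LEAST j. n < j \<or> b j < -2)"
definition "kr = n + 1 - p"
definition "W U i = - sgn (X n) * (-1) ^ i * U (n + 1 - i)" for U :: "nat \<Rightarrow> real"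
text \<open>\<open>D1\<close> is the constant of \<rho> S^2 and \<open>D2\<close> that of
  \<open>K\<close>; \<open>D3\<close> is 2 (D1 + 2 D2) + 2 (D1 + D2), the outcome of the
  matching.\<close>

definition "D1 = 7 * C2 * (3 + C1)\<^sup>2"
definition "D2 = 70 * C1 * C2 * (3 + C1) + 12 * C1 * C2 * (2 * C1 + 4)"
definition "D3 = 4 * D1 + 6 * D2"

lemmas recX = recX'[folded b_def] and recY = recY'[folded b_def]

lemma x0_ge1: "x0 \<ge> 1"
  using ge_one_powr_ge_zero[of c "a / (a + 2)"] a1 c1 by (simp add: x0_def)

lemma x0_le_c: "x0 \<le> c"
  using powr_mono[of "a / (a + 2)" 1 c] a1 c1 by (simp add: x0_def)

lemma x0_powr: "x0 powr (a + 2) = c powr a"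
  using a1 by (simp add: x0_def powr_powr)

lemma x0_pow4: "x0 ^ 4 = c powr (4 * a / (a + 2))"
proof -
  have "x0 powr 4 = c powr (4 * a / (a + 2))" by (simp add: x0_def powr_powr mult.commute)
  then show ?thesis using x0_ge1 by simp
qed

text \<open>Here a \<ge> 1 enters the exponent: 3 a / (a + 2) \<ge> 1.\<close>

lemma c_le_x0: "c \<le> x0 ^ 3"
proof -
  have "c powr 1 \<le> c powr (a / (a + 2) * 3)"
    using a1 c1 by (intro powr_mono) (auto simp: field_simps)
  also have "\<dots> = x0 powr 3" by (simp add: x0_def powr_powr)
  also have "\<dots> = x0 ^ 3" using x0_ge1 by simp
  finally show ?thesis using c1 by simp
qed

lemma x0_pow_mono: "i \<le> j \<Longrightarrow> x0 ^ i \<le> x0 ^ j"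
  using x0_ge1 by (intro power_increasing) auto

lemma C1_ge: "C1 \<ge> 4"
  using powr_mono[of 1 a 4] a1 by (simp add: C1_def)

lemma C2_ge: "C2 \<ge> 16"
  using powr_mono[of 1 a 2] a1 by (simp add: C2_def)

lemma Psi_ge1: "\<Psi> \<ge> 1"
  by (simp add: \<Psi>_def)

lemma b_mono: "i \<le> j \<Longrightarrow> b j \<le> b i"
  using a1 c1 by (auto simp: b_def intro!: powr_mono2 divide_right_mono)

lemma k_facts: "b k > 2" "b (Suc k) \<le> 2"
  using lam_gt lam_le by (auto simp: b_def)

lemma lam4: "lam > 4"
  using lam_gt by (smt (verit) powr_ge_zero)

lemma q_ge: "k \<le> q" "2 \<le> real q"
  using k1 by (auto simp: q_def)

lemma H_pos: "H > 0"
  using q_ge c1 by (simp add: H_def)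

lemma b_step: assumes "q \<le> j" shows "b (Suc j) \<le> b j - H"
proof -
  have "real q powr (a - 1) \<le> real j powr (a - 1)"
    using assms a1 by (intro powr_mono2) auto
  moreover have "real j powr a + real j powr (a - 1) \<le> (real j + 1) powr a"
    using a1 by (intro powr_Suc_ge) auto
  ultimately have "real j powr a + real q powr (a - 1) \<le> (real j + 1) powr a" by linarith
  then have "(real j powr a + real q powr (a - 1)) / c powr a \<le> (real j + 1) powr a / c powr a"
    using c1 by (intro divide_right_mono) auto
  moreover have "(real (Suc j) / c) powr a = (real j + 1) powr a / c powr a"
    "(real j / c) powr a = real j powr a / c powr a"
    using c1 by (auto simp: powr_divide add.commute)
  ultimately show ?thesis
    unfolding b_def H_def add_divide_distrib by simp
qed

lemma b_steps: "q \<le> i \<Longrightarrow> i \<le> j \<Longrightarrow> b j \<le> b i - H * (real j - real i)"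
proof (induction j)
  case (Suc j)
  show ?case
  proof (cases "i = Suc j")
    case False
    then have "b j \<le> b i - H * (real j - real i)" using Suc by auto
    moreover have "b (Suc j) \<le> b j - H" using Suc False by (intro b_step) auto
    ultimately show ?thesis by (simp add: algebra_simps)
  qed simp
qed simp

text \<open>On [0, k] the graph of x^a lies below its chord, whose slope is k^(a-1). So b rises to
  the left of k at least at the rate H at which it falls to the right.\<close>

lemma b_left: assumes "q = k" "j \<le> k" shows "b j \<ge> 2 + H * (real k - real j)"
proof -
  have e: "x powr a = x powr (a - 1) * x" if "x \<ge> 0" for x
    using that powr_add[of x "a - 1" 1] by (cases "x = 0") auto
  have "real j powr a \<le> real k powr (a - 1) * real j"
    using assms a1 by (subst e) (auto intro!: mult_right_mono powr_mono2)
  then have "real k powr (a - 1) * (real k - real j) \<le> real k powr a - real j powr a"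
    using e[of "real k"] by (simp add: algebra_simps)
  then have "real k powr (a - 1) * (real k - real j) / c powr a \<le> (real k powr a - real j powr a) / c powr a"
    using c1 by (intro divide_right_mono) auto
  moreover have e1: "(real k / c) powr a - (real j / c) powr a = (real k powr a - real j powr a) / c powr a"
    using c1 by (simp add: powr_divide diff_divide_distrib)
  moreover have e2: "H * (real k - real j) = 2 * (real k powr (a - 1) * (real k - real j) / c powr a)"
    using assms(1) by (simp add: H_def)
  ultimately have "H * (real k - real j) \<le> 2 * ((real k / c) powr a - (real j / c) powr a)"
    unfolding e1 e2 by (intro mult_left_mono) auto
  then show ?thesis using k_facts(1) by (simp add: b_def)
qed

lemma P0_le: "real P0 \<le> x0 / 2" "x0 / 2 < real P0 + 1"
  using x0_ge1 by (auto simp: P0_def) linarith+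

lemma q_large: "x0 / 4 \<le> real q"
proof -
  have "real P0 \<le> real q" by (simp add: q_def)
  then show ?thesis using P0_le q_ge(2) by linarith
qed

text \<open>With q \<ge> x0 / 4, dividing c^a = x0^(a+2) by q^(a-1) leaves a third power of
  x0.\<close>

lemma H_inverse: "1 / H \<le> C1 * x0 ^ 3"
proof -
  have "x0 powr (a - 1) / 4 powr (a - 1) = (x0 / 4) powr (a - 1)"
    using x0_ge1 by (simp add: powr_divide)
  also have "\<dots> \<le> real q powr (a - 1)"
    using q_large a1 x0_ge1 by (intro powr_mono2) auto
  finally have *: "x0 powr (a - 1) / 4 powr (a - 1) \<le> real q powr (a - 1)" .
  have "1 / H = c powr a / (2 * real q powr (a - 1))" by (simp add: H_def)
  also have "\<dots> \<le> c powr a / (2 * (x0 powr (a - 1) / 4 powr (a - 1)))"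
    using * x0_ge1 q_ge by (intro divide_left_mono mult_left_mono) auto
  also have "\<dots> = 4 powr (a - 1) / 2 * (x0 powr (a + 2) / x0 powr (a - 1))"
    by (simp add: x0_powr)
  also have "x0 powr (a + 2) / x0 powr (a - 1) = x0 ^ 3"
  proof -
    have "x0 powr (a + 2) / x0 powr (a - 1) = x0 powr ((a + 2) - (a - 1))" by (rule powr_diff[symmetric])
    also have "\<dots> = x0 powr 3" by simp
    finally show ?thesis using x0_ge1 by simp
  qed
  also have "4 powr (a - 1) / 2 * x0 ^ 3 \<le> C1 * x0 ^ 3"
  proof (rule mult_right_mono)
    have "4 powr (a - 1) \<le> (4::real) powr a" by (intro powr_mono) auto
    then show "4 powr (a - 1) / 2 \<le> C1" unfolding C1_def using powr_ge_zero[of 4 a] by linarith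
  qed (use x0_ge1 in auto)
  finally show ?thesis .
qed

section \<open>Sizes of \<lambda> and H for k below and above c\<close>

lemma q_le_c: "real k \<le> c \<Longrightarrow> real q \<le> c"
  using P0_le(1) x0_le_c x0_ge1 by (auto simp: q_def max_def)

lemma q_eq_k: "c < real k \<Longrightarrow> q = k"
  using P0_le(1) x0_le_c x0_ge1 by (auto simp: q_def max_def)

lemma H_le2: assumes "real k \<le> c" shows "H \<le> 2"
proof -
  have "real q powr (a - 1) \<le> c powr (a - 1)"
    using q_le_c[OF assms] a1 by (intro powr_mono2) auto
  also have "\<dots> \<le> c powr a" using c1 by (intro powr_mono) auto
  finally show ?thesis using c1 by (simp add: H_def field_simps)
qed

lemma H_large: "c < real k \<Longrightarrow> H = 2 * (real k / c) powr a / real k"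
  using q_eq_k k1 c1 by (simp add: H_def powr_divide powr_diff)

lemma lam_bound: "lam \<le> C2 * max 1 ((real k / c) powr a)"
proof -
  have "(real (k + 1) / c) powr a \<le> (2 * (real k / c)) powr a"
    using k1 c1 a1 by (intro powr_mono2) (auto simp: divide_right_mono)
  also have "\<dots> = 2 powr a * (real k / c) powr a" by (rule powr_mult)
  also have "\<dots> \<le> 2 powr a * max 1 ((real k / c) powr a)" by (intro mult_left_mono) auto
  finally have "lam \<le> 4 + 2 * (2 powr a * max 1 ((real k / c) powr a))" using lam_le by linarith
  moreover have "1 * 1 \<le> 2 powr a * max 1 ((real k / c) powr a)"
    using a1 ge_one_powr_ge_zero[of 2 a] by (intro mult_mono) auto
  ultimately show ?thesis by (simp add: C2_def)
qed

lemma lam_small: "real k \<le> c \<Longrightarrow> lam \<le> C2"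
proof -
  assume "real k \<le> c"
  then have "(real k / c) powr a \<le> 1 powr a" using c1 a1 by (intro powr_mono2) auto
  then show ?thesis using lam_bound by (simp add: max_def split: if_splits)
qed

lemma lam_large:
  assumes "c < real k"
  shows "lam \<le> C2 * (real k / c) powr a" "lam \<le> C2 * real k / 2 * H"
proof -
  have "1 \<le> (real k / c) powr a" using assms c1 a1 by (intro ge_one_powr_ge_zero) auto
  then show "lam \<le> C2 * (real k / c) powr a" using lam_bound by (simp add: max_def)
  then show "lam \<le> C2 * real k / 2 * H" using H_large[OF assms] k1 by simp
qed

text \<open>For k \<le> c the eigenvalue is bounded and only 1 / H counts. For k > c both \<lambda>
  and k H are governed by (k / c)^a, so the quotient is O(k), which \<Psi> takes up.\<close>

lemma lam_H: "lam / H \<le> C1 * C2 * x0 ^ 3 * \<Psi>"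
proof (cases "real k \<le> c")
  case True
  have "lam / H = lam * (1 / H)" by simp
  also have "\<dots> \<le> C2 * (C1 * x0 ^ 3)"
    using lam_small[OF True] H_inverse lam4 C2_ge H_pos by (intro mult_mono) auto
  finally show ?thesis using True by (simp add: \<Psi>_def mult_ac)
next
  case False
  have "lam / H \<le> C2 * real k / 2" using lam_large(2) False H_pos by (simp add: field_simps)
  also have "\<dots> \<le> C2 * \<Psi>" using C2_ge False by (simp add: \<Psi>_def field_simps)
  also have "\<dots> \<le> (C1 * x0 ^ 3) * (C2 * \<Psi>)"
  proof -
    have "1 * 1 \<le> C1 * x0 ^ 3" using C1_ge one_le_power[OF x0_ge1, of 3] by (intro mult_mono) auto
    then show ?thesis using mult_right_mono[of 1 "C1 * x0 ^ 3" "C2 * \<Psi>"] C2_ge Psi_ge1 by simp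
  qed
  finally show ?thesis by (simp add: mult_ac)
qed

text \<open>For j \<le> x0 / 2 one has j^(a+2) \<le> c^a / 2^(a+2) \<le> c^a / 8, which is the Hardy
  condition 2 (j / c)^a \<le> 1 / (4 j^2). This fixes the factor 1/2 in \<open>P0\<close>.\<close>

lemma near: assumes "1 \<le> j" "j \<le> P0" shows "2 - b j \<le> 1 / (4 * (real j)\<^sup>2)"
proof -
  have j: "real j > 0" "real j \<le> x0 / 2" using assms P0_le(1) by auto
  have "real j powr a * (real j)\<^sup>2 = real j powr (a + 2)"
    using j by (simp add: powr_add)
  also have "\<dots> \<le> (x0 / 2) powr (a + 2)" using j a1 by (intro powr_mono2) auto
  also have "\<dots> = c powr a / 2 powr (a + 2)" using x0_ge1 by (simp add: powr_divide x0_powr)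
  also have "\<dots> \<le> c powr a / 8"
  proof (rule divide_left_mono)
    have "2 powr 3 \<le> (2::real) powr (a + 2)" using a1 by (intro powr_mono) auto
    then show "8 \<le> (2::real) powr (a + 2)" by simp
  qed auto
  finally have "2 * (real j powr a / c powr a) \<le> 1 / (4 * (real j)\<^sup>2)"
    using j c1 by (simp add: field_simps)
  then show ?thesis using lam4 c1 by (simp add: b_def powr_divide)
qed

lemma growth_P0: "1 \<le> j \<Longrightarrow> j \<le> P0 \<Longrightarrow> j \<le> n \<Longrightarrow> X j > 0 \<and> X j < X (Suc j)"
proof -
  assume j: "1 \<le> j" "j \<le> P0" "j \<le> n"
  have *: "X j > 0 \<and> (1 + 1 / (2 * real j)) * X j \<le> X (Suc j)"
    by (rule growth_near_turning_point[where b=b and q="min P0 n"])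
       (use X0 X1 recX near j in auto)
  then have "X j < (1 + 1 / (2 * real j)) * X j" using j by (simp add: algebra_simps)
  then show ?thesis using * by linarith
qed

text \<open>Growth up to index n would contradict X (n + 1) = 0.\<close>

lemma q_less_n: "q < n"
proof (rule ccontr)
  assume "\<not> q < n"
  then have "n \<le> P0" using kn by (auto simp: q_def max_def split: if_splits)
  then have "X n > 0 \<and> X n < X (Suc n)" using growth_P0[of n] kn by auto
  then show False using Xn by linarith
qed

text \<open>Where |X| is maximal, b i X i = X (i + 1) + X (i - 1) forces |b i| \<le> 2. Such an
  index lies beyond k, where b does not increase any more. So at least one index separates the two
  forbidden regions.\<close>

lemma b_Suc_k: "b (Suc k) \<ge> -2"
proof -
  define M where "M = Max ((\<lambda>i. \<bar>X i\<bar>) ` {1..n})"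
  have fin: "finite ((\<lambda>i. \<bar>X i\<bar>) ` {1..n})" "(\<lambda>i. \<bar>X i\<bar>) ` {1..n} \<noteq> {}" using kn by auto
  obtain i where i: "i \<in> {1..n}" "\<bar>X i\<bar> = M"
    using Max_in[OF fin] by (auto simp: M_def)
  have le: "\<bar>X j\<bar> \<le> M" if "1 \<le> j" "j \<le> n" for j
    unfolding M_def by (rule Max_ge) (use that fin in auto)
  have "M > 0" using le[of 1] X1 kn by auto
  then have le': "\<bar>X j\<bar> \<le> M" if "j \<le> Suc n" for j
    using le[of j] that X0 Xn by (cases "j = 0"; cases "j = Suc n") auto
  have "b i * X i = X (Suc i) + X (i - 1)" using recX[of i] i by auto
  then have "\<bar>b i\<bar> * M \<le> \<bar>X (Suc i)\<bar> + \<bar>X (i - 1)\<bar>" using i(2) by (metis abs_mult abs_triangle_ineq)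
  also have "\<dots> \<le> 2 * M" proof -
    have "i - 1 \<le> Suc n" "Suc i \<le> Suc n" using i(1) by auto
    then show ?thesis using le'[of "Suc i"] le'[of "i - 1"] by linarith
  qed
  finally have bi: "\<bar>b i\<bar> \<le> 2" using \<open>M > 0\<close> by simp
  have "\<not> i \<le> k" using b_mono[of i k] k_facts(1) bi by auto
  then have "b i \<le> b (Suc k)" by (intro b_mono) auto
  then show ?thesis using bi by auto
qed

lemma S_ge: "1 + C1 * x0 + 2 * x0 \<le> S" "1 \<le> S"
proof -
  show "1 + C1 * x0 + 2 * x0 \<le> S" using x0_ge1 by (simp add: S_def algebra_simps)
  moreover have "0 \<le> C1 * x0" using C1_ge x0_ge1 by simp
  ultimately show "1 \<le> S" using x0_ge1 by linarith
qed

lemma rho_pos: "\<rho> > 0"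
  using C2_ge Psi_ge1 by (simp add: \<rho>_def)

text \<open>Stated for an abstract U, so as to serve the left region and the reflected right one.
  The linear bound on B controls the partial sums; B \<ge> H - 2 controls U l / U (l + 1) when
  \<lambda> is large.\<close>

lemma forbidden_constants:
  assumes "forbidden_region U B r"
    and BH: "\<And>j. 1 \<le> j \<Longrightarrow> j \<le> r \<Longrightarrow> B j \<ge> 2 + H * (real r - real j)"
    and BH2: "\<And>j. 1 \<le> j \<Longrightarrow> j \<le> r \<Longrightarrow> B j \<ge> H - 2"
  shows "\<And>l. l \<le> r \<Longrightarrow> (\<Sum>i=1..l. U i) \<le> S * U l"
    and "\<And>l. 1 \<le> l \<Longrightarrow> l \<le> r \<Longrightarrow> 3 * lam * U l + 4 * U (Suc l) \<le> \<rho> * U (Suc l)"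
proof -
  interpret forbidden_region U B r by fact
  show "(\<Sum>i=1..l. U i) \<le> S * U l" if l: "l \<le> r" for l
  proof (cases "l = 0")
    case False
    define w where "w = nat \<lceil>x0\<rceil>"
    have w: "w \<ge> 1" "x0 \<le> real w" "real w \<le> 2 * x0"
      using x0_ge1 unfolding w_def by linarith+
    \<comment> \<open>Since 1 / H is O(x0^3), the width x0 balances 1 / sqrt (H w) against
      w.\<close>
    have "1 / (H * w) = (1 / H) / w" by simp
    also have "\<dots> \<le> (C1 * x0 ^ 3) / x0"
      using H_inverse w x0_ge1 C1_ge H_pos by (intro frac_le) auto
    also have "\<dots> = C1 * x0\<^sup>2" using x0_ge1 by (simp add: power2_eq_square power3_eq_cube)
    also have "\<dots> \<le> C1\<^sup>2 * x0\<^sup>2"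
      using C1_ge mult_right_mono[of 1 C1 C1] by (intro mult_right_mono) (auto simp: power2_eq_square)
    finally have "sqrt (1 / (H * w)) \<le> sqrt ((C1 * x0)\<^sup>2)"
      by (intro real_sqrt_le_mono) (simp add: power_mult_distrib)
    then have "1 / sqrt (H * w) \<le> C1 * x0" using C1_ge x0_ge1 by (simp add: real_sqrt_divide)
    then have "1 + 1 / sqrt (H * w) + w \<le> S" using w S_ge by linarith
    then have "(1 + 1 / sqrt (H * w) + w) * U l \<le> S * U l"
      using X_pos[of l] l False by (intro mult_right_mono) auto
    moreover have "(\<Sum>i=1..l. U i) \<le> (1 + 1 / sqrt (H * w) + w) * U l"
      by (rule partial_sum_le) (use H_pos w BH l in auto)
    ultimately show ?thesis by linarith
  qed (use X0 in auto)
  show "3 * lam * U l + 4 * U (Suc l) \<le> \<rho> * U (Suc l)" if l: "1 \<le> l" "l \<le> r" for l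
  proof -
    have p: "U l > 0" "U (Suc l) > 0" "U l \<le> U (Suc l)"
      using X_pos[OF l] X_step[OF l] by auto
    have "lam * U l \<le> 2 * C2 * \<Psi> * U (Suc l)"
    proof (cases "real k \<le> c")
      case True
      have "lam * U l \<le> C2 * U (Suc l)" using lam_small[OF True] p C2_ge by (intro mult_mono) auto
      also have "\<dots> \<le> 2 * C2 * \<Psi> * U (Suc l)"
        using C2_ge p True by (intro mult_right_mono) (auto simp: \<Psi>_def)
      finally show ?thesis .
    next
      case False
      \<comment> \<open>Three quarters of B \<ge> 2 plus one quarter of B \<ge> H - 2.\<close>
      have "H / 4 \<le> B l - 1" using BH2[OF l] b2[OF l] by linarith
      then have "H / 4 * U l \<le> (B l - 1) * U l" using p by (intro mult_right_mono) auto
      also have "\<dots> \<le> U (Suc l)" by (rule growth_linear[OF l])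
      finally have HU: "H * U l \<le> 4 * U (Suc l)" by simp
      have "lam * U l \<le> (C2 * real k / 2 * H) * U l" using lam_large(2) False p by (intro mult_right_mono) auto
      also have "\<dots> = (C2 * real k / 2) * (H * U l)" by simp
      also have "\<dots> \<le> (C2 * real k / 2) * (4 * U (Suc l))" using HU C2_ge by (intro mult_left_mono) auto
      also have "\<dots> = 2 * C2 * real k * U (Suc l)" by simp
      also have "\<dots> \<le> 2 * C2 * \<Psi> * U (Suc l)"
        using C2_ge p False by (intro mult_right_mono mult_left_mono) (auto simp: \<Psi>_def)
      finally show ?thesis .
    qed
    then have "3 * lam * U l + 4 * U (Suc l) \<le> (6 * C2 * \<Psi> + 4) * U (Suc l)" by (simp add: algebra_simps)
    also have "\<dots> \<le> \<rho> * U (Suc l)"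
    proof (rule mult_right_mono)
      have "16 * 1 \<le> C2 * \<Psi>" using C2_ge Psi_ge1 by (intro mult_mono) auto
      then show "6 * C2 * \<Psi> + 4 \<le> \<rho>" by (simp add: \<rho>_def)
    qed (use p in auto)
    finally show ?thesis .
  qed
qed

section \<open>Growth of X up to the turning index q\<close>

lemma forbidden_left: assumes "q = k" shows "forbidden_region X b k"
proof
  show "2 \<le> b j" if "1 \<le> j" "j \<le> k" for j using b_mono[of j k] k_facts(1) that by auto
qed (use X0 X1 recX kn b_mono in auto)

lemma left_forbidden_BH2: assumes "q = k" "j \<le> k" shows "b j \<ge> H - 2"
  using b_step[of k] b_Suc_k b_mono[of j k] assms by auto

lemma left_step: assumes "1 \<le> j" "j \<le> q" shows "X j \<le> X (Suc j)"
proof (cases "q = k")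
  case True
  then show ?thesis using forbidden_region.X_step[OF forbidden_left] assms by auto
next
  case False
  then have "q = P0" by (auto simp: q_def max_def split: if_splits)
  then show ?thesis using growth_P0[of j] assms q_less_n by auto
qed

lemma left_mono: "1 \<le> i \<Longrightarrow> i \<le> j \<Longrightarrow> j \<le> Suc q \<Longrightarrow> X i \<le> X j"
proof (induction j)
  case (Suc j)
  show ?case
  proof (cases "i = Suc j")
    case False
    then have "X i \<le> X j" using Suc by auto
    then show ?thesis using left_step[of j] Suc.prems False by auto
  qed simp
qed simp

lemma left_pos: "1 \<le> j \<Longrightarrow> j \<le> Suc q \<Longrightarrow> X j > 0"
  using left_mono[of 1 j] X1 by linarith

lemma left_S: assumes "l \<le> q" shows "(\<Sum>i=1..l. X i) \<le> S * X l"
proof (cases "q = k")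
  case True
  show ?thesis
    by (rule forbidden_constants(1)[OF forbidden_left[OF True] b_left[OF True] left_forbidden_BH2[OF True]])
       (use assms True in simp_all)
next
  case False
  then have P: "q = P0" by (auto simp: q_def max_def split: if_splits)
  show ?thesis
  proof (cases "l = 0")
    case False
    have "(\<Sum>i=1..l. X i) \<le> (\<Sum>i=1..l. X l)" using assms by (intro sum_mono left_mono) auto
    also have "\<dots> = real l * X l" by simp
    also have "\<dots> \<le> S * X l"
    proof (rule mult_right_mono)
      have "real l \<le> x0" using assms P P0_le(1) x0_ge1 by linarith
      moreover have "0 \<le> C1 * x0" using C1_ge x0_ge1 by simp
      ultimately show "real l \<le> S" using S_ge(1) x0_ge1 by linarith
    qed (use left_pos[of l] False assms in auto)
    finally show ?thesis .
  qed (use X0 in auto)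
qed

lemma left_rho: assumes "1 \<le> l" "l \<le> q" shows "3 * lam * X l + 4 * X (Suc l) \<le> \<rho> * X (Suc l)"
proof (cases "q = k")
  case True
  show ?thesis
    by (rule forbidden_constants(2)[OF forbidden_left[OF True] b_left[OF True] left_forbidden_BH2[OF True]])
       (use assms True in simp_all)
next
  case False
  then have k: "real k \<le> c" using q_eq_k by force
  have p: "X l > 0" "X (Suc l) > 0" "X l \<le> X (Suc l)"
    using left_pos left_step assms by auto
  have "lam * X l \<le> C2 * X (Suc l)" using lam_small[OF k] p C2_ge by (intro mult_mono) auto
  then have "3 * lam * X l + 4 * X (Suc l) \<le> (3 * C2 + 4) * X (Suc l)" by (simp add: algebra_simps)
  also have "\<dots> \<le> \<rho> * X (Suc l)" using C2_ge k p by (intro mult_right_mono) (auto simp: \<rho>_def \<Psi>_def)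
  finally show ?thesis .
qed

end

section \<open>Matching the two halves\<close>

context eig_problem
begin

lemma p_le: "p \<le> n + 1"
  unfolding p_def by (rule Least_le) simp

lemma below_p: "j < p \<Longrightarrow> j \<le> n \<and> -2 \<le> b j"
  unfolding p_def using not_less_Least[of j "\<lambda>j. n < j \<or> b j < -2"] by force

lemma b_p: "p \<le> n \<Longrightarrow> b p < -2"
  using LeastI[of "\<lambda>j. n < j \<or> b j < -2" "n + 1"] unfolding p_def by auto

lemma p_gt: assumes "j \<le> n" "-2 \<le> b j" shows "j < p"
proof (rule ccontr)
  assume "\<not> j < p"
  then have "p \<le> n" "b j \<le> b p" using assms by (auto intro: b_mono)
  then show False using b_p assms by auto
qed

lemma k2_le_p: "k + 2 \<le> p"
  using p_gt[of "Suc k"] kn b_Suc_k by auto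

lemma b_q_nonneg: "0 \<le> b q"
proof (cases "q = k")
  case True
  then show ?thesis using k_facts by simp
next
  case False
  then have q: "q = P0" by (auto simp: q_def max_def split: if_splits)
  have "2\<^sup>2 \<le> (real q)\<^sup>2" using q_ge by (intro power_mono) auto
  then have "1 / (4 * (real q)\<^sup>2) \<le> 1" by (simp add: divide_le_eq)
  moreover have "1 \<le> q" using q_ge k1 by linarith
  ultimately show ?thesis using near[of q] q by linarith
qed

lemma q_less_p: "q < p"
  using p_gt[of q] b_q_nonneg q_less_n by auto

lemma X_n_nonzero: "X n \<noteq> 0"
  using two_term_zero[where X=X and b=b and n=n and m=n] recX Xn X1 kn by auto

section \<open>Reflection of the right end\<close>

lemma abs_W: "\<bar>W U i\<bar> = \<bar>U (n + 1 - i)\<bar>"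
  using X_n_nonzero by (simp add: W_def abs_mult power_abs abs_sgn_eq)

lemma W_sq: "(W U i)\<^sup>2 = (U (n + 1 - i))\<^sup>2"
  using abs_W[of U i] by (metis power2_abs)

text \<open>The alternating sign turns b into -b, so that b < -2 becomes a region of growth read
  from the right; \<open>sgn (X n)\<close> makes the first reflected coordinate equal to |X
  n|.\<close>

lemma W_rec:
  assumes "\<And>j. 1 \<le> j \<Longrightarrow> j \<le> n \<Longrightarrow> U (Suc j) = b j * U j - U (j - 1) + g j"
    and "1 \<le> i" "i \<le> n"
  shows "W U (Suc i) = - b (n + 1 - i) * W U i - W U (i - 1) + sgn (X n) * (-1) ^ i * g (n + 1 - i)"
proof -
  define j where "j = n + 1 - i"
  have j: "1 \<le> j" "j \<le> n" "n + 1 - Suc i = j - 1" "n + 1 - (i - 1) = Suc j"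
    using assms by (auto simp: j_def)
  obtain i' where i': "i = Suc i'" using assms by (cases i) auto
  have "W U (Suc i) = sgn (X n) * (-1) ^ i * U (j - 1)" by (simp only: W_def j) simp
  also have "U (j - 1) = b j * U j - U (Suc j) + g j" using assms(1)[OF j(1,2)] by simp
  also have "sgn (X n) * (-1) ^ i * \<dots> = - b j * W U i - W U (i - 1) + sgn (X n) * (-1) ^ i * g j"
  proof -
    have "W U i = - sgn (X n) * (-1) ^ i * U j" by (simp add: W_def j_def)
    moreover have "W U (i - 1) = sgn (X n) * (-1) ^ i * U (Suc j)" by (simp only: W_def j) (simp add: i')
    ultimately show ?thesis by (simp only:) (simp add: algebra_simps)
  qed
  finally show ?thesis by (simp add: j_def)
qed

lemma right_forbidden: "forbidden_region (W X) (\<lambda>i. - b (n + 1 - i)) kr"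
proof
  show "W X 0 = 0" using Xn by (simp add: W_def)
  have "W X 1 = \<bar>X n\<bar>" by (simp add: W_def abs_sgn mult.commute)
  then show "W X 1 > 0" using X_n_nonzero by simp
  show "W X (Suc i) = - b (n + 1 - i) * W X i - W X (i - 1)" if "1 \<le> i" "i \<le> kr" for i
    using W_rec[of X "\<lambda>_. 0" i] recX that k2_le_p by (auto simp: kr_def)
  show "2 \<le> - b (n + 1 - i)" if "1 \<le> i" "i \<le> kr" for i
  proof -
    have "p \<le> n" "p \<le> n + 1 - i" using that by (auto simp: kr_def)
    then show ?thesis using b_p b_mono[of p "n + 1 - i"] by linarith
  qed
  show "- b (n + 1 - j) \<le> - b (n + 1 - i)" if "1 \<le> i" "i \<le> j" "j \<le> kr" for i j
    using that by (auto intro!: b_mono)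
qed

lemma right_BH:
  assumes "1 \<le> i" "i \<le> kr"
  shows "2 + H * (real kr - real i) \<le> - b (n + 1 - i)" "H - 2 \<le> - b (n + 1 - i)"
proof -
  have p: "p \<le> n" "p \<le> n + 1 - i" using assms by (auto simp: kr_def)
  have bb: "b (n + 1 - i) \<le> b p - H * (real (n + 1 - i) - real p)"
    using q_less_p p by (intro b_steps) auto
  have e: "real (n + 1 - i) - real p = real kr - real i"
    using assms p unfolding kr_def by linarith
  show "2 + H * (real kr - real i) \<le> - b (n + 1 - i)" using bb e b_p p by simp
  have "b p \<le> b (p - 1) - H" using b_step[of "p - 1"] q_less_p by simp
  moreover have "b (p - 1) \<le> 2"
  proof -
    have "Suc k \<le> p - 1" using k2_le_p by linarith
    then show ?thesis using b_mono[of "Suc k" "p - 1"] k_facts by linarith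
  qed
  moreover have "b (n + 1 - i) \<le> b p" using p by (intro b_mono)
  ultimately show "H - 2 \<le> - b (n + 1 - i)" by linarith
qed

lemma left_half:
  assumes "q \<le> m" "m \<le> n"
  shows "half_line X (\<lambda>j. Y j - Y (Suc q) / X (Suc q) * X j) b f q m lam S \<rho>"
proof
  fix j assume j: "1 \<le> j" "j \<le> m"
  then have j': "j \<le> n" using assms by auto
  show "X (Suc j) = b j * X j - X (j - 1)" using recX j j' by auto
  show "Y (Suc j) - Y (Suc q) / X (Suc q) * X (Suc j) = b j * (Y j - Y (Suc q) / X (Suc q) * X j)
      - (Y (j - 1) - Y (Suc q) / X (Suc q) * X (j - 1)) + f j"
    unfolding recX[OF j(1) j'] recY[OF j(1) j'] by (simp only: algebra_simps)
  show "\<bar>f j\<bar> \<le> 3 * lam * \<bar>X j\<bar> + 2 * (\<bar>X (j - 1)\<bar> + \<bar>X (Suc j)\<bar>)" using f_le j j' by auto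
next
  show "Y (Suc q) - Y (Suc q) / X (Suc q) * X (Suc q) = 0" using left_pos[of "Suc q"] by simp
qed (use X0 Y0 X1 assms lam4 left_step left_S S_ge left_rho rho_pos in auto)

text \<open>Up to sign this is the reflected solution at kr + 1, the end of its growing range; the
  right solution is normalised by it.\<close>

lemma X_p_nonzero: "X (p - 1) \<noteq> 0"
proof -
  interpret forbidden_region "W X" "\<lambda>i. - b (n + 1 - i)" kr by (rule right_forbidden)
  have "W X (Suc kr) > 0"
    using X1 X_step[of kr] X_pos[of kr] by (cases "kr = 0") auto
  then have "\<bar>W X (Suc kr)\<bar> > 0" by simp
  moreover have "n + 1 - Suc kr = p - 1" using p_le k2_le_p by (auto simp: kr_def)
  ultimately show ?thesis unfolding abs_W by auto
qed

lemma right_half: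
  assumes "kr \<le> m" "m \<le> n"
  shows "half_line (W X) (W (\<lambda>j. Y j - Y (p - 1) / X (p - 1) * X j)) (\<lambda>i. - b (n + 1 - i))
    (\<lambda>i. sgn (X n) * (-1) ^ i * f (n + 1 - i)) kr m lam S \<rho>"
proof -
  interpret F: forbidden_region "W X" "\<lambda>i. - b (n + 1 - i)" kr by (rule right_forbidden)
  define Z where "Z j = Y j - Y (p - 1) / X (p - 1) * X j" for j
  have Zrec: "Z (Suc j) = b j * Z j - Z (j - 1) + f j" if "1 \<le> j" "j \<le> n" for j
    unfolding Z_def recX[OF that] recY[OF that] by (simp only: algebra_simps)
  have "half_line (W X) (W Z) (\<lambda>i. - b (n + 1 - i))
    (\<lambda>i. sgn (X n) * (-1) ^ i * f (n + 1 - i)) kr m lam S \<rho>"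
  proof
    fix i assume i: "1 \<le> i" "i \<le> m"
    then have i': "i \<le> n" using assms by auto
    show "W X (Suc i) = - b (n + 1 - i) * W X i - W X (i - 1)"
      using W_rec[of X "\<lambda>_. 0" i] recX i i' by auto
    show "W Z (Suc i) = - b (n + 1 - i) * W Z i - W Z (i - 1) + sgn (X n) * (-1) ^ i * f (n + 1 - i)"
      by (rule W_rec[OF Zrec i(1) i'])
    have j: "1 \<le> n + 1 - i" "n + 1 - i \<le> n" "n + 1 - (i - 1) = Suc (n + 1 - i)" "n + 1 - Suc i = n + 1 - i - 1"
      using i i' by auto
    have "\<bar>sgn (X n) * (-1) ^ i * f (n + 1 - i)\<bar> = \<bar>f (n + 1 - i)\<bar>"
      using X_n_nonzero by (simp add: abs_mult power_abs abs_sgn_eq)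
    then show "\<bar>sgn (X n) * (-1) ^ i * f (n + 1 - i)\<bar>
        \<le> 3 * lam * \<bar>W X i\<bar> + 2 * (\<bar>W X (i - 1)\<bar> + \<bar>W X (Suc i)\<bar>)"
      using f_le[OF j(1,2)] unfolding abs_W j by (simp only: add.commute)
  next
    show "W Z 0 = 0" using Xn Yn by (simp add: W_def Z_def)
    have "n + 1 - Suc kr = p - 1" using p_le k2_le_p by (auto simp: kr_def)
    then show "W Z (Suc kr) = 0" using X_p_nonzero by (simp add: W_def Z_def)
    show "(\<Sum>i = 1..l. W X i) \<le> S * W X l" if "l \<le> kr" for l
      by (rule forbidden_constants(1)[OF right_forbidden right_BH that])
    show "3 * lam * W X l + 4 * W X (Suc l) \<le> \<rho> * W X (Suc l)" if "1 \<le> l" "l \<le> kr" for l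
      by (rule forbidden_constants(2)[OF right_forbidden right_BH that])
  qed (use F.X0 F.X1 assms lam4 F.X_step S_ge rho_pos in auto)
  then show ?thesis by (simp add: Z_def[abs_def])
qed

lemma W_inner: "m \<le> n \<Longrightarrow> (\<Sum>i=1..m. \<bar>W U i * W V i\<bar>) = (\<Sum>j=n+1-m..n. \<bar>U j * V j\<bar>)"
  unfolding abs_mult abs_W
  by (rule sum.reindex_bij_witness[where i="\<lambda>j. n + 1 - j" and j="\<lambda>j. n + 1 - j"]) auto

lemma W_norm: "m \<le> n \<Longrightarrow> (\<Sum>i=1..m. (W U i)\<^sup>2) = (\<Sum>j=n+1-m..n. (U j)\<^sup>2)"
  unfolding W_sq
  by (rule sum.reindex_bij_witness[where i="\<lambda>j. n + 1 - j" and j="\<lambda>j. n + 1 - j"]) auto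

lemma part_norm: "A \<subseteq> {1..n} \<Longrightarrow> (\<Sum>j\<in>A. (X j)\<^sup>2) \<le> 1"
  unfolding normX[symmetric] by (rule sum_mono2) auto

lemma C_pos: "C1 > 0" "C2 > 0" "x0 > 0" "\<Psi> > 0"
  using C1_ge C2_ge x0_ge1 Psi_ge1 by linarith+

lemma rho_S2: "\<rho> * S\<^sup>2 \<le> D1 * x0 ^ 4 * \<Psi>"
proof -
  have "\<rho> * S\<^sup>2 = D1 * \<Psi> * x0\<^sup>2" by (simp add: \<rho>_def S_def D1_def power_mult_distrib)
  also have "\<dots> \<le> D1 * \<Psi> * x0 ^ 4"
    using C_pos by (intro mult_left_mono x0_pow_mono) (auto simp: D1_def)
  finally show ?thesis by (simp add: mult_ac)
qed

lemma rho_S: "\<rho> * S \<le> D1 * x0 ^ 4 * \<Psi>"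
proof -
  have "S \<le> S\<^sup>2" using S_ge mult_right_mono[of 1 S S] by (simp add: power2_eq_square)
  then show ?thesis using rho_S2 rho_pos mult_left_mono[of S "S\<^sup>2" \<rho>] by linarith
qed

text \<open>H \<le> 4 lets G be absorbed into G / H and bounds ln (2 / H) from below. The logarithm
  is estimated by a whole factor x0: S \<lambda> / H already carries the order x0^4, so the exponent
  does not suffer.\<close>

lemma K_le:
  assumes "H \<le> 4"
  shows "5 * lam * (S + 1) + 3 * (5 * lam * (S + 1)) / H + 12 * (lam / H) * (1 + \<bar>ln (2 / H)\<bar>) \<le> D2 * x0 ^ 4 * \<Psi>"
proof -
  define E where "E = C1 * C2 * x0 ^ 3 * \<Psi>"
  have E: "lam / H \<le> E" "E > 0" using lam_H C_pos by (auto simp: E_def)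
  define G where "G = 5 * lam * (S + 1)"
  have G0: "G \<ge> 0" using lam4 S_ge by (simp add: G_def)
  have "G / H = 5 * (S + 1) * (lam / H)" by (simp add: G_def)
  also have "\<dots> \<le> (10 * S) * E" using E S_ge lam4 H_pos by (intro mult_mono[of "5 * (S + 1)"]) auto
  finally have GH: "G / H \<le> 10 * S * E" .
  have "G * H \<le> G * 4" using assms G0 by (intro mult_left_mono)
  then have "G \<le> 4 * (G / H)" using H_pos by (simp add: field_simps)
  then have 1: "G + 3 * G / H \<le> 70 * S * E" using GH by (simp add: field_simps)
  have l: "\<bar>ln (2 / H)\<bar> \<le> (2 * C1 + 3) * x0"
  proof -
    have "2 / H \<le> 2 * C1 * x0 ^ 3" using H_inverse by simp
    then have "ln (2 / H) \<le> ln (2 * C1 * x0 ^ 3)" using H_pos by (intro ln_mono) auto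
    also have "\<dots> = ln (2 * C1) + 3 * ln x0" using C_pos by (simp add: ln_mult ln_realpow)
    also have "\<dots> \<le> 2 * C1 + 3 * x0"
      using C_pos ln_less_self[of "2 * C1"] ln_less_self[of x0] by linarith
    also have "\<dots> \<le> (2 * C1 + 3) * x0"
      using x0_ge1 C_pos mult_left_mono[of 1 x0 "2 * C1"] by (simp add: algebra_simps)
    finally have u: "ln (2 / H) \<le> (2 * C1 + 3) * x0" .
    have "1 / 2 \<le> 2 / H" using assms H_pos by (simp add: field_simps)
    then have "ln (1 / 2) \<le> ln (2 / H)" using H_pos by (intro ln_mono) auto
    then have "- ln (2 / H) \<le> 1" using ln_less_self[of 2] ln_2_less_1 by (simp add: ln_div)
    also have "1 \<le> (2 * C1 + 3) * x0"
      using mult_mono[of 1 "2 * C1 + 3" 1 x0] x0_ge1 C_pos by auto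
    finally show ?thesis using u by (simp add: abs_le_iff)
  qed
  have "12 * (lam / H) * (1 + \<bar>ln (2 / H)\<bar>) \<le> 12 * E * ((2 * C1 + 4) * x0)"
  proof (rule mult_mono)
    show "1 + \<bar>ln (2 / H)\<bar> \<le> (2 * C1 + 4) * x0" using l x0_ge1 by (simp add: algebra_simps)
  qed (use E lam4 H_pos in auto)
  then have "G + 3 * G / H + 12 * (lam / H) * (1 + \<bar>ln (2 / H)\<bar>) \<le> 70 * S * E + 12 * E * ((2 * C1 + 4) * x0)"
    using 1 by linarith
  also have "\<dots> = D2 * x0 ^ 4 * \<Psi>"
    by (simp add: E_def S_def D2_def power3_eq_cube power4_eq_xxxx algebra_simps)
  finally show ?thesis by (simp add: G_def)
qed

text \<open>The solutions controlled from the left and from the right differ by a multiple of X; its size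
  is read off at the middle index m, and orthogonality of X and Y then determines \<alpha>.\<close>

lemma alpha_bound_multi:
  assumes H4: "H \<le> 4"
  shows "\<bar>Y (Suc q) / X (Suc q)\<bar> \<le> D3 * x0 ^ 4 * \<Psi>"
proof -
  define \<alpha> where "\<alpha> = Y (Suc q) / X (Suc q)"
  define \<beta> where "\<beta> = Y (p - 1) / X (p - 1)"
  define ZL where "ZL j = Y j - \<alpha> * X j" for j
  define ZR where "ZR j = Y j - \<beta> * X j" for j
  \<comment> \<open>The last index with b \<ge> 0: up to m the energies for b apply, beyond m those
    of the reflection, for -b.\<close>
  define m where "m = Max {j \<in> {1..n}. 0 \<le> b j}"
  have fin: "finite {j \<in> {1..n}. 0 \<le> b j}" "q \<in> {j \<in> {1..n}. 0 \<le> b j}"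
    using b_q_nonneg q_less_n q_ge by auto
  have mM: "m \<in> {j \<in> {1..n}. 0 \<le> b j}" unfolding m_def by (rule Max_in) (use fin in auto)
  have "q \<le> m" unfolding m_def by (rule Max_ge[OF fin])
  then have m: "q \<le> m" "1 \<le> m" "m \<le> n" "0 \<le> b m" using mM by auto
  have above_m: "b j < 0" if "m < j" "j \<le> n" for j
    using that Max_ge[OF fin(1), of j] m unfolding m_def[symmetric] by force
  have mp: "m < p" using p_gt[of m] m by auto
  have krm: "kr \<le> n - m" using mp by (auto simp: kr_def)
  interpret L0: half_line X ZL b f q m lam S \<rho>
    using left_half[OF m(1,3)] by (simp add: ZL_def[abs_def] \<alpha>_def)
  interpret L: half_line_osc X ZL b f q m lam S \<rho> H
  proof
    show "0 \<le> b j" if "1 \<le> j" "j \<le> m" for j using b_mono[of j m] m that by auto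
    show "b (Suc j) \<le> b j" for j by (rule b_mono) simp
    show "H > 0" by (rule H_pos)
    show "H * (real j - real q - 1) \<le> 2 - b j" if "q < j" "j \<le> m" for j
    proof -
      have "b j \<le> b (Suc q) - H * (real j - real (Suc q))" using that by (intro b_steps) auto
      moreover have "b (Suc q) \<le> 2" using b_mono[of "Suc k" "Suc q"] q_ge k_facts by auto
      ultimately show ?thesis by (simp add: algebra_simps)
    qed
  qed
  interpret R0: half_line "W X" "W ZR" "\<lambda>i. - b (n + 1 - i)" "\<lambda>i. sgn (X n) * (-1) ^ i * f (n + 1 - i)" kr "n - m" lam S \<rho>
    using right_half[OF krm] by (simp add: ZR_def[abs_def] \<beta>_def)
  interpret R: half_line_osc "W X" "W ZR" "\<lambda>i. - b (n + 1 - i)" "\<lambda>i. sgn (X n) * (-1) ^ i * f (n + 1 - i)" kr "n - m" lam S \<rho> H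
  proof
    show "0 \<le> - b (n + 1 - i)" if "1 \<le> i" "i \<le> n - m" for i
    proof -
      have "m < n + 1 - i" "n + 1 - i \<le> n" using that by auto
      then show ?thesis using above_m[of "n + 1 - i"] by linarith
    qed
    show "- b (n + 1 - Suc i) \<le> - b (n + 1 - i)" for i using b_mono[of "n + 1 - Suc i" "n + 1 - i"] by auto
    show "H > 0" by (rule H_pos)
    show "H * (real i - real kr - 1) \<le> 2 - - b (n + 1 - i)" if i: "kr < i" "i \<le> n - m" for i
    proof -
      have j: "n + 1 - i \<le> p - 1" "q \<le> n + 1 - i" using i m p_le by (auto simp: kr_def)
      have "b (p - 1) \<le> b (n + 1 - i) - H * (real (p - 1) - real (n + 1 - i))" using j by (intro b_steps) auto
      moreover have "-2 \<le> b (p - 1)" using below_p[of "p - 1"] k2_le_p by auto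
      moreover have "real (p - 1) - real (n + 1 - i) = real i - real kr - 1"
        using i p_le k2_le_p unfolding kr_def by linarith
      ultimately show ?thesis by simp
    qed
  qed
  have GG: "L.G = 5 * lam * (S + 1)" "R.G = 5 * lam * (S + 1)" by (simp_all only: L.G_def R.G_def)
  have K: "L.K \<le> D2 * x0 ^ 4 * \<Psi>" "R.K \<le> D2 * x0 ^ 4 * \<Psi>"
    using K_le[OF H4] unfolding L.K_def R.K_def GG by auto
  define KK where "KK = D2 * x0 ^ 4 * \<Psi>"
  define DD where "DD = D1 * x0 ^ 4 * \<Psi>"
  have K0: "0 \<le> L.K" "0 \<le> R.K" "0 \<le> \<rho> * S" using L.K_ge_G R.K_ge_G rho_pos S_ge by auto
  define N where "N = (X m)\<^sup>2 + (X (Suc m))\<^sup>2"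
  have N: "N > 0"
  proof -
    have "N \<noteq> 0" using two_term_zero[where X=X and b=b and n=n and m=m] recX X1 m by (auto simp: N_def)
    then show ?thesis by (simp add: N_def less_le)
  qed
  have "(ZL m)\<^sup>2 + (ZL (Suc m))\<^sup>2 \<le> (\<rho> * S + L.K)\<^sup>2 * N" using L.end_bound by (simp add: N_def)
  also have "\<dots> \<le> (DD + KK)\<^sup>2 * N"
    using N K K0 rho_S unfolding KK_def DD_def by (intro mult_right_mono power_mono add_mono) auto
  finally have eL: "(ZL m)\<^sup>2 + (ZL (Suc m))\<^sup>2 \<le> (DD + KK)\<^sup>2 * N" .
  have idx: "n + 1 - (n - m) = Suc m" "n + 1 - Suc (n - m) = m" using m by auto
  have "(ZR m)\<^sup>2 + (ZR (Suc m))\<^sup>2 \<le> (\<rho> * S + R.K)\<^sup>2 * N"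
    using R.end_bound unfolding W_sq idx by (simp add: N_def add.commute)
  also have "\<dots> \<le> (DD + KK)\<^sup>2 * N"
    using N K K0 rho_S unfolding KK_def DD_def by (intro mult_right_mono power_mono add_mono) auto
  finally have eR: "(ZR m)\<^sup>2 + (ZR (Suc m))\<^sup>2 \<le> (DD + KK)\<^sup>2 * N" .
  define d where "d = \<beta> - \<alpha>"
  \<comment> \<open>Used at m and m + 1 together, where the squares of X have positive sum N; this
    avoids dividing by a single coordinate, which might vanish.\<close>
  have dX: "d * X j = ZL j - ZR j" for j by (simp add: d_def ZL_def ZR_def algebra_simps)
  have sq: "(x - y)\<^sup>2 \<le> 2 * x\<^sup>2 + 2 * y\<^sup>2" for x y :: real
    using zero_le_power2[of "x + y"] by (simp add: power2_eq_square algebra_simps)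
  have "d\<^sup>2 * N = (d * X m)\<^sup>2 + (d * X (Suc m))\<^sup>2" by (simp add: N_def power_mult_distrib algebra_simps)
  also have "\<dots> \<le> 4 * ((DD + KK)\<^sup>2 * N)"
    unfolding dX using sq[of "ZL m" "ZR m"] sq[of "ZL (Suc m)" "ZR (Suc m)"] eL eR by linarith
  also have "\<dots> = (2 * (DD + KK))\<^sup>2 * N" by (simp only: power_mult_distrib) simp
  finally have "d\<^sup>2 \<le> (2 * (DD + KK))\<^sup>2" using N by simp
  moreover have "0 \<le> DD + KK" using K K0 rho_S unfolding KK_def DD_def by linarith
  ultimately have d: "\<bar>d\<bar> \<le> 2 * (DD + KK)" using abs_le_square_iff[of d "2 * (DD + KK)"] by simp
  have iL: "(\<Sum>j=1..m. \<bar>X j * ZL j\<bar>) \<le> DD + 2 * KK"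
  proof -
    have "(\<Sum>j=1..m. \<bar>X j * ZL j\<bar>) \<le> (\<rho> * S\<^sup>2 + 2 * L.K) * (\<Sum>j=1..m. (X j)\<^sup>2)" by (rule L.inner_bound)
    also have "\<dots> \<le> (\<rho> * S\<^sup>2 + 2 * L.K) * 1"
      using m K0 rho_pos by (intro mult_left_mono part_norm) auto
    finally show ?thesis using rho_S2 K by (simp add: KK_def DD_def)
  qed
  have iR: "(\<Sum>j=Suc m..n. \<bar>X j * ZR j\<bar>) \<le> DD + 2 * KK"
  proof -
    have "(\<Sum>j=Suc m..n. \<bar>X j * ZR j\<bar>) \<le> (\<rho> * S\<^sup>2 + 2 * R.K) * (\<Sum>j=Suc m..n. (X j)\<^sup>2)"
      using R.inner_bound unfolding W_inner[OF diff_le_self] W_norm[OF diff_le_self] idx .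
    also have "\<dots> \<le> (\<rho> * S\<^sup>2 + 2 * R.K) * 1"
      using m K0 rho_pos by (intro mult_left_mono part_norm) auto
    finally show ?thesis using rho_S2 K by (simp add: KK_def DD_def)
  qed
  have split: "(\<Sum>j=1..n. g j) = (\<Sum>j=1..m. g j) + (\<Sum>j=Suc m..n. g j)" for g :: "nat \<Rightarrow> real"
    using m by (subst sum.union_disjoint[symmetric]) (auto intro!: sum.cong)
  have e1: "(\<Sum>j=1..m. X j * Y j) = (\<Sum>j=1..m. X j * ZL j) + \<alpha> * (\<Sum>j=1..m. (X j)\<^sup>2)"
    unfolding sum_distrib_left sum.distrib[symmetric]
    by (rule sum.cong) (auto simp: ZL_def power2_eq_square algebra_simps)
  have e2: "(\<Sum>j=Suc m..n. X j * Y j) = (\<Sum>j=Suc m..n. X j * ZR j) + (\<alpha> + d) * (\<Sum>j=Suc m..n. (X j)\<^sup>2)"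
    unfolding sum_distrib_left sum.distrib[symmetric]
    by (rule sum.cong) (auto simp: ZR_def d_def power2_eq_square algebra_simps)
  \<comment> \<open>On the right half Y = ZR + (\<alpha> + d) X. By the unit norm of X, \<alpha>
    appears with weight 1 and d with the share of the right half.\<close>
  have "0 = (\<Sum>j=1..m. X j * ZL j) + (\<Sum>j=Suc m..n. X j * ZR j) + \<alpha> + d * (\<Sum>j=Suc m..n. (X j)\<^sup>2)"
  proof -
    have "\<alpha> = \<alpha> * ((\<Sum>j=1..m. (X j)\<^sup>2) + (\<Sum>j=Suc m..n. (X j)\<^sup>2))"
      using normX split[of "\<lambda>j. (X j)\<^sup>2"] by simp
    then show ?thesis using orth split[of "\<lambda>j. X j * Y j"] e1 e2 by (simp add: algebra_simps)
  qed
  moreover have "\<bar>\<Sum>j=1..m. X j * ZL j\<bar> \<le> DD + 2 * KK" by (rule order_trans[OF sum_abs iL])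
  moreover have "\<bar>\<Sum>j=Suc m..n. X j * ZR j\<bar> \<le> DD + 2 * KK" by (rule order_trans[OF sum_abs iR])
  moreover have "\<bar>d * (\<Sum>j=Suc m..n. (X j)\<^sup>2)\<bar> \<le> 2 * (DD + KK)"
  proof -
    have "0 \<le> (\<Sum>j=Suc m..n. (X j)\<^sup>2)" "(\<Sum>j=Suc m..n. (X j)\<^sup>2) \<le> 1"
      using m by (auto intro!: sum_nonneg part_norm)
    then have "\<bar>d\<bar> * (\<Sum>j=Suc m..n. (X j)\<^sup>2) \<le> \<bar>d\<bar> * 1" by (intro mult_left_mono) auto
    then show ?thesis using d \<open>0 \<le> (\<Sum>j=Suc m..n. (X j)\<^sup>2)\<close> by (simp add: abs_mult)
  qed
  moreover have "\<bar>x\<bar> \<le> 2 * r + s" if "0 = u + v + x + w" "\<bar>u\<bar> \<le> r" "\<bar>v\<bar> \<le> r" "\<bar>w\<bar> \<le> s" for x u v w r s :: real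
    using that by linarith
  ultimately have "\<bar>\<alpha>\<bar> \<le> 2 * (DD + 2 * KK) + 2 * (DD + KK)" by blast
  then show ?thesis by (simp add: \<alpha>_def D3_def DD_def KK_def algebra_simps)
qed

text \<open>If H is large, k + 1 is the only index outside the forbidden regions, and the left and the
  right normalisation coincide.\<close>

lemma alpha_bound_single:
  assumes H4: "H > 4"
  shows "\<bar>Y (Suc q) / X (Suc q)\<bar> \<le> D3 * x0 ^ 4 * \<Psi>"
proof -
  have kc: "c < real k" using H_le2 H4 by force
  have qk: "q = k" by (rule q_eq_k[OF kc])
  \<comment> \<open>A drop by more than 4 from b (k + 1) \<le> 2 ends below -2.\<close>
  have pk: "p = k + 2"
  proof -
    have "\<not> k + 2 < p"
    proof
      assume "k + 2 < p"
      then have "-2 \<le> b (k + 2)" using below_p by auto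
      moreover have "b (k + 2) \<le> b (Suc k) - H" using b_step[of "Suc k"] qk by simp
      ultimately show False using k_facts H4 by linarith
    qed
    then show ?thesis using k2_le_p by auto
  qed
  define \<alpha> where "\<alpha> = Y (Suc q) / X (Suc q)"
  define Z where "Z j = Y j - \<alpha> * X j" for j
  interpret L: half_line X Z b f q q lam S \<rho>
    using left_half[of q] q_less_n by (simp add: Z_def[abs_def] \<alpha>_def)
  have \<alpha>': "Y (p - 1) / X (p - 1) = \<alpha>" using pk qk by (simp add: \<alpha>_def)
  have kr: "kr \<le> n" "n + 1 - kr = p" using k2_le_p p_le by (auto simp: kr_def)
  interpret R: half_line "W X" "W Z" "\<lambda>i. - b (n + 1 - i)" "\<lambda>i. sgn (X n) * (-1) ^ i * f (n + 1 - i)" kr kr lam S \<rho>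
    using right_half[OF order_refl kr(1)] unfolding \<alpha>' by (simp add: Z_def[abs_def])
  have iL: "(\<Sum>j=1..q. \<bar>X j * Z j\<bar>) \<le> D1 * x0 ^ 4 * \<Psi>"
  proof -
    have "(\<Sum>j=1..q. \<bar>X j * Z j\<bar>) \<le> \<rho> * S\<^sup>2 * (\<Sum>j=1..q. (X j)\<^sup>2)" by (rule L.inner_left)
    also have "\<dots> \<le> \<rho> * S\<^sup>2 * 1" using q_less_n rho_pos by (intro mult_left_mono part_norm) auto
    finally show ?thesis using rho_S2 by simp
  qed
  have iR: "(\<Sum>j=p..n. \<bar>X j * Z j\<bar>) \<le> D1 * x0 ^ 4 * \<Psi>"
  proof -
    have "(\<Sum>j=p..n. \<bar>X j * Z j\<bar>) \<le> \<rho> * S\<^sup>2 * (\<Sum>j=p..n. (X j)\<^sup>2)"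
      using R.inner_left unfolding W_inner[OF kr(1)] W_norm[OF kr(1)] kr(2) .
    also have "\<dots> \<le> \<rho> * S\<^sup>2 * 1" using k2_le_p rho_pos by (intro mult_left_mono part_norm) auto
    finally show ?thesis using rho_S2 by simp
  qed
  have "{1..n} = {1..q} \<union> {Suc q} \<union> {p..n}" using pk qk kn by auto
  then have split: "(\<Sum>j=1..n. g j) = (\<Sum>j=1..q. g j) + g (Suc q) + (\<Sum>j=p..n. g j)" for g :: "nat \<Rightarrow> real"
    using pk qk by (simp add: sum.union_disjoint)
  have "0 = (\<Sum>j=1..n. X j * Z j) + \<alpha> * (\<Sum>j=1..n. (X j)\<^sup>2)"
    unfolding orth[symmetric] sum_distrib_left sum.distrib[symmetric]
    by (rule sum.cong) (auto simp: Z_def power2_eq_square algebra_simps)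
  then have "\<alpha> = - ((\<Sum>j=1..q. X j * Z j) + (\<Sum>j=p..n. X j * Z j))"
    using normX split[of "\<lambda>j. X j * Z j"] L.Zq by simp
  moreover have "\<bar>\<Sum>j=1..q. X j * Z j\<bar> \<le> D1 * x0 ^ 4 * \<Psi>" by (rule order_trans[OF sum_abs iL])
  moreover have "\<bar>\<Sum>j=p..n. X j * Z j\<bar> \<le> D1 * x0 ^ 4 * \<Psi>" by (rule order_trans[OF sum_abs iR])
  ultimately have "\<bar>\<alpha>\<bar> \<le> 2 * D1 * (x0 ^ 4 * \<Psi>)" by linarith
  also have "\<dots> \<le> D3 * (x0 ^ 4 * \<Psi>)"
    using C_pos by (intro mult_right_mono) (auto simp: D3_def D1_def D2_def intro!: add_nonneg_nonneg mult_nonneg_nonneg)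
  finally show ?thesis by (simp add: \<alpha>_def mult_ac)
qed

lemma alpha_bound: "\<bar>Y (Suc q) / X (Suc q)\<bar> \<le> D3 * x0 ^ 4 * \<Psi>"
  using alpha_bound_single alpha_bound_multi by (cases "H \<le> 4") auto

end

section \<open>The pointwise bound\<close>

context eig_problem
begin

section \<open>The logarithm of the first coordinate\<close>

definition "\<Lambda> = - ln (X 1)"

lemma X_le_1: assumes "1 \<le> j" "j \<le> n" shows "X j \<le> 1"
proof -
  have "(X j)\<^sup>2 \<le> 1" using part_norm[of "{j}"] assms by simp
  then show ?thesis by (simp add: abs_square_le_1 abs_le_iff)
qed

lemma ln2_ge: "ln (2::real) \<ge> 1 / 2"
  using ln_le_minus_one[of "1 / 2 :: real"] by (simp add: ln_div)

text \<open>X 1 \<le> X 2 and the unit norm give (X 1)^2 \<le> 1/2. Constants can therefore be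
  absorbed into \<Lambda>.\<close>

lemma Lambda_ge: "\<Lambda> \<ge> 1 / 4"
proof -
  have "(\<Sum>j\<in>{1,2}. (X j)\<^sup>2) \<le> 1" by (rule part_norm) (use kn k1 in auto)
  then have "(X 1)\<^sup>2 + (X 2)\<^sup>2 \<le> 1" by simp
  moreover have "(X 1)\<^sup>2 \<le> (X 2)\<^sup>2"
    using left_step[of 1] q_ge k1 X1 by (intro power_mono) (auto simp: numeral_2_eq_2)
  ultimately have "(X 1)\<^sup>2 \<le> 1 / 2" by linarith
  then have "ln ((X 1)\<^sup>2) \<le> ln (1 / 2)" using X1 by (intro ln_mono) auto
  also have "\<dots> = - ln 2" by (simp add: ln_div)
  finally show ?thesis using X1 ln2_ge by (simp add: \<Lambda>_def ln_realpow)
qed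

text \<open>For indices up to k / 2, b - 2 is at least H k / 2 = (k / c)^a, so X gains a factor t =
  1 + (k / c)^(a/2) per step and still ends below 1. Hence \<Lambda> \<ge> (k / 3) ln t; the two
  estimates use t \<ge> 2 and t \<ge> sqrt (k / c).\<close>

lemma Lambda_large:
  assumes kc: "c < real k"
  shows "real k \<le> 6 * \<Lambda>" "real k * ln (real k / c) \<le> 6 * \<Lambda>"
proof -
  define \<kappa> where "\<kappa> = (real k / c) powr a"
  have qk: "q = k" by (rule q_eq_k[OF kc])
  have y: "1 < real k / c" using kc c1 by simp
  have \<kappa>: "real k / c \<le> \<kappa>" using powr_mono[of 1 a "real k / c"] y a1 c1 by (simp add: \<kappa>_def)
  interpret F: forbidden_region X b k by (rule forbidden_left[OF qk])
  define h where "h = k div 2"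
  have h: "real k \<le> 3 * real h" "2 * h \<le> k" "1 \<le> h"
  proof -
    have "k \<le> 3 * h" unfolding h_def using k1 by presburger
    then show "real k \<le> 3 * real h" by linarith
    show "1 \<le> h" unfolding h_def using k1 by presburger
  qed (simp add: h_def)
  define t where "t = 1 + sqrt \<kappa>"
  have t: "t \<ge> 1 + 1" "sqrt (real k / c) \<le> t"
  proof -
    have "1 \<le> \<kappa>" using \<kappa> y by linarith
    then show "t \<ge> 1 + 1" by (simp add: t_def)
    have "sqrt (real k / c) \<le> sqrt \<kappa>" using \<kappa> by (rule real_sqrt_le_mono)
    then show "sqrt (real k / c) \<le> t" unfolding t_def by linarith
  qed
  have grow: "t ^ i * X 1 \<le> X (Suc i)" if "i \<le> h" for i
    using that
  proof (induction i)
    case (Suc i)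
    have i: "1 \<le> Suc i" "Suc i \<le> k" using Suc h by auto
    have "H * (real k / 2) = \<kappa>" using H_large[OF kc] k1 by (simp add: \<kappa>_def)
    moreover have "H * (real k / 2) \<le> H * (real k - real (Suc i))"
    proof (rule mult_left_mono)
      have "2 * Suc i \<le> k" using Suc.prems h(2) by presburger
      then have "real (2 * Suc i) \<le> real k" by (simp only: of_nat_le_iff)
      then show "real k / 2 \<le> real k - real (Suc i)" by simp
    qed (use H_pos in auto)
    ultimately have "\<kappa> \<le> b (Suc i) - 2" using b_left[OF qk i(2)] by linarith
    then have "t \<le> 1 + sqrt (b (Suc i) - 2)" by (simp add: t_def)
    moreover have "X (Suc i) > 0" using F.X_pos[OF i] .
    ultimately have "t * X (Suc i) \<le> (1 + sqrt (b (Suc i) - 2)) * X (Suc i)" by (intro mult_right_mono) auto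
    also have "\<dots> \<le> X (Suc (Suc i))" using F.growth_sqrt[OF i] by simp
    finally have "t * X (Suc i) \<le> X (Suc (Suc i))" .
    moreover have "t * (t ^ i * X 1) \<le> t * X (Suc i)" using Suc t by (intro mult_left_mono) auto
    ultimately show ?case by simp
  qed simp
  have "t ^ h * X 1 \<le> X (Suc h)" using grow by simp
  also have "\<dots> \<le> 1" using h kn by (intro X_le_1) auto
  finally have "ln (t ^ h * X 1) \<le> ln 1" using t X1 by (intro ln_mono) (auto intro!: mult_pos_pos)
  then have L: "real h * ln t \<le> \<Lambda>" using t X1 by (simp add: ln_mult ln_realpow \<Lambda>_def)
  have "ln 2 \<le> ln t" using t by (intro ln_mono) auto
  then have l1: "1 / 2 \<le> ln t" using ln2_ge by linarith
  have "ln (sqrt (real k / c)) \<le> ln t" using t y by (intro ln_mono) auto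
  then have l2: "ln (real k / c) / 2 \<le> ln t" using y by (simp add: ln_sqrt)
  have "real k / 3 * (1 / 2) \<le> real h * ln t" using h l1 by (intro mult_mono) auto
  then show "real k \<le> 6 * \<Lambda>" using L by linarith
  have "real k / 3 * (ln (real k / c) / 2) \<le> real h * ln t" using h l2 y by (intro mult_mono) auto
  then show "real k * ln (real k / c) \<le> 6 * \<Lambda>" using L by linarith
qed

lemma Psi_le: "\<Psi> \<le> 12 * \<Lambda>"
  using Lambda_ge Lambda_large(1) k1 by (auto simp: \<Psi>_def)

text \<open>k ln (k / c) is paid by \<Lambda>, and ln c is O(x0). The extra x0 is affordable, as the
  sum to be bounded then has order x0^2 only.\<close>

lemma k_ln_k:
  assumes kc: "c < real k"
  shows "real k * (1 + ln (real k)) \<le> 30 * x0 * \<Lambda>"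
proof -
  have "ln c \<le> ln (x0 ^ 3)" using c_le_x0 c1 by (intro ln_mono) auto
  also have "\<dots> = 3 * ln x0" using C_pos by (simp add: ln_realpow)
  also have "\<dots> \<le> 3 * x0" using C_pos ln_less_self[of x0] by linarith
  finally have "ln c \<le> 3 * x0" .
  then have "real k * ln c \<le> (6 * \<Lambda>) * (3 * x0)"
    using Lambda_large(1)[OF kc] c1 Lambda_ge by (intro mult_mono) auto
  moreover have "real k * ln (real k) = real k * ln (real k / c) + real k * ln c"
    using c1 k1 by (simp add: ln_div algebra_simps)
  moreover have "\<Lambda> \<le> x0 * \<Lambda>" using x0_ge1 Lambda_ge by simp
  ultimately show ?thesis using Lambda_large[OF kc] by (simp add: algebra_simps)
qed

text \<open>At most c \<le> x0^3 steps, each of cost \<rho> S = O(x0).\<close>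

lemma ratio_sum_small:
  assumes "real k \<le> c"
  shows "(\<Sum>l=1..q. (3 * lam * (X l / X (Suc l)) + 4) * S) \<le> 100 * D1 * x0 ^ 4 * \<Lambda>"
proof -
  interpret L: half_line X "\<lambda>j. Y j - Y (Suc q) / X (Suc q) * X j" b f q q lam S \<rho>
    using left_half[of q] q_less_n by simp
  have "(\<Sum>l=1..q. (3 * lam * (X l / X (Suc l)) + 4) * S) \<le> (\<Sum>l=1..q. \<rho> * S)"
    by (intro sum_mono L.rho_step) auto
  also have "\<dots> = real q * (\<rho> * S)" by simp
  also have "\<dots> \<le> x0 ^ 3 * (\<rho> * S)"
    using q_le_c[OF assms] c_le_x0 rho_pos S_ge by (intro mult_right_mono) auto
  also have "\<dots> = 7 * C2 * (3 + C1) * x0 ^ 4"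
    using assms by (simp add: \<rho>_def S_def \<Psi>_def power3_eq_cube power4_eq_xxxx)
  also have "\<dots> \<le> D1 * x0 ^ 4"
  proof (rule mult_right_mono)
    have "(3 + C1) * 1 \<le> (3 + C1) * (3 + C1)" using C_pos by (intro mult_left_mono) auto
    then have "7 * C2 * (3 + C1) \<le> 7 * C2 * ((3 + C1) * (3 + C1))" using C_pos by (intro mult_left_mono) auto
    then show "7 * C2 * (3 + C1) \<le> D1" by (simp only: D1_def power2_eq_square)
  qed (use C_pos in auto)
  also have "\<dots> \<le> D1 * x0 ^ 4 * (100 * \<Lambda>)"
    using mult_left_mono[of 1 "100 * \<Lambda>" "D1 * x0 ^ 4"] Lambda_ge C_pos by (simp add: D1_def)
  finally show ?thesis by (simp add: mult_ac)
qed

text \<open>Counting steps would give k \<rho> S with \<rho> of order k, hence k^2, more than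
  \<open>Lambda_large\<close> pays for. Since X l / X (l + 1) is at most 1 / (H (k - l)) and
  \<lambda> / H is O(k), the sum is k times a harmonic one.\<close>

lemma ratio_sum_large:
  assumes kc: "c < real k"
  shows "(\<Sum>l=1..q. (3 * lam * (X l / X (Suc l)) + 4) * S) \<le> 100 * D1 * x0 ^ 4 * \<Lambda>"
proof -
  have qk: "q = k" by (rule q_eq_k[OF kc])
  interpret F: forbidden_region X b k by (rule forbidden_left[OF qk])
  interpret L: half_line X "\<lambda>j. Y j - Y (Suc q) / X (Suc q) * X j" b f q q lam S \<rho>
    using left_half[of q] q_less_n by simp
  define M where "M = C2 * real k"
  have M: "real k \<le> M" "M \<ge> 0"
    using C2_ge mult_right_mono[of 1 C2 "real k"] by (auto simp: M_def)
  have single: "3 * lam * (X l / X (Suc l)) + 4 \<le> 3 * M / 2 * (1 / real (k - l)) + 4"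
    if l: "l \<in> {1..k - 1}" for l
  proof -
    have l': "1 \<le> l" "l \<le> k" "l < k" using l by auto
    have p: "X l > 0" "X (Suc l) > 0" using left_pos l' qk by auto
    define g where "g = H * real (k - l)"
    have g: "g > 0" using H_pos l' by (simp add: g_def)
    have "g \<le> b l - 1" using b_left[OF qk l'(2)] l' by (simp add: g_def of_nat_diff)
    then have "g * X l \<le> (b l - 1) * X l" using p by (intro mult_right_mono) auto
    also have "\<dots> \<le> X (Suc l)" by (rule F.growth_linear) (use l' in auto)
    finally have "X l / X (Suc l) \<le> 1 / g" using g p by (simp add: field_simps)
    then have "3 * lam * (X l / X (Suc l)) \<le> 3 * (M / 2 * H) * (1 / g)"
      using lam_large(2)[OF kc] lam4 p g M H_pos unfolding M_def
      by (intro mult_mono) auto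
    also have "\<dots> = 3 * M / 2 * (1 / real (k - l))" using H_pos by (simp add: g_def)
    finally show ?thesis by simp
  qed
  \<comment> \<open>At l = k the distance k - l is 0, so this term is left to
    \<open>rho_step\<close>.\<close>
  have "(\<Sum>l=1..k. (3 * lam * (X l / X (Suc l)) + 4) * S)
     = (\<Sum>l=1..k-1. (3 * lam * (X l / X (Suc l)) + 4) * S) + (3 * lam * (X k / X (Suc k)) + 4) * S"
    using k1 by (cases k) auto
  also have "\<dots> \<le> (\<Sum>l=1..k-1. (3 * M / 2 * (1 / real (k - l)) + 4) * S) + \<rho> * S"
    using L.rho_step[of k] qk k1 S_ge by (intro add_mono sum_mono mult_right_mono single) auto
  also have "(\<Sum>l=1..k-1. (3 * M / 2 * (1 / real (k - l)) + 4) * S)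
     = (3 * M / 2 * (\<Sum>l=1..k-1. 1 / real (k - l)) + 4 * real (k - 1)) * S"
    unfolding sum_distrib_right[symmetric] sum.distrib sum_distrib_left[symmetric] by simp
  also have "(\<Sum>l=1..k-1. 1 / real (k - l)) = (\<Sum>r=1..k-1. 1 / real r)"
    by (rule sum.reindex_bij_witness[where i="\<lambda>r. k - r" and j="\<lambda>l. k - l"]) auto
  also have "(3 * M / 2 * (\<Sum>r=1..k-1. 1 / real r) + 4 * real (k - 1)) * S + \<rho> * S
     \<le> (3 * M / 2 * (1 + ln (real k)) + 4 * M) * S + 14 * M * S"
  proof (intro add_mono mult_right_mono mult_left_mono)
    have "(\<Sum>r=1..k-1. 1 / real r) \<le> 1 + ln (real (k - 1))" by (rule harmonic_le)
    also have "\<dots> \<le> 1 + ln (real k)" using k1 by simp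
    finally show "(\<Sum>r=1..k-1. 1 / real r) \<le> 1 + ln (real k)" .
    have "real (k - 1) \<le> real k" by simp
    then show "real (k - 1) \<le> M" using M by linarith
    have "1 + real k \<le> 2 * real k" using k1 by simp
    then have "C2 * (1 + real k) \<le> C2 * (2 * real k)" using C_pos by (intro mult_left_mono) auto
    moreover have "\<rho> = 7 * (C2 * (1 + real k))" using kc by (simp add: \<rho>_def \<Psi>_def)
    moreover have "14 * M = 7 * (C2 * (2 * real k))" by (simp add: M_def)
    ultimately show "\<rho> \<le> 14 * M" by linarith
  qed (use M S_ge in auto)
  also have "\<dots> \<le> 20 * (M * (1 + ln (real k))) * S"
  proof -
    have "0 \<le> ln (real k)" using k1 by simp
    then have "0 \<le> M * ln (real k)" using M by simp
    then have "3 * M / 2 * (1 + ln (real k)) + 4 * M + 14 * M \<le> 20 * (M * (1 + ln (real k)))"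
      using M by (simp add: algebra_simps)
    then show ?thesis using S_ge by (simp only: distrib_right[symmetric]) (intro mult_right_mono, auto)
  qed
  also have "\<dots> = 20 * C2 * (real k * (1 + ln (real k))) * S" by (simp add: M_def)
  also have "\<dots> \<le> 20 * C2 * (30 * x0 * \<Lambda>) * S"
    using k_ln_k[OF kc] C_pos S_ge by (intro mult_right_mono mult_left_mono) auto
  also have "\<dots> = 600 * C2 * (3 + C1) * \<Lambda> * x0\<^sup>2" by (simp add: S_def power2_eq_square)
  also have "\<dots> \<le> 700 * C2 * (3 + C1)\<^sup>2 * \<Lambda> * x0 ^ 4"
  proof (intro mult_mono)
    have "(3 + C1) * 1 \<le> (3 + C1) * (3 + C1)" using C_pos by (intro mult_left_mono) auto
    then show "3 + C1 \<le> (3 + C1)\<^sup>2" by (simp add: power2_eq_square)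
  qed (use C_pos Lambda_ge x0_pow_mono[of 2 4] in auto)
  also have "\<dots> = 100 * D1 * x0 ^ 4 * \<Lambda>" by (simp add: D1_def)
  finally show ?thesis using qk by simp
qed

lemma pointwise_bound:
  assumes j: "1 \<le> j" "j \<le> k"
  shows "\<bar>Y j\<bar> \<le> (12 * D3 + 100 * D1) * (- ln (X 1)) * c powr (4 * a / (a + 2)) * X j"
proof -
  define \<alpha> where "\<alpha> = Y (Suc q) / X (Suc q)"
  interpret L: half_line X "\<lambda>j. Y j - \<alpha> * X j" b f q q lam S \<rho>
    using left_half[of q] q_less_n by (simp add: \<alpha>_def)
  have jq: "j \<le> Suc q" using j q_ge by auto
  have p: "X j > 0" using left_pos j jq by auto
  have "\<bar>(Y j - \<alpha> * X j) / X j\<bar> \<le> (\<Sum>l=j..q. (3 * lam * (X l / X (Suc l)) + 4) * S)"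
    by (rule L.ratio_bound[OF j(1) jq])
  also have "\<dots> \<le> (\<Sum>l=1..q. (3 * lam * (X l / X (Suc l)) + 4) * S)"
  proof (rule sum_mono2)
    fix l assume "l \<in> {1..q} - {j..q}"
    then have "0 < X l" "0 < X (Suc l)" using left_pos by auto
    then have "0 \<le> X l / X (Suc l)" by simp
    then have "0 \<le> 3 * lam * (X l / X (Suc l))" using lam4 by (intro mult_nonneg_nonneg) auto
    then show "0 \<le> (3 * lam * (X l / X (Suc l)) + 4) * S" using S_ge by (intro mult_nonneg_nonneg) linarith+
  qed (use j in auto)
  also have "\<dots> \<le> 100 * D1 * x0 ^ 4 * \<Lambda>"
    using ratio_sum_small ratio_sum_large by (cases "real k \<le> c") auto
  finally have 1: "\<bar>(Y j - \<alpha> * X j) / X j\<bar> \<le> 100 * D1 * x0 ^ 4 * \<Lambda>" .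
  have D0: "0 \<le> D3"
    using C_pos by (auto simp: D3_def D1_def D2_def intro!: add_nonneg_nonneg mult_nonneg_nonneg)
  have "\<bar>\<alpha>\<bar> \<le> D3 * x0 ^ 4 * \<Psi>" unfolding \<alpha>_def by (rule alpha_bound)
  also have "\<dots> \<le> D3 * x0 ^ 4 * (12 * \<Lambda>)" using Psi_le D0 C_pos by (intro mult_left_mono) auto
  finally have 2: "\<bar>\<alpha>\<bar> \<le> D3 * x0 ^ 4 * (12 * \<Lambda>)" .
  have "Y j = ((Y j - \<alpha> * X j) / X j + \<alpha>) * X j" using p by (simp add: field_simps)
  then have "\<bar>Y j\<bar> = \<bar>(Y j - \<alpha> * X j) / X j + \<alpha>\<bar> * X j" using p by (metis abs_mult abs_of_pos)
  also have "\<dots> \<le> (100 * D1 * x0 ^ 4 * \<Lambda> + D3 * x0 ^ 4 * (12 * \<Lambda>)) * X j"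
    using 1 2 p by (intro mult_right_mono order_trans[OF abs_triangle_ineq] add_mono) auto
  finally show ?thesis unfolding x0_pow4[symmetric] \<Lambda>_def by (simp add: algebra_simps)
qed

end

section \<open>Perturbation of simple eigenvalues\<close>

text \<open>Shooting solution: the zeros in \<mu> of its value at n + 1 are the eigenvalues. The
  start value 1 is admissible because an eigenvector has a nonzero first coordinate.\<close>

fun jacobi_solution :: "(nat \<Rightarrow> real) \<Rightarrow> (nat \<Rightarrow> real) \<Rightarrow> real \<Rightarrow> nat \<Rightarrow> real" where
  "jacobi_solution \<alpha> \<beta> \<mu> 0 = 0"
| "jacobi_solution \<alpha> \<beta> \<mu> (Suc 0) = 1"
| "jacobi_solution \<alpha> \<beta> \<mu> (Suc (Suc j)) =
     ((\<mu> - \<alpha> (Suc j)) * jacobi_solution \<alpha> \<beta> \<mu> (Suc j) - \<beta> j * jacobi_solution \<alpha> \<beta> \<mu> j) / \<beta> (Suc j)"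

lemma jacobi_solution_rec:
  assumes "1 \<le> j" "\<beta> j \<noteq> 0"
  shows "\<beta> j * jacobi_solution \<alpha> \<beta> \<mu> (Suc j)
    = (\<mu> - \<alpha> j) * jacobi_solution \<alpha> \<beta> \<mu> j - \<beta> (j - 1) * jacobi_solution \<alpha> \<beta> \<mu> (j - 1)"
  using assms by (cases j) auto

lemma jacobi_solution_unique:
  assumes "x 0 = 0"
    and rec: "\<And>j. 1 \<le> j \<Longrightarrow> j \<le> n \<Longrightarrow> \<beta> j * x (Suc j) = (\<mu> - \<alpha> j) * x j - \<beta> (j - 1) * x (j - 1)"
    and nz: "\<And>j. \<beta> j \<noteq> 0"
  shows "j \<le> Suc n \<Longrightarrow> x j = x 1 * jacobi_solution \<alpha> \<beta> \<mu> j"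
proof (induction j rule: less_induct)
  case (less j)
  show ?case
  proof (cases "j \<le> 1")
    case True
    then show ?thesis using assms(1) by (cases j) auto
  next
    case False
    then obtain i where i: "j = Suc (Suc i)" by (metis One_nat_def Suc_le_D not_less_eq_eq)
    have e1: "x i = x 1 * jacobi_solution \<alpha> \<beta> \<mu> i" by (rule less.IH) (use less.prems i in auto)
    have e2: "x (Suc i) = x 1 * jacobi_solution \<alpha> \<beta> \<mu> (Suc i)" by (rule less.IH) (use less.prems i in auto)
    have "\<beta> (Suc i) * x j = (\<mu> - \<alpha> (Suc i)) * x (Suc i) - \<beta> i * x i"
      using rec[of "Suc i"] less.prems i by simp
    then have "x j = ((\<mu> - \<alpha> (Suc i)) * x (Suc i) - \<beta> i * x i) / \<beta> (Suc i)"
      using nz[of "Suc i"] by (simp add: field_simps)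
    then show ?thesis unfolding e1 e2 i by (simp add: algebra_simps)
  qed
qed

text \<open>The matrices depend on t through the diagonal A + t u and the off-diagonal 1 + t w; since
  \<beta> t n multiplies a vanishing coordinate, its value is irrelevant as long as it is nonzero.\<close>

locale jacobi_family =
  fixes A u w :: "nat \<Rightarrow> real" and n :: nat
  assumes n1: "1 \<le> n" and w1: "\<And>j. \<bar>w j\<bar> \<le> 1"
    and fin0: "finite {\<mu>. jacobi_solution A (\<lambda>_. 1) \<mu> (Suc n) = 0}"
begin

definition "\<alpha> t j = A j + t * u j"
definition "\<beta> t j = 1 + t * w j"
definition "\<Phi> t \<mu> j = jacobi_solution (\<alpha> t) (\<beta> t) \<mu> j"
definition "R t = {\<mu>. \<Phi> t \<mu> (Suc n) = 0}"

lemma beta_pos: assumes "\<bar>t\<bar> < 1" shows "\<beta> t j > 0" "\<bar>\<beta> t j\<bar> \<le> 2"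
proof -
  have "\<bar>t * w j\<bar> \<le> \<bar>t\<bar> * 1" unfolding abs_mult using w1 by (intro mult_left_mono) auto
  then show "\<beta> t j > 0" "\<bar>\<beta> t j\<bar> \<le> 2" using assms by (auto simp: \<beta>_def)
qed

lemma Phi_0 [simp]: "\<Phi> t \<mu> 0 = 0" and Phi_1 [simp]: "\<Phi> t \<mu> (Suc 0) = 1"
  by (simp_all add: \<Phi>_def)

lemma Phi_rec:
  assumes "\<bar>t\<bar> < 1" "1 \<le> j"
  shows "\<beta> t j * \<Phi> t \<mu> (Suc j) = (\<mu> - \<alpha> t j) * \<Phi> t \<mu> j - \<beta> t (j - 1) * \<Phi> t \<mu> (j - 1)"
  unfolding \<Phi>_def using beta_pos(1)[OF assms(1), of j] by (intro jacobi_solution_rec assms) auto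

lemma R_0: "R 0 = {\<mu>. jacobi_solution A (\<lambda>_. 1) \<mu> (Suc n) = 0}"
  by (simp add: R_def \<Phi>_def \<alpha>_def[abs_def] \<beta>_def[abs_def])

lemma finite_R0: "finite (R 0)"
  using fin0 by (simp add: R_0)

lemma continuous_Phi: "continuous_on ({-1<..<1} \<times> UNIV) (\<lambda>z. \<Phi> (fst z) (snd z) j)"
proof (induction j rule: less_induct)
  case (less j)
  consider "j = 0" | "j = Suc 0" | i where "j = Suc (Suc i)" by (metis not0_implies_Suc)
  then show ?case
  proof cases
    case 3
    have nz: "1 + fst z * w (Suc i) \<noteq> 0" if "z \<in> {-1<..<1} \<times> UNIV" for z :: "real \<times> real"
    proof -
      have "\<bar>fst z\<bar> < 1" using that by auto
      then show ?thesis using beta_pos(1)[of "fst z" "Suc i"] by (simp add: \<beta>_def)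
    qed
    have "continuous_on ({-1<..<1} \<times> UNIV) (\<lambda>z. ((snd z - (A (Suc i) + fst z * u (Suc i))) * \<Phi> (fst z) (snd z) (Suc i)
      - (1 + fst z * w i) * \<Phi> (fst z) (snd z) i) / (1 + fst z * w (Suc i)))"
      by (intro continuous_intros less.IH) (use 3 nz in auto)
    then show ?thesis unfolding 3 by (simp add: \<Phi>_def \<alpha>_def \<beta>_def)
  qed auto
qed

lemma tendsto_Phi:
  assumes "\<bar>t0\<bar> < 1" "(f \<longlongrightarrow> t0) F" "(g \<longlongrightarrow> \<mu>0) F"
  shows "((\<lambda>x. \<Phi> (f x) (g x) j) \<longlongrightarrow> \<Phi> t0 \<mu>0 j) F"
proof -
  have "open ({-1<..<1 :: real} \<times> (UNIV :: real set))" by (intro open_Times) auto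
  then have "isCont (\<lambda>z. \<Phi> (fst z) (snd z) j) (t0, \<mu>0)"
    using continuous_Phi[of j] assms(1)
    by (subst (asm) continuous_on_eq_continuous_at) (auto simp: abs_less_iff)
  then have "((\<lambda>x. \<Phi> (fst (f x, g x)) (snd (f x, g x)) j) \<longlongrightarrow> \<Phi> (fst (t0, \<mu>0)) (snd (t0, \<mu>0)) j) F"
    by (rule isCont_tendsto_compose) (intro tendsto_Pair assms)
  then show ?thesis by simp
qed

text \<open>Two roots give orthogonality; one root \<mu> and a free \<nu> give the sign change at
  \<mu>.\<close>

lemma Phi_green:
  assumes "\<bar>t\<bar> < 1"
  shows "\<beta> t n * (\<Phi> t \<mu> n * \<Phi> t \<nu> (Suc n) - \<Phi> t \<mu> (Suc n) * \<Phi> t \<nu> n)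
    = (\<nu> - \<mu>) * (\<Sum>i=1..n. \<Phi> t \<mu> i * \<Phi> t \<nu> i)"
  using jacobi_green[where x="\<Phi> t \<mu>" and y="\<Phi> t \<nu>" and \<beta>="\<beta> t" and \<alpha>="\<alpha> t" and g="\<lambda>_. 0" and n=n
      and \<mu>=\<mu> and \<nu>=\<nu>] Phi_rec[OF assms]
  by (simp add: sum_distrib_left)

text \<open>The row of the largest coordinate bounds the root, uniformly in |t| < 1; this provides
  the compact interval for the localisation of roots.\<close>

lemma R_bounded:
  assumes "\<bar>t\<bar> < 1" "\<mu> \<in> R t"
  shows "\<bar>\<mu>\<bar> \<le> (\<Sum>j=1..n. \<bar>A j\<bar> + \<bar>u j\<bar>) + 4"
proof -
  define x where "x = \<Phi> t \<mu>"
  define m where "m = Max ((\<lambda>i. \<bar>x i\<bar>) ` {1..n})"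
  have fin: "finite ((\<lambda>i. \<bar>x i\<bar>) ` {1..n})" "(\<lambda>i. \<bar>x i\<bar>) ` {1..n} \<noteq> {}" using n1 by auto
  obtain i where i: "i \<in> {1..n}" "\<bar>x i\<bar> = m" using Max_in[OF fin] by (auto simp: m_def)
  have le: "\<bar>x j\<bar> \<le> m" if "1 \<le> j" "j \<le> n" for j
    unfolding m_def by (rule Max_ge) (use that fin in auto)
  have m: "m > 0" using le[of 1] n1 by (simp add: x_def)
  have le': "\<bar>x j\<bar> \<le> m" if "j \<le> Suc n" for j
    using le[of j] that assms(2) m by (cases "j = 0"; cases "j = Suc n") (auto simp: x_def R_def)
  have "(\<mu> - \<alpha> t i) * x i = \<beta> t i * x (Suc i) + \<beta> t (i - 1) * x (i - 1)"
    using Phi_rec[OF assms(1), of i \<mu>] i by (simp add: x_def)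
  then have "\<bar>\<mu> - \<alpha> t i\<bar> * m = \<bar>\<beta> t i * x (Suc i) + \<beta> t (i - 1) * x (i - 1)\<bar>"
    using i(2) by (metis abs_mult)
  also have "\<dots> \<le> 2 * m + 2 * m"
  proof (rule order_trans[OF abs_triangle_ineq], unfold abs_mult, rule add_mono)
    show "\<bar>\<beta> t i\<bar> * \<bar>x (Suc i)\<bar> \<le> 2 * m" using beta_pos(2)[OF assms(1)] le'[of "Suc i"] i by (intro mult_mono) auto
    have "\<bar>x (i - 1)\<bar> \<le> m" by (rule le') (use i in auto)
    then show "\<bar>\<beta> t (i - 1)\<bar> * \<bar>x (i - 1)\<bar> \<le> 2 * m" using beta_pos(2)[OF assms(1)] by (intro mult_mono) auto
  qed
  finally have 1: "\<bar>\<mu> - \<alpha> t i\<bar> \<le> 4" using m by simp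
  have "\<bar>\<alpha> t i\<bar> \<le> \<bar>A i\<bar> + \<bar>t\<bar> * \<bar>u i\<bar>" unfolding \<alpha>_def abs_mult[symmetric] by (rule abs_triangle_ineq)
  also have "\<dots> \<le> \<bar>A i\<bar> + 1 * \<bar>u i\<bar>" using assms(1) by (intro add_left_mono mult_right_mono) auto
  also have "\<dots> \<le> (\<Sum>j=1..n. \<bar>A j\<bar> + \<bar>u j\<bar>)"
    using member_le_sum[of i "{1..n}" "\<lambda>j. \<bar>A j\<bar> + \<bar>u j\<bar>"] i by auto
  finally show ?thesis using 1 by linarith
qed

text \<open>Two roots for the same t near the same root r have nearly parallel eigenvectors, which
  contradicts their orthogonality.\<close>

lemma locally_unique:
  "\<exists>\<eta>>0. (\<forall>\<^sub>F t in nhds 0. \<forall>\<mu> \<nu>. \<mu> \<in> R t \<longrightarrow> \<nu> \<in> R t \<longrightarrow> \<bar>\<mu> - r\<bar> < \<eta> \<longrightarrow> \<bar>\<nu> - r\<bar> < \<eta> \<longrightarrow> \<mu> = \<nu>)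
     \<and> (\<forall>\<nu>. \<bar>\<nu> - r\<bar> < \<eta> \<longrightarrow> (\<Sum>i=1..n. \<Phi> 0 r i * \<Phi> 0 \<nu> i) > 0)"
proof -
  define G where "G z = (\<Sum>i=1..n. \<Phi> (fst z) (fst (snd z)) i * \<Phi> (fst z) (snd (snd z)) i)" for z :: "real \<times> real \<times> real"
  have "(G \<longlongrightarrow> (\<Sum>i=1..n. \<Phi> 0 r i * \<Phi> 0 r i)) (nhds (0, r, r))"
  proof -
    have id: "((\<lambda>z. z) \<longlongrightarrow> (0, r, r)) (nhds (0, r, r))" by (simp add: filterlim_ident)
    show ?thesis
      unfolding G_def
      using tendsto_fst[OF id] tendsto_fst[OF tendsto_snd[OF id]] tendsto_snd[OF tendsto_snd[OF id]]
      by (intro tendsto_sum tendsto_mult tendsto_Phi) auto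
  qed
  moreover have "(\<Sum>i=1..n. \<Phi> 0 r i * \<Phi> 0 r i) > 0"
  proof -
    have "0 < \<Phi> 0 r 1 * \<Phi> 0 r 1" by simp
    also have "\<dots> \<le> (\<Sum>i=1..n. \<Phi> 0 r i * \<Phi> 0 r i)"
      by (rule member_le_sum) (use n1 in auto)
    finally show ?thesis .
  qed
  ultimately have "\<forall>\<^sub>F z in nhds (0, r, r). G z > 0" by (rule order_tendstoD(1))
  then obtain d where d: "d > 0" "\<And>z. dist z (0, r, r) < d \<Longrightarrow> G z > 0"
    by (auto simp: eventually_nhds_metric)
  \<comment> \<open>The three coordinates of (t, \<mu>, \<nu>) share the distance d; the bound 1
    keeps |t| < 1.\<close>
  define \<eta> where "\<eta> = min (d / 3) 1"
  have \<eta>: "\<eta> > 0" using d by (simp add: \<eta>_def)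
  have pos: "G (t, \<mu>, \<nu>) > 0" if "\<bar>t\<bar> < \<eta>" "\<bar>\<mu> - r\<bar> < \<eta>" "\<bar>\<nu> - r\<bar> < \<eta>" for t \<mu> \<nu>
  proof (rule d(2))
    have "dist (t, \<mu>, \<nu>) (0, r, r) \<le> \<bar>t\<bar> + (\<bar>\<mu> - r\<bar> + \<bar>\<nu> - r\<bar>)"
      unfolding dist_Pair_Pair dist_real_def
      by (rule order_trans[OF sqrt_sum_squares_le_sum], simp, simp)
         (intro add_mono order_refl order_trans[OF sqrt_sum_squares_le_sum], auto)
    then show "dist (t, \<mu>, \<nu>) (0, r, r) < d" using that by (simp add: \<eta>_def)
  qed
  have "\<forall>\<^sub>F t in nhds (0::real). \<bar>t\<bar> < \<eta>"
    using \<eta> by (auto simp: eventually_nhds_metric dist_real_def)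
  then have "\<forall>\<^sub>F t in nhds 0. \<forall>\<mu> \<nu>. \<mu> \<in> R t \<longrightarrow> \<nu> \<in> R t \<longrightarrow> \<bar>\<mu> - r\<bar> < \<eta> \<longrightarrow> \<bar>\<nu> - r\<bar> < \<eta> \<longrightarrow> \<mu> = \<nu>"
  proof eventually_elim
    case (elim t)
    show ?case
    proof (intro allI impI)
      fix \<mu> \<nu> assume *: "\<mu> \<in> R t" "\<nu> \<in> R t" "\<bar>\<mu> - r\<bar> < \<eta>" "\<bar>\<nu> - r\<bar> < \<eta>"
      have t1: "\<bar>t\<bar> < 1" using elim by (simp add: \<eta>_def)
      have "(\<nu> - \<mu>) * G (t, \<mu>, \<nu>) = 0"
        using Phi_green[OF t1, of \<mu> \<nu>] * by (simp add: G_def R_def)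
      then show "\<mu> = \<nu>" using pos[OF elim *(3,4)] by auto
    qed
  qed
  moreover have "\<forall>\<nu>. \<bar>\<nu> - r\<bar> < \<eta> \<longrightarrow> (\<Sum>i=1..n. \<Phi> 0 r i * \<Phi> 0 \<nu> i) > 0"
    using pos[of 0 r] \<eta> by (auto simp: G_def)
  ultimately show ?thesis using \<eta> by blast
qed

text \<open>By Green's identity \<Phi> 0 r n times \<Phi> 0 \<nu> (n + 1) has the sign of \<nu> - r
  near r. The opposite signs at r - d and r + d persist for small t, and the intermediate value
  theorem applies.\<close>

lemma root_near:
  assumes r: "r \<in> R 0" and "\<epsilon> > 0"
  shows "\<forall>\<^sub>F t in nhds 0. \<exists>\<mu>\<in>R t. \<bar>\<mu> - r\<bar> < \<epsilon>"
proof -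
  obtain \<eta> where \<eta>: "\<eta> > 0" "\<And>\<nu>. \<bar>\<nu> - r\<bar> < \<eta> \<Longrightarrow> (\<Sum>i=1..n. \<Phi> 0 r i * \<Phi> 0 \<nu> i) > 0"
    using locally_unique[of r] by blast
  define d where "d = min \<eta> \<epsilon> / 2"
  have d: "d > 0" "d < \<eta>" "d < \<epsilon>" using \<eta> assms by (auto simp: d_def)
  define P where "P t = \<Phi> t (r - d) (Suc n) * \<Phi> t (r + d) (Suc n)" for t
  have "P 0 < 0"
  proof -
    have b0: "\<beta> 0 n = 1" by (simp add: \<beta>_def)
    have e: "\<Phi> 0 r n * \<Phi> 0 \<nu> (Suc n) = (\<nu> - r) * (\<Sum>i=1..n. \<Phi> 0 r i * \<Phi> 0 \<nu> i)" for \<nu>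
      using Phi_green[of 0 r \<nu>] r b0 by (simp add: R_def)
    have "\<Phi> 0 r n * \<Phi> 0 (r - d) (Suc n) < 0"
      unfolding e using \<eta>(2)[of "r - d"] d by (simp add: mult_neg_pos)
    moreover have "\<Phi> 0 r n * \<Phi> 0 (r + d) (Suc n) > 0"
      unfolding e using \<eta>(2)[of "r + d"] d by simp
    ultimately show ?thesis unfolding P_def
      by (auto simp: zero_less_mult_iff mult_less_0_iff)
  qed
  moreover have "(P \<longlongrightarrow> P 0) (nhds 0)"
    unfolding P_def by (intro tendsto_mult tendsto_Phi tendsto_const) (auto simp: filterlim_ident)
  ultimately have "\<forall>\<^sub>F t in nhds 0. P t < 0" by (auto intro: order_tendstoD(2))
  moreover have "\<forall>\<^sub>F t in nhds (0::real). \<bar>t\<bar> < 1"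
    by (auto simp: eventually_nhds_metric dist_real_def intro!: exI[of _ 1])
  ultimately show ?thesis
  proof eventually_elim
    case (elim t)
    define h where "h \<mu> = \<Phi> t \<mu> (Suc n)" for \<mu>
    have cont: "isCont h \<mu>" for \<mu>
      unfolding isCont_def h_def by (intro tendsto_Phi[OF elim(2)] tendsto_const tendsto_ident_at)
    have "\<exists>\<mu>. r - d \<le> \<mu> \<and> \<mu> \<le> r + d \<and> h \<mu> = 0"
    proof (cases "h (r - d) \<le> 0")
      case True
      then have "0 \<le> h (r + d)" using elim(1) by (auto simp: P_def h_def mult_less_0_iff)
      then show ?thesis using True d cont by (intro IVT) auto
    next
      case False
      then have "h (r + d) \<le> 0" using elim(1) by (auto simp: P_def h_def mult_less_0_iff)
      then show ?thesis using False d cont by (intro IVT2) auto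
    qed
    then obtain \<mu> where "r - d \<le> \<mu>" "\<mu> \<le> r + d" "h \<mu> = 0" by blast
    then show ?case using d by (intro bexI[of _ \<mu>]) (auto simp: R_def h_def)
  qed
qed

text \<open>Off the \<epsilon>-neighbourhoods of \<open>R 0\<close>, within the compact interval
  holding all roots, there is no zero at t = 0, and the tube lemma extends this to small t. So no
  eigenvalue can enter from elsewhere and shift the index.\<close>

lemma roots_localized:
  assumes "\<epsilon> > 0"
  shows "\<forall>\<^sub>F t in nhds 0. \<forall>\<mu>\<in>R t. \<exists>r\<in>R 0. \<bar>\<mu> - r\<bar> < \<epsilon>"
proof -
  define B where "B = (\<Sum>j=1..n. \<bar>A j\<bar> + \<bar>u j\<bar>) + 4"
  define K where "K = {-B..B} - (\<Union>r\<in>R 0. {r - \<epsilon><..<r + \<epsilon>})"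
  have "compact K" unfolding K_def by (intro compact_diff compact_Icc) auto
  define V where "V = {z \<in> {-1<..<1} \<times> UNIV. \<Phi> (fst z) (snd z) (Suc n) \<noteq> 0}"
  have "open V"
  proof -
    have "open ((\<lambda>z. \<Phi> (fst z) (snd z) (Suc n)) -` (- {0}) \<inter> ({-1<..<1} \<times> UNIV))"
      using continuous_Phi[of "Suc n"] by (subst (asm) continuous_on_open_vimage) (auto intro!: open_Times)
    moreover have "(\<lambda>z. \<Phi> (fst z) (snd z) (Suc n)) -` (- {0}) \<inter> ({-1<..<1} \<times> UNIV) = V"
      by (auto simp: V_def)
    ultimately show ?thesis by simp
  qed
  have "{0 :: real} \<times> K \<subseteq> V"
  proof
    fix z assume "z \<in> {0 :: real} \<times> K"
    then obtain \<mu> where z: "z = (0, \<mu>)" "\<mu> \<in> K" by auto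
    have "\<mu> \<notin> R 0" using z assms by (auto simp: K_def)
    then show "z \<in> V" using z by (auto simp: V_def R_def)
  qed
  from tube_lemma[OF \<open>compact K\<close> \<open>open V\<close> this]
  obtain T where T: "0 \<in> T" "open T" "T \<times> K \<subseteq> V" by blast
  have "\<forall>\<^sub>F t in nhds 0. t \<in> T" using T by (auto simp: eventually_nhds)
  moreover have "\<forall>\<^sub>F t in nhds (0::real). \<bar>t\<bar> < 1"
    by (auto simp: eventually_nhds_metric dist_real_def intro!: exI[of _ 1])
  ultimately show ?thesis
  proof eventually_elim
    case (elim t)
    show ?case
    proof
      fix \<mu> assume \<mu>: "\<mu> \<in> R t"
      have "\<mu> \<notin> K" using \<mu> T(3) elim by (auto simp: V_def R_def)
      moreover have "\<mu> \<in> {-B..B}" using R_bounded[OF elim(2) \<mu>] by (auto simp: B_def)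
      ultimately show "\<exists>r\<in>R 0. \<bar>\<mu> - r\<bar> < \<epsilon>" by (force simp: K_def abs_less_iff)
    qed
  qed
qed

section \<open>Eigenvalue branches and their index\<close>

lemma root_separation: "\<exists>\<eta>>0. \<forall>r\<in>R 0. \<forall>s\<in>R 0. r < s \<longrightarrow> r + 2 * \<eta> \<le> s"
proof -
  define D where "D = insert 1 ((\<lambda>(r, s). s - r) ` {(r, s) \<in> R 0 \<times> R 0. r < s})"
  have fin: "finite D" unfolding D_def
    by (intro finite.insertI finite_imageI finite_subset[OF _ finite_cartesian_product[OF finite_R0 finite_R0]]) auto
  have "Min D \<in> D" by (rule Min_in[OF fin]) (auto simp: D_def)
  then have "Min D > 0" by (auto simp: D_def)
  moreover have "r + 2 * (Min D / 2) \<le> s" if "r \<in> R 0" "s \<in> R 0" "r < s" for r s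
  proof -
    have "s - r \<in> D" using that by (force simp: D_def)
    then show ?thesis using Min_le[OF fin] by force
  qed
  ultimately show ?thesis by (intro exI[of _ "Min D / 2"]) auto
qed

lemma locally_unique_uniform:
  "\<exists>\<eta>>0. (\<forall>r\<in>R 0. \<forall>s\<in>R 0. r < s \<longrightarrow> r + 2 * \<eta> \<le> s) \<and>
    (\<forall>\<^sub>F t in nhds 0. \<forall>r\<in>R 0. \<forall>\<mu> \<nu>. \<mu> \<in> R t \<longrightarrow> \<nu> \<in> R t \<longrightarrow> \<bar>\<mu> - r\<bar> < \<eta> \<longrightarrow> \<bar>\<nu> - r\<bar> < \<eta> \<longrightarrow> \<mu> = \<nu>)"
proof -
  obtain \<eta>0 where \<eta>0: "\<eta>0 > 0" "\<And>r s. r \<in> R 0 \<Longrightarrow> s \<in> R 0 \<Longrightarrow> r < s \<Longrightarrow> r + 2 * \<eta>0 \<le> s"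
    using root_separation by blast
  have "\<forall>r. \<exists>\<eta>>0. \<forall>\<^sub>F t in nhds 0. \<forall>\<mu> \<nu>. \<mu> \<in> R t \<longrightarrow> \<nu> \<in> R t \<longrightarrow> \<bar>\<mu> - r\<bar> < \<eta> \<longrightarrow> \<bar>\<nu> - r\<bar> < \<eta> \<longrightarrow> \<mu> = \<nu>"
    using locally_unique by blast
  from choice[OF this] obtain h where h: "\<And>r. h r > 0"
    "\<And>r. \<forall>\<^sub>F t in nhds 0. \<forall>\<mu> \<nu>. \<mu> \<in> R t \<longrightarrow> \<nu> \<in> R t \<longrightarrow> \<bar>\<mu> - r\<bar> < h r \<longrightarrow> \<bar>\<nu> - r\<bar> < h r \<longrightarrow> \<mu> = \<nu>"
    by auto
  define \<eta> where "\<eta> = Min (insert \<eta>0 (h ` R 0))"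
  have fin: "finite (insert \<eta>0 (h ` R 0))" using finite_R0 by simp
  have pos: "\<eta> > 0" unfolding \<eta>_def using \<eta>0 h by (subst Min_gr_iff[OF fin]) auto
  have le: "\<eta> \<le> \<eta>0" "\<And>r. r \<in> R 0 \<Longrightarrow> \<eta> \<le> h r" unfolding \<eta>_def by (auto intro!: Min_le fin)
  have "\<forall>\<^sub>F t in nhds 0. \<forall>r\<in>R 0. \<forall>\<mu> \<nu>. \<mu> \<in> R t \<longrightarrow> \<nu> \<in> R t \<longrightarrow> \<bar>\<mu> - r\<bar> < \<eta> \<longrightarrow> \<bar>\<nu> - r\<bar> < \<eta> \<longrightarrow> \<mu> = \<nu>"
  proof (intro eventually_ball_finite[OF finite_R0] ballI)
    fix r assume r: "r \<in> R 0"
    show "\<forall>\<^sub>F t in nhds 0. \<forall>\<mu> \<nu>. \<mu> \<in> R t \<longrightarrow> \<nu> \<in> R t \<longrightarrow> \<bar>\<mu> - r\<bar> < \<eta> \<longrightarrow> \<bar>\<nu> - r\<bar> < \<eta> \<longrightarrow> \<mu> = \<nu>"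
      using h(2)[of r] by eventually_elim (use le(2)[OF r] in force)
  qed
  moreover have "r + 2 * \<eta> \<le> s" if "r \<in> R 0" "s \<in> R 0" "r < s" for r s
    using \<eta>0(2)[OF that] le(1) by linarith
  ultimately show ?thesis using pos by blast
qed

text \<open>One radius for all roots and all small t, so that each branch becomes a function of t;
  the margin 2 * sep keeps the branches in order.\<close>

definition "sep = (SOME \<eta>. \<eta> > 0 \<and> (\<forall>r\<in>R 0. \<forall>s\<in>R 0. r < s \<longrightarrow> r + 2 * \<eta> \<le> s) \<and>
    (\<forall>\<^sub>F t in nhds 0. \<forall>r\<in>R 0. \<forall>\<mu> \<nu>. \<mu> \<in> R t \<longrightarrow> \<nu> \<in> R t \<longrightarrow> \<bar>\<mu> - r\<bar> < \<eta> \<longrightarrow> \<bar>\<nu> - r\<bar> < \<eta> \<longrightarrow> \<mu> = \<nu>))"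

lemma sep: "sep > 0" "\<And>r s. r \<in> R 0 \<Longrightarrow> s \<in> R 0 \<Longrightarrow> r < s \<Longrightarrow> r + 2 * sep \<le> s"
  "\<forall>\<^sub>F t in nhds 0. \<forall>r\<in>R 0. \<forall>\<mu> \<nu>. \<mu> \<in> R t \<longrightarrow> \<nu> \<in> R t \<longrightarrow> \<bar>\<mu> - r\<bar> < sep \<longrightarrow> \<bar>\<nu> - r\<bar> < sep \<longrightarrow> \<mu> = \<nu>"
  using someI_ex[OF locally_unique_uniform] unfolding sep_def[symmetric] by blast+

definition "eigval t r = (THE \<mu>. \<mu> \<in> R t \<and> \<bar>\<mu> - r\<bar> < sep)"

definition "good t \<longleftrightarrow> \<bar>t\<bar> < 1 \<and> (\<forall>r\<in>R 0. eigval t r \<in> R t \<and> \<bar>eigval t r - r\<bar> < sep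
    \<and> (\<forall>\<mu>\<in>R t. \<bar>\<mu> - r\<bar> < sep \<longrightarrow> \<mu> = eigval t r)) \<and> (\<forall>\<mu>\<in>R t. \<exists>r\<in>R 0. \<bar>\<mu> - r\<bar> < sep)"

lemma eventually_good: "\<forall>\<^sub>F t in nhds 0. good t"
proof -
  have 1: "\<forall>\<^sub>F t in nhds 0. \<forall>r\<in>R 0. \<exists>\<mu>\<in>R t. \<bar>\<mu> - r\<bar> < sep"
    by (intro eventually_ball_finite[OF finite_R0] ballI root_near sep)
  have 2: "\<forall>\<^sub>F t in nhds (0::real). \<bar>t\<bar> < 1"
    by (auto simp: eventually_nhds_metric dist_real_def intro!: exI[of _ 1])
  show ?thesis
    using 1 2 sep(3) roots_localized[OF sep(1)]
  proof eventually_elim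
    case (elim t)
    have "eigval t r \<in> R t \<and> \<bar>eigval t r - r\<bar> < sep" if "r \<in> R 0" for r
    proof -
      have "\<exists>!\<mu>. \<mu> \<in> R t \<and> \<bar>\<mu> - r\<bar> < sep" using elim(1,3) that by blast
      then show ?thesis unfolding eigval_def by (rule theI')
    qed
    then show ?case using elim unfolding good_def by blast
  qed
qed

lemma good_0: "good 0"
  using eventually_good by (rule eventually_nhds_x_imp_x)

lemma eigval_0: "r \<in> R 0 \<Longrightarrow> eigval 0 r = r"
  using good_0 sep(1) unfolding good_def by auto

text \<open>The intervals of radius \<open>sep\<close> are disjoint and ordered; for good t each
  holds exactly one root and together they hold all of them.\<close>

lemma card_below_eigval:
  assumes g: "good t" and s: "s \<in> R 0"
  shows "card {\<nu>. \<nu> \<in> R t \<and> \<nu> < eigval t s} = card {r. r \<in> R 0 \<and> r < s}"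
proof -
  have less: "eigval t r < eigval t s'" if "r \<in> R 0" "s' \<in> R 0" "r < s'" for r s'
  proof -
    have "\<bar>eigval t r - r\<bar> < sep" "\<bar>eigval t s' - s'\<bar> < sep" using g that unfolding good_def by auto
    then show ?thesis using sep(2)[OF that] by linarith
  qed
  have "bij_betw (eigval t) {r. r \<in> R 0 \<and> r < s} {\<nu>. \<nu> \<in> R t \<and> \<nu> < eigval t s}"
    unfolding bij_betw_def
  proof
    show "inj_on (eigval t) {r. r \<in> R 0 \<and> r < s}"
    proof (rule inj_onI)
      fix x y assume "x \<in> {r. r \<in> R 0 \<and> r < s}" "y \<in> {r. r \<in> R 0 \<and> r < s}" "eigval t x = eigval t y"
      then show "x = y" using less[of x y] less[of y x] by (cases x y rule: linorder_cases) auto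
    qed
    show "eigval t ` {r. r \<in> R 0 \<and> r < s} = {\<nu>. \<nu> \<in> R t \<and> \<nu> < eigval t s}"
    proof
      show "eigval t ` {r. r \<in> R 0 \<and> r < s} \<subseteq> {\<nu>. \<nu> \<in> R t \<and> \<nu> < eigval t s}"
        using g s less unfolding good_def by auto
      show "{\<nu>. \<nu> \<in> R t \<and> \<nu> < eigval t s} \<subseteq> eigval t ` {r. r \<in> R 0 \<and> r < s}"
      proof
        fix \<nu> assume \<nu>: "\<nu> \<in> {\<nu>. \<nu> \<in> R t \<and> \<nu> < eigval t s}"
        then obtain r where r: "r \<in> R 0" "\<nu> = eigval t r" using g unfolding good_def by blast
        have "\<not> s \<le> r" using less[OF s r(1)] \<nu> r by (cases "s = r") auto
        then show "\<nu> \<in> eigval t ` {r. r \<in> R 0 \<and> r < s}" using r by auto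
      qed
    qed
  qed
  then show ?thesis by (rule bij_betw_same_card[THEN sym])
qed

text \<open>Identifies the eigenvalue selected by counting with the continuous branch.\<close>

lemma eigval_by_index:
  assumes g: "good t" and s: "s \<in> R 0" and \<mu>: "\<mu> \<in> R t"
    and c: "card {\<nu>. \<nu> \<in> R t \<and> \<nu> < \<mu>} = card {r. r \<in> R 0 \<and> r < s}"
  shows "\<mu> = eigval t s"
proof -
  obtain r where r: "r \<in> R 0" "\<mu> = eigval t r" using g \<mu> unfolding good_def by blast
  have e: "card {x. x \<in> R 0 \<and> x < r} = card {x. x \<in> R 0 \<and> x < s}"
    using card_below_eigval[OF g r(1)] c r by simp
  have *: "card {x. x \<in> R 0 \<and> x < y} < card {x. x \<in> R 0 \<and> x < z}" if "y \<in> R 0" "z \<in> R 0" "y < z" for y z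
    using that finite_R0 by (intro psubset_card_mono) (auto intro: finite_subset)
  show ?thesis using *[OF r(1) s] *[OF s r(1)] e r(2) by (cases r s rule: linorder_cases) auto
qed

lemma tendsto_eigval:
  assumes r: "r \<in> R 0"
  shows "((\<lambda>t. eigval t r) \<longlongrightarrow> r) (nhds 0)"
proof (rule tendstoI)
  fix e :: real assume "e > 0"
  then have "\<forall>\<^sub>F t in nhds 0. \<exists>\<mu>\<in>R t. \<bar>\<mu> - r\<bar> < min e sep" using sep(1) by (intro root_near r) auto
  then show "\<forall>\<^sub>F t in nhds 0. dist (eigval t r) r < e"
    using eventually_good
  proof eventually_elim
    case (elim t)
    then obtain \<mu> where "\<mu> \<in> R t" "\<bar>\<mu> - r\<bar> < e" "\<bar>\<mu> - r\<bar> < sep" by auto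
    then show ?case using elim(2) r unfolding good_def dist_real_def by auto
  qed
qed

text \<open>The difference quotient of the eigenvalue is a quotient of scalar products of the eigenvectors
  at 0 and t, so continuity of the eigenvector suffices.\<close>

lemma eigval_derivative:
  assumes r: "r \<in> R 0"
  shows "\<exists>D. ((\<lambda>t. eigval t r) has_real_derivative D) (at 0)"
proof -
  define Q where "Q t = (\<Sum>i=1..n. \<Phi> 0 r i * (u i * \<Phi> t (eigval t r) i + w i * \<Phi> t (eigval t r) (Suc i)
     + w (i - 1) * \<Phi> t (eigval t r) (i - 1)))" for t
  define N where "N t = (\<Sum>i=1..n. \<Phi> 0 r i * \<Phi> t (eigval t r) i)" for t
  have eigval0: "((\<lambda>t. eigval t r) \<longlongrightarrow> r) (at 0)"
    using tendsto_eigval[OF r] by (rule tendsto_mono[rotated]) (simp add: at_within_def)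
  have PhiT: "((\<lambda>t. \<Phi> t (eigval t r) i) \<longlongrightarrow> \<Phi> 0 r i) (at 0)" for i
    by (intro tendsto_Phi eigval0 tendsto_ident_at) auto
  have r0: "eigval 0 r = r" by (rule eigval_0[OF r])
  have Q: "(Q \<longlongrightarrow> Q 0) (at 0)" unfolding Q_def r0 by (intro tendsto_intros PhiT)
  have N: "(N \<longlongrightarrow> N 0) (at 0)" unfolding N_def r0 by (intro tendsto_intros PhiT)
  have N0: "N 0 > 0"
  proof -
    have "0 < \<Phi> 0 r 1 * \<Phi> 0 r 1" by simp
    also have "\<dots> \<le> N 0" unfolding N_def r0 by (rule member_le_sum) (use n1 in auto)
    finally show ?thesis .
  qed
  have "\<forall>\<^sub>F t in at 0. N t > 0" using order_tendstoD(1)[OF N N0] .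
  moreover have "\<forall>\<^sub>F t in at 0. good t" using eventually_good by (auto simp: eventually_at_filter elim: eventually_mono)
  moreover have "\<forall>\<^sub>F t in at (0::real). t \<noteq> 0" by (simp add: eventually_at_filter)
  ultimately have "\<forall>\<^sub>F t in at 0. Q t / N t = (eigval (0 + t) r - eigval 0 r) / t"
  proof eventually_elim
    case (elim t)
    have t: "\<bar>t\<bar> < 1" and rt: "eigval t r \<in> R t" using elim(2) r unfolding good_def by auto
    \<comment> \<open>The recurrence at t is rewritten with the coefficients at 0; the perturbation
      moves into the right-hand side.\<close>
    define g where "g j = - t * (u j * \<Phi> t (eigval t r) j + w j * \<Phi> t (eigval t r) (Suc j)
        + w (j - 1) * \<Phi> t (eigval t r) (j - 1))" for j
    have b1: "\<beta> 0 j = 1" for j by (simp add: \<beta>_def)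
    have green: "\<beta> 0 n * (\<Phi> 0 r n * \<Phi> t (eigval t r) (Suc n) - \<Phi> 0 r (Suc n) * \<Phi> t (eigval t r) n)
       = (\<Sum>i=1..n. (eigval t r - r) * (\<Phi> 0 r i * \<Phi> t (eigval t r) i) + \<Phi> 0 r i * g i)"
    proof (rule jacobi_green[where \<alpha>="\<alpha> 0"])
      fix j assume j: "1 \<le> j" "j \<le> n"
      show "\<beta> 0 j * \<Phi> 0 r (Suc j) = (r - \<alpha> 0 j) * \<Phi> 0 r j - \<beta> 0 (j - 1) * \<Phi> 0 r (j - 1)"
        by (rule Phi_rec) (use j in auto)
      show "\<beta> 0 j * \<Phi> t (eigval t r) (Suc j)
        = (eigval t r - \<alpha> 0 j) * \<Phi> t (eigval t r) j - \<beta> 0 (j - 1) * \<Phi> t (eigval t r) (j - 1) + g j"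
        using Phi_rec[OF t j(1), of "eigval t r"] by (simp add: g_def \<alpha>_def \<beta>_def algebra_simps)
    qed auto
    have "\<beta> 0 n * (\<Phi> 0 r n * \<Phi> t (eigval t r) (Suc n) - \<Phi> 0 r (Suc n) * \<Phi> t (eigval t r) n) = 0"
      using rt r by (simp add: R_def)
    moreover have "(\<Sum>i=1..n. (eigval t r - r) * (\<Phi> 0 r i * \<Phi> t (eigval t r) i) + \<Phi> 0 r i * g i)
        = (eigval t r - r) * N t - t * Q t"
      unfolding N_def Q_def g_def sum_distrib_left sum_subtractf[symmetric]
      by (rule sum.cong) (auto simp: algebra_simps)
    ultimately have "(eigval t r - r) * N t = t * Q t" using green by linarith
    then show ?case using elim r0 by (simp add: field_simps)
  qed
  moreover have "((\<lambda>t. Q t / N t) \<longlongrightarrow> Q 0 / N 0) (at 0)"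
    by (rule tendsto_divide[OF Q N]) (use N0 in auto)
  ultimately have "((\<lambda>t. (eigval (0 + t) r - eigval 0 r) / t) \<longlongrightarrow> Q 0 / N 0) (at 0)"
    by (rule Lim_transform_eventually[rotated])
  then show ?thesis unfolding DERIV_def by blast
qed

section \<open>Derivative of the normalised eigenvector\<close>

definition "nrm t r = sqrt (\<Sum>i=1..n. (\<Phi> t (eigval t r) i)\<^sup>2)"

definition "evec t r j = \<Phi> t (eigval t r) j / nrm t r"

lemma nrm_sq_pos: "(\<Sum>i=1..n. (\<Phi> t \<mu> i)\<^sup>2) > 0"
proof -
  have "0 < (\<Phi> t \<mu> 1)\<^sup>2" by simp
  also have "\<dots> \<le> (\<Sum>i=1..n. (\<Phi> t \<mu> i)\<^sup>2)" by (rule member_le_sum) (use n1 in auto)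
  finally show ?thesis .
qed

lemma nrm_pos: "nrm t r > 0"
  using nrm_sq_pos by (simp add: nrm_def)

lemma evec_norm: "(\<Sum>j=1..n. (evec t r j)\<^sup>2) = 1"
proof -
  have "(\<Sum>j=1..n. (evec t r j)\<^sup>2) = (\<Sum>j=1..n. (\<Phi> t (eigval t r) j)\<^sup>2) / (nrm t r)\<^sup>2"
    by (simp add: evec_def power_divide sum_divide_distrib)
  also have "(nrm t r)\<^sup>2 = (\<Sum>j=1..n. (\<Phi> t (eigval t r) j)\<^sup>2)"
    using nrm_sq_pos[of t "eigval t r"] by (simp add: nrm_def)
  finally show ?thesis using nrm_sq_pos[of t "eigval t r"] by simp
qed

lemma evec_rec:
  assumes "\<bar>t\<bar> < 1" "1 \<le> j"
  shows "\<beta> t j * evec t r (Suc j) = (eigval t r - \<alpha> t j) * evec t r j - \<beta> t (j - 1) * evec t r (j - 1)"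
  using arg_cong[OF Phi_rec[OF assms, of "eigval t r"], of "\<lambda>x. x / nrm t r"]
  by (simp add: evec_def diff_divide_distrib)

lemma evec_differentiable:
  assumes r: "r \<in> R 0"
  shows "(\<lambda>t. evec t r j) differentiable (at 0)"
proof -
  have eigval_d: "(\<lambda>t. eigval t r) differentiable (at 0)"
    using eigval_derivative[OF r] unfolding real_differentiable_def .
  have Phi_d: "(\<lambda>t. \<Phi> t (eigval t r) j) differentiable (at 0)" for j
  proof (induction j rule: less_induct)
    case (less j)
    consider "j = 0" | "j = Suc 0" | i where "j = Suc (Suc i)" by (metis not0_implies_Suc)
    then show ?case
    proof cases
      case 3
      have "(\<lambda>t. ((eigval t r - (A (Suc i) + t * u (Suc i))) * \<Phi> t (eigval t r) (Suc i)
        - (1 + t * w i) * \<Phi> t (eigval t r) i) / (1 + t * w (Suc i))) differentiable (at 0)"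
        by (intro derivative_intros less.IH eigval_d) (use 3 in auto)
      then show ?thesis unfolding 3 by (simp add: \<Phi>_def \<alpha>_def \<beta>_def)
    qed auto
  qed
  have "\<exists>D. ((\<lambda>t. \<Sum>i=1..n. (\<Phi> t (eigval t r) i)\<^sup>2) has_real_derivative D) (at 0)"
    unfolding real_differentiable_def[symmetric]
    by (intro differentiable_sum differentiable_power Phi_d ballI) auto
  then obtain D where D: "((\<lambda>t. \<Sum>i=1..n. (\<Phi> t (eigval t r) i)\<^sup>2) has_real_derivative D) (at 0)" by blast
  have "((\<lambda>t. nrm t r) has_real_derivative (inverse (sqrt (\<Sum>i=1..n. (\<Phi> 0 (eigval 0 r) i)\<^sup>2)) / 2) * D) (at 0)"
    unfolding nrm_def by (rule DERIV_chain2[OF DERIV_real_sqrt D]) (rule nrm_sq_pos)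
  then have "(\<lambda>t. nrm t r) differentiable (at 0)" by (auto simp: real_differentiable_def)
  then show ?thesis unfolding evec_def
    by (intro differentiable_divide Phi_d) (use nrm_pos[of 0 r] in auto)
qed

text \<open>Differentiates the recurrence, the two boundary values and the unit norm at t = 0; the
  last gives the orthogonality, and D is the derivative of the eigenvalue.\<close>

lemma evec_linearization:
  assumes r: "r \<in> R 0"
  obtains Y D where "\<And>j. ((\<lambda>t. evec t r j) has_real_derivative Y j) (at 0)"
    and "Y 0 = 0" "Y (Suc n) = 0"
    and "\<And>j. 1 \<le> j \<Longrightarrow> j \<le> n \<Longrightarrow> Y (Suc j) = (r - A j) * Y j - Y (j - 1)
      + (D * evec 0 r j - (u j * evec 0 r j + w j * evec 0 r (Suc j) + w (j - 1) * evec 0 r (j - 1)))"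
    and "(\<Sum>j=1..n. evec 0 r j * Y j) = 0"
proof -
  have "\<forall>j. \<exists>D. ((\<lambda>t. evec t r j) has_real_derivative D) (at 0)"
    using evec_differentiable[OF r] unfolding real_differentiable_def by blast
  from choice[OF this] obtain Y where Y: "\<And>j. ((\<lambda>t. evec t r j) has_real_derivative Y j) (at 0)" by auto
  obtain D where D: "((\<lambda>t. eigval t r) has_real_derivative D) (at 0)" using eigval_derivative[OF r] by blast
  have t1: "\<forall>\<^sub>F t in nhds (0::real). \<bar>t\<bar> < 1"
    by (auto simp: eventually_nhds_metric dist_real_def intro!: exI[of _ 1])
  show ?thesis
  proof (rule that[of Y D])
    show "((\<lambda>t. evec t r j) has_real_derivative Y j) (at 0)" for j by (rule Y)
    have "((\<lambda>t. evec t r 0) has_real_derivative 0) (at 0)" by (simp add: evec_def)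
    then show "Y 0 = 0" by (rule DERIV_unique[OF Y])
    have ev: "\<forall>\<^sub>F t in nhds 0. evec t r (Suc n) = 0"
      using eventually_good by eventually_elim (use r in \<open>auto simp: good_def R_def evec_def\<close>)
    have "((\<lambda>t. evec t r (Suc n)) has_real_derivative 0) (at 0)"
      using DERIV_cong_ev[OF refl ev refl, of 0] by simp
    then show "Y (Suc n) = 0" by (rule DERIV_unique[OF Y])
    show "Y (Suc j) = (r - A j) * Y j - Y (j - 1)
      + (D * evec 0 r j - (u j * evec 0 r j + w j * evec 0 r (Suc j) + w (j - 1) * evec 0 r (j - 1)))"
      if j: "1 \<le> j" "j \<le> n" for j
    proof -
      have ev: "\<forall>\<^sub>F t in nhds 0. (1 + t * w j) * evec t r (Suc j)
          = (eigval t r - (A j + t * u j)) * evec t r j - (1 + t * w (j - 1)) * evec t r (j - 1)"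
        using t1
      proof eventually_elim
        case (elim t)
        show ?case using evec_rec[OF elim j(1), of r] unfolding \<alpha>_def \<beta>_def .
      qed
      have "((\<lambda>t. (1 + t * w j) * evec t r (Suc j)) has_real_derivative w j * evec 0 r (Suc j) + Y (Suc j)) (at 0)"
        by (rule derivative_eq_intros Y refl | simp)+
      moreover have "((\<lambda>t. (eigval t r - (A j + t * u j)) * evec t r j - (1 + t * w (j - 1)) * evec t r (j - 1))
         has_real_derivative (D - u j) * evec 0 r j + (r - A j) * Y j - (w (j - 1) * evec 0 r (j - 1) + Y (j - 1))) (at 0)"
        by (rule derivative_eq_intros Y D refl | simp add: eigval_0[OF r])+
      ultimately have "w j * evec 0 r (Suc j) + Y (Suc j)
          = (D - u j) * evec 0 r j + (r - A j) * Y j - (w (j - 1) * evec 0 r (j - 1) + Y (j - 1))"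
        by (intro DERIV_unique[OF iffD1[OF DERIV_cong_ev[OF refl ev refl]]])
      then show ?thesis by (simp add: algebra_simps)
    qed
    have "((\<lambda>t. \<Sum>j=1..n. (evec t r j)\<^sup>2) has_real_derivative (\<Sum>j=1..n. 2 * (evec 0 r j * Y j))) (at 0)"
      by (rule derivative_eq_intros Y refl | simp add: mult.commute)+
    moreover have "((\<lambda>t. \<Sum>j=1..n. (evec t r j)\<^sup>2) has_real_derivative 0) (at 0)"
      unfolding evec_norm by simp
    ultimately have "(\<Sum>j=1..n. 2 * (evec 0 r j * Y j)) = 0" by (rule DERIV_unique)
    then show "(\<Sum>j=1..n. evec 0 r j * Y j) = 0" by (simp add: sum_distrib_left[symmetric])
  qed
qed

end

section \<open>Tridiagonal matrices\<close>

definition jacobi_mat :: "(nat \<Rightarrow> real) \<Rightarrow> (nat \<Rightarrow> real) \<Rightarrow> nat \<Rightarrow> real mat" where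
  "jacobi_mat \<alpha> \<beta> n = mat n n (\<lambda>(i, j). if i = j then \<alpha> (Suc i) else if j = Suc i then \<beta> (Suc i)
     else if i = Suc j then \<beta> (Suc j) else 0)"

text \<open>1-based coordinates, extended by 0, so that the boundary rows obey the same recurrence.\<close>

definition coord :: "nat \<Rightarrow> real vec \<Rightarrow> nat \<Rightarrow> real" where
  "coord n v j = (if 1 \<le> j \<and> j \<le> n then v $ (j - 1) else 0)"

lemma jacobi_mat_dim [simp]: "dim_row (jacobi_mat \<alpha> \<beta> n) = n" "dim_col (jacobi_mat \<alpha> \<beta> n) = n"
  "jacobi_mat \<alpha> \<beta> n \<in> carrier_mat n n"
  by (auto simp: jacobi_mat_def)

lemma jacobi_mat_mult:
  assumes i: "i < n" and v: "v \<in> carrier_vec n"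
  shows "(jacobi_mat \<alpha> \<beta> n *\<^sub>v v) $ i
    = \<alpha> (Suc i) * coord n v (Suc i) + \<beta> (Suc i) * coord n v (Suc (Suc i)) + \<beta> i * coord n v i"
proof -
  have "(jacobi_mat \<alpha> \<beta> n *\<^sub>v v) $ i = (\<Sum>j\<in>{0..<n}. jacobi_mat \<alpha> \<beta> n $$ (i, j) * v $ j)"
    using i v by (simp add: scalar_prod_def)
  \<comment> \<open>Truncated subtraction makes i - 1 equal to 0 at i = 0, hence the inner
    test.\<close>
  also have "\<dots> = (\<Sum>j\<in>{0..<n}. (if j = i then \<alpha> (Suc i) * v $ i else 0)
      + (if j = Suc i then \<beta> (Suc i) * v $ Suc i else 0) + (if j = i - 1 then (if i = 0 then 0 else \<beta> i * v $ (i - 1)) else 0))"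
    by (rule sum.cong) (use i in \<open>auto simp: jacobi_mat_def\<close>)
  also have "\<dots> = \<alpha> (Suc i) * coord n v (Suc i) + \<beta> (Suc i) * coord n v (Suc (Suc i)) + \<beta> i * coord n v i"
  proof -
    have "(\<Sum>j\<in>{0..<n}. if j = i then \<alpha> (Suc i) * v $ i else 0) = \<alpha> (Suc i) * coord n v (Suc i)"
      using i by (simp add: coord_def)
    moreover have "(\<Sum>j\<in>{0..<n}. if j = Suc i then \<beta> (Suc i) * v $ Suc i else 0) = \<beta> (Suc i) * coord n v (Suc (Suc i))"
      using i by (simp add: coord_def)
    moreover have "(\<Sum>j\<in>{0..<n}. if j = i - 1 then (if i = 0 then 0 else \<beta> i * v $ (i - 1)) else 0) = \<beta> i * coord n v i"
      using i by (auto simp: coord_def)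
    ultimately show ?thesis by (simp only: sum.distrib)
  qed
  finally show ?thesis .
qed

lemma eigenvector_jacobi_mat:
  "eigenvector (jacobi_mat \<alpha> \<beta> n) v \<mu> \<longleftrightarrow> v \<in> carrier_vec n \<and> v \<noteq> 0\<^sub>v n \<and>
    (\<forall>j. 1 \<le> j \<longrightarrow> j \<le> n \<longrightarrow>
      \<beta> j * coord n v (Suc j) = (\<mu> - \<alpha> j) * coord n v j - \<beta> (j - 1) * coord n v (j - 1))"
proof (cases "v \<in> carrier_vec n")
  case True
  have "jacobi_mat \<alpha> \<beta> n *\<^sub>v v = \<mu> \<cdot>\<^sub>v v \<longleftrightarrow> (\<forall>i<n. (jacobi_mat \<alpha> \<beta> n *\<^sub>v v) $ i = (\<mu> \<cdot>\<^sub>v v) $ i)"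
    using True by (auto simp: vec_eq_iff)
  also have "\<dots> \<longleftrightarrow> (\<forall>i<n. \<alpha> (Suc i) * coord n v (Suc i) + \<beta> (Suc i) * coord n v (Suc (Suc i)) + \<beta> i * coord n v i
      = \<mu> * coord n v (Suc i))"
    using True by (auto simp: jacobi_mat_mult coord_def simp del: index_mult_mat_vec)
  also have "\<dots> \<longleftrightarrow> (\<forall>i<n. \<beta> (Suc i) * coord n v (Suc (Suc i)) = (\<mu> - \<alpha> (Suc i)) * coord n v (Suc i) - \<beta> i * coord n v i)"
    by (auto simp: algebra_simps)
  also have "\<dots> \<longleftrightarrow> (\<forall>j. 1 \<le> j \<longrightarrow> j \<le> n \<longrightarrow>
      \<beta> j * coord n v (Suc j) = (\<mu> - \<alpha> j) * coord n v j - \<beta> (j - 1) * coord n v (j - 1))"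
  proof safe
    fix j assume *: "\<forall>i<n. \<beta> (Suc i) * coord n v (Suc (Suc i)) = (\<mu> - \<alpha> (Suc i)) * coord n v (Suc i) - \<beta> i * coord n v i"
      and j: "1 \<le> j" "j \<le> n"
    show "\<beta> j * coord n v (Suc j) = (\<mu> - \<alpha> j) * coord n v j - \<beta> (j - 1) * coord n v (j - 1)"
      using *[rule_format, of "j - 1"] j by simp
  next
    fix i assume *: "\<forall>j. 1 \<le> j \<longrightarrow> j \<le> n \<longrightarrow>
      \<beta> j * coord n v (Suc j) = (\<mu> - \<alpha> j) * coord n v j - \<beta> (j - 1) * coord n v (j - 1)" and i: "i < n"
    show "\<beta> (Suc i) * coord n v (Suc (Suc i)) = (\<mu> - \<alpha> (Suc i)) * coord n v (Suc i) - \<beta> i * coord n v i"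
      using *[rule_format, of "Suc i"] i by simp
  qed
  finally show ?thesis using True by (simp add: eigenvector_def)
qed (simp add: eigenvector_def)

lemma coord_vec: "coord n (vec n (\<lambda>i. g (Suc i))) j = (if 1 \<le> j \<and> j \<le> n then g j else 0)"
  by (auto simp: coord_def)

lemma norm_coord: "v \<in> carrier_vec n \<Longrightarrow> v \<bullet> v = (\<Sum>j=1..n. (coord n v j)\<^sup>2)"
  unfolding scalar_prod_def
  by (rule sum.reindex_bij_witness[where i="\<lambda>j. j - 1" and j=Suc]) (auto simp: coord_def power2_eq_square)

lemma coord_0_Suc [simp]: "coord n v 0 = 0" "coord n v (Suc n) = 0"
  by (auto simp: coord_def)

lemma eigenvector_coord:
  assumes ev: "eigenvector (jacobi_mat \<alpha> \<beta> n) v \<mu>" and nz: "\<And>j. \<beta> j \<noteq> 0"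
  shows "j \<le> Suc n \<Longrightarrow> coord n v j = coord n v 1 * jacobi_solution \<alpha> \<beta> \<mu> j"
    and "coord n v 1 \<noteq> 0" and "jacobi_solution \<alpha> \<beta> \<mu> (Suc n) = 0"
proof -
  show *: "coord n v j = coord n v 1 * jacobi_solution \<alpha> \<beta> \<mu> j" if "j \<le> Suc n" for j
    by (rule jacobi_solution_unique[where \<beta>=\<beta> and n=n]) (use ev that nz in \<open>auto simp: eigenvector_jacobi_mat\<close>)
  show 1: "coord n v 1 \<noteq> 0"
  proof
    assume "coord n v 1 = 0"
    then have "coord n v (Suc i) = 0" if "i < n" for i using *[of "Suc i"] that by simp
    then have "v $ i = 0" if "i < n" for i using that by (force simp: coord_def)
    then have "v = 0\<^sub>v n" using ev by (auto simp: eigenvector_jacobi_mat vec_eq_iff)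
    then show False using ev by (simp add: eigenvector_jacobi_mat)
  qed
  show "jacobi_solution \<alpha> \<beta> \<mu> (Suc n) = 0" using *[of "Suc n"] 1 by simp
qed

text \<open>Norm and sign leave a single candidate per \<mu>, which later resolves the definite
  description in \<open>perturbed_eigenvector\<close>.\<close>

lemma unit_eigenvector_jacobi_mat:
  fixes \<alpha> \<beta> :: "nat \<Rightarrow> real" and \<mu> :: real
  defines "\<phi> \<equiv> jacobi_solution \<alpha> \<beta> \<mu>"
  assumes n: "1 \<le> n" and nz: "\<And>j. \<beta> j \<noteq> 0"
  shows "unit_eigenvector (jacobi_mat \<alpha> \<beta> n) v \<mu> \<longleftrightarrow>
    \<phi> (Suc n) = 0 \<and> v = vec n (\<lambda>i. \<phi> (Suc i) / sqrt (\<Sum>j=1..n. (\<phi> j)\<^sup>2))"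
proof -
  have N: "(\<Sum>j=1..n. (\<phi> j)\<^sup>2) > 0"
  proof -
    have "0 < (\<phi> 1)\<^sup>2" by (simp add: \<phi>_def)
    also have "\<dots> \<le> (\<Sum>j=1..n. (\<phi> j)\<^sup>2)" by (rule member_le_sum) (use n in auto)
    finally show ?thesis .
  qed
  show ?thesis
  proof
    assume u: "unit_eigenvector (jacobi_mat \<alpha> \<beta> n) v \<mu>"
    then have ev: "eigenvector (jacobi_mat \<alpha> \<beta> n) v \<mu>" and v: "v \<in> carrier_vec n"
      and one: "sqrt (v \<bullet> v) = 1" and pos: "coord n v 1 > 0"
      using n by (auto simp: unit_eigenvector_def eigenvector_jacobi_mat coord_def)
    have c: "coord n v j = coord n v 1 * \<phi> j" if "j \<le> Suc n" for j
      unfolding \<phi>_def by (rule eigenvector_coord(1)[OF ev nz that])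
    have "v \<bullet> v = (\<Sum>j=1..n. (coord n v 1 * \<phi> j)\<^sup>2)"
      unfolding norm_coord[OF v]
    proof (rule sum.cong[OF refl])
      fix j assume "j \<in> {1..n}"
      then show "(coord n v j)\<^sup>2 = (coord n v 1 * \<phi> j)\<^sup>2" using c[of j] by simp
    qed
    also have "\<dots> = (coord n v 1)\<^sup>2 * (\<Sum>j=1..n. (\<phi> j)\<^sup>2)" by (simp add: power_mult_distrib sum_distrib_left)
    finally have "coord n v 1 * sqrt (\<Sum>j=1..n. (\<phi> j)\<^sup>2) = 1" using one pos by (simp add: real_sqrt_mult)
    then have c1: "coord n v 1 = 1 / sqrt (\<Sum>j=1..n. (\<phi> j)\<^sup>2)" using N by (simp add: field_simps)
    have "v $ i = \<phi> (Suc i) / sqrt (\<Sum>j=1..n. (\<phi> j)\<^sup>2)" if "i < n" for i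
    proof -
      have "v $ i = coord n v (Suc i)" using that by (simp add: coord_def)
      also have "\<dots> = \<phi> (Suc i) / sqrt (\<Sum>j=1..n. (\<phi> j)\<^sup>2)" using c[of "Suc i"] that c1 by simp
      finally show ?thesis .
    qed
    then have "v = vec n (\<lambda>i. \<phi> (Suc i) / sqrt (\<Sum>j=1..n. (\<phi> j)\<^sup>2))" using v by (auto simp: vec_eq_iff)
    moreover have "\<phi> (Suc n) = 0" unfolding \<phi>_def by (rule eigenvector_coord(3)[OF ev nz])
    ultimately show "\<phi> (Suc n) = 0 \<and> v = vec n (\<lambda>i. \<phi> (Suc i) / sqrt (\<Sum>j=1..n. (\<phi> j)\<^sup>2))" by simp
  next
    assume *: "\<phi> (Suc n) = 0 \<and> v = vec n (\<lambda>i. \<phi> (Suc i) / sqrt (\<Sum>j=1..n. (\<phi> j)\<^sup>2))"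
    define s where "s = sqrt (\<Sum>j=1..n. (\<phi> j)\<^sup>2)"
    have s: "s > 0" "s\<^sup>2 = (\<Sum>j=1..n. (\<phi> j)\<^sup>2)" using N by (auto simp: s_def)
    have v: "v = vec n (\<lambda>i. \<phi> (Suc i) / s)" using * by (simp add: s_def)
    have c: "coord n v j = \<phi> j / s" if "j \<le> Suc n" for j
      using that * unfolding v coord_vec[of n "\<lambda>i. \<phi> i / s"] by (cases "j = 0"; cases "j = Suc n") (auto simp: \<phi>_def)
    have rec: "\<beta> j * coord n v (Suc j) = (\<mu> - \<alpha> j) * coord n v j - \<beta> (j - 1) * coord n v (j - 1)"
      if j: "1 \<le> j" "j \<le> n" for j
    proof -
      have "\<beta> j * \<phi> (Suc j) = (\<mu> - \<alpha> j) * \<phi> j - \<beta> (j - 1) * \<phi> (j - 1)"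
        unfolding \<phi>_def by (rule jacobi_solution_rec[OF j(1) nz])
      from arg_cong[OF this, of "\<lambda>x. x / s"] show ?thesis
        using c[of j] c[of "Suc j"] c[of "j - 1"] j by (simp add: diff_divide_distrib)
    qed
    have vc: "v \<in> carrier_vec n" by (simp add: v)
    have v0: "v $ 0 > 0" using n s by (simp add: v \<phi>_def)
    have "v \<noteq> 0\<^sub>v n"
    proof
      assume "v = 0\<^sub>v n" then show False using v0 n by simp
    qed
    moreover have "v \<bullet> v = 1"
    proof -
      have "v \<bullet> v = (\<Sum>j=1..n. (\<phi> j / s)\<^sup>2)" unfolding norm_coord[OF vc] using c by (intro sum.cong) auto
      also have "\<dots> = (\<Sum>j=1..n. (\<phi> j)\<^sup>2) / s\<^sup>2" by (simp add: power_divide sum_divide_distrib)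
      finally show ?thesis using s(2) N by simp
    qed
    ultimately show "unit_eigenvector (jacobi_mat \<alpha> \<beta> n) v \<mu>"
      unfolding unit_eigenvector_def eigenvector_jacobi_mat using rec vc v0 by simp
  qed
qed

lemma eigenvalue_jacobi_mat:
  assumes n: "1 \<le> n" and nz: "\<And>j. \<beta> j \<noteq> 0"
  shows "eigenvalue (jacobi_mat \<alpha> \<beta> n) \<mu> \<longleftrightarrow> jacobi_solution \<alpha> \<beta> \<mu> (Suc n) = 0"
proof
  assume "eigenvalue (jacobi_mat \<alpha> \<beta> n) \<mu>"
  then obtain v where "eigenvector (jacobi_mat \<alpha> \<beta> n) v \<mu>" unfolding eigenvalue_def by blast
  then show "jacobi_solution \<alpha> \<beta> \<mu> (Suc n) = 0" using nz by (rule eigenvector_coord(3))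
next
  assume "jacobi_solution \<alpha> \<beta> \<mu> (Suc n) = 0"
  then have "\<exists>v. unit_eigenvector (jacobi_mat \<alpha> \<beta> n) v \<mu>"
    unfolding unit_eigenvector_jacobi_mat[OF assms] by blast
  then show "eigenvalue (jacobi_mat \<alpha> \<beta> n) \<mu>" unfolding eigenvalue_def unit_eigenvector_def by blast
qed

text \<open>They are roots of the characteristic polynomial, which is monic and hence
  nonzero.\<close>

lemma finite_jacobi_roots:
  assumes n: "1 \<le> n" and nz: "\<And>j. \<beta> j \<noteq> 0"
  shows "finite {\<mu>. jacobi_solution \<alpha> \<beta> \<mu> (Suc n) = 0}"
proof -
  let ?M = "jacobi_mat \<alpha> \<beta> n"
  have "char_poly ?M \<noteq> 0" using degree_monic_char_poly[of ?M n] n by auto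
  then have "finite {\<mu>. poly (char_poly ?M) \<mu> = 0}" by (rule poly_roots_finite)
  then show ?thesis
    unfolding eigenvalue_root_char_poly[OF jacobi_mat_dim(3), symmetric] eigenvalue_jacobi_mat[OF assms] .
qed

text \<open>Any pair e is allowed, so that derivatives can be chosen for all pairs at once; a pair
  off the upper band gives a constant family.\<close>

locale entry_perturbation =
  fixes a c :: real and n :: nat and e :: "nat \<times> nat"
  assumes n1: "1 \<le> n"
begin

text \<open>For a relative perturbation the direction is the entry itself: the diagonal entry here,
  and 1 beside the diagonal.\<close>

definition "u j = (if 1 \<le> j \<and> e = (j - 1, j - 1) then diag_entry a c j else 0)"
definition "w j = (if 1 \<le> j \<and> e = (j - 1, j) then 1 else (0::real))"

sublocale jacobi_family "diag_entry a c" u w n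
proof
  show "finite {\<mu>. jacobi_solution (diag_entry a c) (\<lambda>_. 1) \<mu> (Suc n) = 0}"
    by (rule finite_jacobi_roots) (use n1 in auto)
qed (use n1 in \<open>auto simp: w_def\<close>)

lemma perturb_mat_eq: "perturb_mat (tridiag_mat a c n) ((\<lambda>_. 0)(e := t)) = jacobi_mat (\<alpha> t) (\<beta> t) n"
proof (rule eq_matI)
  fix i j assume "i < dim_row (jacobi_mat (\<alpha> t) (\<beta> t) n)" "j < dim_col (jacobi_mat (\<alpha> t) (\<beta> t) n)"
  then have ij: "i < n" "j < n" by auto
  show "perturb_mat (tridiag_mat a c n) ((\<lambda>_. 0)(e := t)) $$ (i, j) = jacobi_mat (\<alpha> t) (\<beta> t) n $$ (i, j)"
    using ij by (auto simp: perturb_mat_def tridiag_mat_def jacobi_mat_def \<alpha>_def \<beta>_def u_def w_def min_def max_def algebra_simps)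
qed (auto simp: perturb_mat_def tridiag_mat_def)

lemma tridiag_mat_eq: "tridiag_mat a c n = jacobi_mat (\<alpha> 0) (\<beta> 0) n"
  by (rule eq_matI) (auto simp: tridiag_mat_def jacobi_mat_def \<alpha>_def \<beta>_def)

lemma unit_eigenvector_iff:
  assumes "\<bar>t\<bar> < 1"
  shows "unit_eigenvector (jacobi_mat (\<alpha> t) (\<beta> t) n) v \<mu> \<longleftrightarrow>
    \<mu> \<in> R t \<and> v = vec n (\<lambda>i. \<Phi> t \<mu> (Suc i) / sqrt (\<Sum>j=1..n. (\<Phi> t \<mu> j)\<^sup>2))"
proof -
  have nz: "\<beta> t j \<noteq> 0" for j using beta_pos(1)[OF assms, of j] by simp
  show ?thesis unfolding unit_eigenvector_jacobi_mat[OF n1 nz] by (simp add: R_def \<Phi>_def)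
qed

lemma eigenvalue_index_eq:
  assumes "\<bar>t\<bar> < 1"
  shows "eigenvalue_index (jacobi_mat (\<alpha> t) (\<beta> t) n) \<mu> = card {\<nu>. \<nu> \<in> R t \<and> \<nu> < \<mu>}"
proof -
  have nz: "\<beta> t j \<noteq> 0" for j using beta_pos(1)[OF assms, of j] by simp
  show ?thesis unfolding eigenvalue_index_def eigenvalue_jacobi_mat[OF n1 nz] by (simp add: R_def \<Phi>_def)
qed

lemma eigenvector_at_0:
  assumes "unit_eigenvector (tridiag_mat a c n) v r"
  shows "r \<in> R 0" "v = vec n (\<lambda>i. evec 0 r (Suc i))"
proof -
  have *: "r \<in> R 0 \<and> v = vec n (\<lambda>i. \<Phi> 0 r (Suc i) / sqrt (\<Sum>j=1..n. (\<Phi> 0 r j)\<^sup>2))"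
    using assms unfolding tridiag_mat_eq using unit_eigenvector_iff[of 0] by simp
  then show r: "r \<in> R 0" by simp
  show "v = vec n (\<lambda>i. evec 0 r (Suc i))" using * by (simp add: evec_def nrm_def eigval_0[OF r])
qed

lemma perturbed_eigenvector_eq:
  assumes g: "good t" and r: "r \<in> R 0"
  shows "perturbed_eigenvector (tridiag_mat a c n) r ((\<lambda>_. 0)(e := t)) = vec n (\<lambda>i. evec t r (Suc i))"
proof -
  have t: "\<bar>t\<bar> < 1" using g by (simp add: good_def)
  have i0: "eigenvalue_index (tridiag_mat a c n) r = card {\<nu>. \<nu> \<in> R 0 \<and> \<nu> < r}"
    unfolding tridiag_mat_eq by (rule eigenvalue_index_eq) simp
  show ?thesis
    unfolding perturbed_eigenvector_def perturb_mat_eq unit_eigenvector_iff[OF t] eigenvalue_index_eq[OF t] i0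
  proof (rule the_equality)
    show "\<exists>\<mu>. (\<mu> \<in> R t \<and> vec n (\<lambda>i. evec t r (Suc i)) = vec n (\<lambda>i. \<Phi> t \<mu> (Suc i) / sqrt (\<Sum>j=1..n. (\<Phi> t \<mu> j)\<^sup>2)))
       \<and> card {\<nu>. \<nu> \<in> R t \<and> \<nu> < \<mu>} = card {\<nu>. \<nu> \<in> R 0 \<and> \<nu> < r}"
      using card_below_eigval[OF g r] g r
      by (intro exI[of _ "eigval t r"]) (auto simp: evec_def nrm_def good_def)
    show "v = vec n (\<lambda>i. evec t r (Suc i))"
      if ex: "\<exists>\<mu>. (\<mu> \<in> R t \<and> v = vec n (\<lambda>i. \<Phi> t \<mu> (Suc i) / sqrt (\<Sum>j=1..n. (\<Phi> t \<mu> j)\<^sup>2)))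
       \<and> card {\<nu>. \<nu> \<in> R t \<and> \<nu> < \<mu>} = card {\<nu>. \<nu> \<in> R 0 \<and> \<nu> < r}" for v
    proof -
      obtain \<mu> where \<mu>: "\<mu> \<in> R t" "v = vec n (\<lambda>i. \<Phi> t \<mu> (Suc i) / sqrt (\<Sum>j=1..n. (\<Phi> t \<mu> j)\<^sup>2))"
        "card {\<nu>. \<nu> \<in> R t \<and> \<nu> < \<mu>} = card {\<nu>. \<nu> \<in> R 0 \<and> \<nu> < r}"
        using ex by blast
      have "\<mu> = eigval t r" by (rule eigval_by_index[OF g r \<mu>(1,3)])
      then show ?thesis using \<mu>(2) by (simp add: evec_def nrm_def)
    qed
  qed
qed

lemma perturbed_eigenvector_derivative:
  assumes v: "unit_eigenvector (tridiag_mat a c n) v r"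
  shows "\<exists>Y D. (\<forall>j. 1 \<le> j \<longrightarrow> j \<le> n \<longrightarrow> ((\<lambda>t. perturbed_eigenvector (tridiag_mat a c n) r ((\<lambda>_. 0)(e := t)) $ (j - 1))
        has_real_derivative Y j) (at 0))
    \<and> Y 0 = 0 \<and> Y (Suc n) = 0
    \<and> (\<forall>j. 1 \<le> j \<longrightarrow> j \<le> n \<longrightarrow> Y (Suc j) = (r - diag_entry a c j) * Y j - Y (j - 1)
      + (D * coord n v j - (u j * coord n v j + w j * coord n v (Suc j) + w (j - 1) * coord n v (j - 1))))
    \<and> (\<Sum>j=1..n. coord n v j * Y j) = 0"
proof -
  note r = eigenvector_at_0(1)[OF v]
  have vc: "coord n v j = evec 0 r j" if "j \<le> Suc n" for j
  proof -
    have "evec 0 r 0 = 0" "evec 0 r (Suc n) = 0" using r by (auto simp: evec_def R_def eigval_0[OF r])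
    then show ?thesis using that unfolding eigenvector_at_0(2)[OF v] coord_vec[of n "evec 0 r"]
      by (cases "j = 0"; cases "j = Suc n") auto
  qed
  obtain Y D where Y: "\<And>j. ((\<lambda>t. evec t r j) has_real_derivative Y j) (at 0)"
    and Y0: "Y 0 = 0" "Y (Suc n) = 0"
    and rec: "\<And>j. 1 \<le> j \<Longrightarrow> j \<le> n \<Longrightarrow> Y (Suc j) = (r - diag_entry a c j) * Y j - Y (j - 1)
      + (D * evec 0 r j - (u j * evec 0 r j + w j * evec 0 r (Suc j) + w (j - 1) * evec 0 r (j - 1)))"
    and orth: "(\<Sum>j=1..n. evec 0 r j * Y j) = 0"
    using evec_linearization[OF r] by blast
  have "((\<lambda>t. perturbed_eigenvector (tridiag_mat a c n) r ((\<lambda>_. 0)(e := t)) $ (j - 1)) has_real_derivative Y j) (at 0)"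
    if j: "1 \<le> j" "j \<le> n" for j
  proof -
    have "\<forall>\<^sub>F t in nhds 0. perturbed_eigenvector (tridiag_mat a c n) r ((\<lambda>_. 0)(e := t)) $ (j - 1) = evec t r j"
      using eventually_good
    proof eventually_elim
      case (elim t)
      have "j - 1 < n" "Suc (j - 1) = j" using j by auto
      then show ?case unfolding perturbed_eigenvector_eq[OF elim r] by simp
    qed
    then show ?thesis using Y[of j] by (subst DERIV_cong_ev[OF refl _ refl]) auto
  qed
  moreover have "Y (Suc j) = (r - diag_entry a c j) * Y j - Y (j - 1)
      + (D * coord n v j - (u j * coord n v j + w j * coord n v (Suc j) + w (j - 1) * coord n v (j - 1)))"
    if j: "1 \<le> j" "j \<le> n" for j
    using rec[OF j] j by (simp add: vc)
  moreover have "(\<Sum>j=1..n. coord n v j * Y j) = 0"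
  proof -
    have "(\<Sum>j=1..n. coord n v j * Y j) = (\<Sum>j=1..n. evec 0 r j * Y j)"
      by (rule sum.cong) (auto simp: vc)
    then show ?thesis using orth by simp
  qed
  ultimately show ?thesis using Y0 by (intro exI[of _ Y] exI[of _ D]) blast
qed

end

section \<open>The precision of the coordinates\<close>

text \<open>Green's identity with equal eigenvalues gives D as the sum of X i g i. As A i may be far
  larger than \<lambda>, A i X i is replaced through the recurrence by \<lambda> X i and the
  neighbours. This yields |D| \<le> \<lambda> + 4 \<le> 2 \<lambda> and explains the factors 3 and
  2.\<close>

lemma eigenvalue_derivative_bound:
  fixes X Y g A :: "nat \<Rightarrow> real"
  assumes X0: "X 0 = 0" "X (Suc n) = 0" and Y0: "Y 0 = 0" "Y (Suc n) = 0"
    and recX: "\<And>j. 1 \<le> j \<Longrightarrow> j \<le> n \<Longrightarrow> X (Suc j) = (lam - A j) * X j - X (j - 1)"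
    and recY: "\<And>j. 1 \<le> j \<Longrightarrow> j \<le> n \<Longrightarrow> Y (Suc j) = (lam - A j) * Y j - Y (j - 1) + (D * X j - g j)"
    and normX: "(\<Sum>j=1..n. (X j)\<^sup>2) = 1"
    and g_le: "\<And>j. 1 \<le> j \<Longrightarrow> j \<le> n \<Longrightarrow> \<bar>g j\<bar> \<le> A j * \<bar>X j\<bar> + \<bar>X (Suc j)\<bar> + \<bar>X (j - 1)\<bar>"
    and A0: "\<And>j. 1 \<le> j \<Longrightarrow> j \<le> n \<Longrightarrow> A j \<ge> 0" and lam4: "lam \<ge> 4"
    and j: "1 \<le> j" "j \<le> n"
  shows "\<bar>D * X j - g j\<bar> \<le> 3 * lam * \<bar>X j\<bar> + 2 * (\<bar>X (j - 1)\<bar> + \<bar>X (Suc j)\<bar>)"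
proof -
  have "1 * (X n * Y (Suc n) - X (Suc n) * Y n) = (\<Sum>i=1..n. (lam - lam) * (X i * Y i) + X i * (D * X i - g i))"
    by (rule jacobi_green[where \<alpha>=A and \<beta>="\<lambda>_. 1"]) (use X0 Y0 recX recY in auto)
  then have "0 = (\<Sum>i=1..n. D * (X i)\<^sup>2 - X i * g i)" using X0 Y0 by (simp add: power2_eq_square algebra_simps)
  also have "\<dots> = D - (\<Sum>i=1..n. X i * g i)" using normX by (simp add: sum_subtractf sum_distrib_left[symmetric])
  finally have "D = (\<Sum>i=1..n. X i * g i)" by simp
  then have "\<bar>D\<bar> \<le> (\<Sum>i=1..n. \<bar>X i * g i\<bar>)" by simp
  also have "\<dots> \<le> (\<Sum>i=1..n. lam * (X i)\<^sup>2 + (2 * (X i)\<^sup>2 + (X (Suc i))\<^sup>2 + (X (i - 1))\<^sup>2))"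
  proof (rule sum_mono)
    fix i assume i: "i \<in> {1..n}"
    define x p m where "x = \<bar>X i\<bar>" and "p = \<bar>X (Suc i)\<bar>" and "m = \<bar>X (i - 1)\<bar>"
    have nn: "x \<ge> 0" "p \<ge> 0" "m \<ge> 0" by (auto simp: x_def p_def m_def)
    have "A i * (X i)\<^sup>2 = lam * (X i)\<^sup>2 - X i * (X (Suc i) + X (i - 1))"
    proof -
      have "A i * X i = lam * X i - (X (Suc i) + X (i - 1))" using recX[of i] i by (simp add: algebra_simps)
      then have "X i * (A i * X i) = X i * (lam * X i - (X (Suc i) + X (i - 1)))" by simp
      then show ?thesis by (simp add: power2_eq_square algebra_simps)
    qed
    moreover have "\<bar>X i * (X (Suc i) + X (i - 1))\<bar> \<le> x * (p + m)"
      unfolding abs_mult x_def p_def m_def by (intro mult_left_mono abs_triangle_ineq) auto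
    ultimately have A: "A i * x\<^sup>2 \<le> lam * x\<^sup>2 + x * (p + m)" by (simp add: x_def)
    have "\<bar>X i * g i\<bar> \<le> x * (A i * x + p + m)"
      unfolding abs_mult x_def p_def m_def using g_le[of i] i by (intro mult_left_mono) auto
    also have "\<dots> = A i * x\<^sup>2 + x * (p + m)" by (simp add: power2_eq_square algebra_simps)
    also have "\<dots> \<le> lam * x\<^sup>2 + (2 * (x * p) + 2 * (x * m))" using A by (simp add: algebra_simps)
    also have "\<dots> \<le> lam * x\<^sup>2 + ((x\<^sup>2 + p\<^sup>2) + (x\<^sup>2 + m\<^sup>2))"
      using zero_le_power2[of "x - p"] zero_le_power2[of "x - m"]
      by (intro add_mono order_refl) (simp_all add: power2_eq_square algebra_simps)
    finally show "\<bar>X i * g i\<bar> \<le> lam * (X i)\<^sup>2 + (2 * (X i)\<^sup>2 + (X (Suc i))\<^sup>2 + (X (i - 1))\<^sup>2)"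
      by (simp add: x_def p_def m_def)
  qed
  also have "\<dots> = lam + 2 + (\<Sum>i=1..n. (X (Suc i))\<^sup>2) + (\<Sum>i=1..n. (X (i - 1))\<^sup>2)"
    using normX by (simp add: sum.distrib sum_distrib_left[symmetric])
  also have "(\<Sum>i=1..n. (X (Suc i))\<^sup>2) \<le> 1"
  proof -
    have "(\<Sum>i=1..n. (X (Suc i))\<^sup>2) = (\<Sum>i=Suc 1..Suc n. (X i)\<^sup>2)" by (rule sum.shift_bounds_cl_Suc_ivl[symmetric])
    also have "\<dots> \<le> (\<Sum>i=1..Suc n. (X i)\<^sup>2)" by (rule sum_mono2) auto
    also have "\<dots> = 1" using normX X0 by simp
    finally show ?thesis .
  qed
  also have "(\<Sum>i=1..n. (X (i - 1))\<^sup>2) \<le> 1"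
  proof -
    have "(\<Sum>i=1..n. (X (i - 1))\<^sup>2) = (\<Sum>i<n. (X i)\<^sup>2)"
      by (rule sum.reindex_bij_witness[where i=Suc and j="\<lambda>i. i - 1"]) auto
    also have "\<dots> \<le> (\<Sum>i=0..n. (X i)\<^sup>2)" by (rule sum_mono2) auto
    also have "\<dots> = 1" using normX X0 by (simp add: sum.atLeast_Suc_atMost)
    finally show ?thesis .
  qed
  finally have D: "\<bar>D\<bar> \<le> 2 * lam" using lam4 by simp
  have "A j * X j = lam * X j - X (Suc j) - X (j - 1)" using recX[OF j] by (simp add: algebra_simps)
  moreover have "A j * \<bar>X j\<bar> = \<bar>A j * X j\<bar>" using A0[OF j] by (simp add: abs_mult)
  moreover have "\<bar>lam * X j\<bar> = lam * \<bar>X j\<bar>" using lam4 by (simp add: abs_mult)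
  ultimately have A: "A j * \<bar>X j\<bar> \<le> lam * \<bar>X j\<bar> + \<bar>X (Suc j)\<bar> + \<bar>X (j - 1)\<bar>" by linarith
  have "\<bar>D * X j\<bar> \<le> (2 * lam) * \<bar>X j\<bar>" unfolding abs_mult using D by (intro mult_right_mono) auto
  then have "\<bar>D * X j\<bar> \<le> 2 * (lam * \<bar>X j\<bar>)" by (simp only: mult.assoc)
  moreover have "\<bar>D * X j - g j\<bar> \<le> \<bar>D * X j\<bar> + \<bar>g j\<bar>" by (rule abs_triangle_ineq4)
  moreover have "x \<le> 3 * r + 2 * (s + t)"
    if "y \<le> 2 * r" "x \<le> y + z" "z \<le> h + t + s" "h \<le> r + t + s" for x y z h r s t :: real
    using that by argo
  ultimately show ?thesis using g_le[OF j] A unfolding mult.assoc by blast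
qed

text \<open>The locale constants depend on a alone, which makes the bound uniform in c, n, k and the
  eigenvector.\<close>

definition precision_const :: "real \<Rightarrow> real" where
  "precision_const a = 12 * eig_problem.D3 a + 100 * eig_problem.D1 a"

lemma finite_sym_entries: "finite (sym_entries A)"
  by (rule finite_subset[of _ "{..<dim_row A} \<times> {..<dim_row A}"]) (auto simp: sym_entries_def)

text \<open>Each coefficient of the recurrence is touched by one entry e only, so perturbing all
  entries at once costs no factor.\<close>

lemma sum_entries_delta:
  assumes "\<And>e. e \<in> E \<Longrightarrow> \<bar>d e\<bar> \<le> 1" "finite E" "\<And>e. h e = (if e = e0 then r else (0::real))"
  shows "\<bar>\<Sum>e\<in>E. d e * h e\<bar> \<le> \<bar>r\<bar>"
proof -
  have "(\<Sum>e\<in>E. d e * h e) = (\<Sum>e\<in>E. if e = e0 then d e0 * r else 0)"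
    by (rule sum.cong) (auto simp: assms(3))
  also have "\<dots> = (if e0 \<in> E then d e0 * r else 0)" using assms(2) by simp
  finally show ?thesis using assms(1)[of e0] mult_right_mono[of "\<bar>d e0\<bar>" 1 "\<bar>r\<bar>"] by (auto simp: abs_mult)
qed

text \<open>Valid for every single c > 1, with a constant depending on a alone; no limit is
  involved.\<close>

theorem coordinate_precision:
  fixes a c lam :: real and n k :: nat and v :: "real vec"
  assumes a1: "a \<ge> 1" and c1: "c > 1" and k: "1 < k" "k < n"
    and lam: "2 + diag_entry a c k < lam" "lam \<le> 2 + diag_entry a c (k + 1)"
    and v: "unit_eigenvector (tridiag_mat a c n) v lam"
    and j: "j \<in> {1..k}" and eps: "\<epsilon> > 0"
  shows "defined_to_rel_precision \<epsilon> (tridiag_mat a c n) lam v (j - 1)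
    (\<epsilon> * (precision_const a * (- ln (v $ 0))) * c powr (4 * a / (a + 2)))"
proof -
  define A where "A = tridiag_mat a c n"
  define E where "E = sym_entries A"
  define X where "X = coord n v"
  have n1: "1 \<le> n" using k by simp
  have ep: "entry_perturbation n" using n1 by (rule entry_perturbation.intro)
  define u where "u e = entry_perturbation.u a c e" for e
  define w where "w e = entry_perturbation.w e" for e
  define rel where "rel e Y D \<longleftrightarrow> (\<forall>j. 1 \<le> j \<longrightarrow> j \<le> n \<longrightarrow>
        ((\<lambda>t. perturbed_eigenvector A lam ((\<lambda>_. 0)(e := t)) $ (j - 1)) has_real_derivative Y j) (at 0))
    \<and> Y 0 = 0 \<and> Y (Suc n) = 0
    \<and> (\<forall>j. 1 \<le> j \<longrightarrow> j \<le> n \<longrightarrow> Y (Suc j) = (lam - diag_entry a c j) * Y j - Y (j - 1)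
      + (D * X j - (u e j * X j + w e j * X (Suc j) + w e (j - 1) * X (j - 1))))
    \<and> (\<Sum>j=1..n. X j * Y j) = 0" for e and Y :: "nat \<Rightarrow> real" and D :: real
  have "\<exists>Y D. rel e Y D" for e
    unfolding rel_def u_def w_def X_def A_def
    using entry_perturbation.perturbed_eigenvector_derivative[OF ep v] .
  then have "\<forall>e. \<exists>YD. rel e (fst YD) (snd YD)" by simp
  from choice[OF this] obtain YD where YD: "\<And>e. rel e (fst (YD e)) (snd (YD e))" by blast
  define Ye where "Ye e = fst (YD e)" for e
  define De where "De e = snd (YD e)" for e
  have rel: "rel e (Ye e) (De e)" for e using YD by (simp add: Ye_def De_def)
  have Yder: "((\<lambda>t. perturbed_eigenvector A lam ((\<lambda>_. 0)(e := t)) $ (j - 1)) has_real_derivative Ye e j) (at 0)"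
    and Yrec: "Ye e (Suc j) = (lam - diag_entry a c j) * Ye e j - Ye e (j - 1)
      + (De e * X j - (u e j * X j + w e j * X (Suc j) + w e (j - 1) * X (j - 1)))"
    if "1 \<le> j" "j \<le> n" for e j
    using rel[of e] that unfolding rel_def by blast+
  have Y0: "Ye e 0 = 0" "Ye e (Suc n) = 0" and Yorth: "(\<Sum>j=1..n. X j * Ye e j) = 0" for e
    using rel[of e] unfolding rel_def by blast+
  have ev: "eigenvector (tridiag_mat a c n) v lam" and one: "sqrt (v \<bullet> v) = 1" and v0: "v $ 0 > 0"
    using v by (auto simp: unit_eigenvector_def)
  have jm: "tridiag_mat a c n = jacobi_mat (diag_entry a c) (\<lambda>_. 1) n"
    by (rule eq_matI) (auto simp: tridiag_mat_def jacobi_mat_def)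
  have vc: "v \<in> carrier_vec n" using ev by (simp add: jm eigenvector_jacobi_mat)
  have X0: "X 0 = 0" "X (Suc n) = 0" by (auto simp: X_def)
  have X1: "X 1 = v $ 0" using n1 by (simp add: X_def coord_def)
  have recX: "X (Suc j) = (lam - diag_entry a c j) * X j - X (j - 1)" if "1 \<le> j" "j \<le> n" for j
    using ev that by (simp add: jm eigenvector_jacobi_mat X_def)
  have normX: "(\<Sum>j=1..n. (X j)\<^sup>2) = 1" using one norm_coord[OF vc] by (simp add: X_def)
  have lam4: "lam \<ge> 4" using lam(1) by (simp add: diag_entry_def) (smt (verit) powr_ge_zero)
  have dpos: "diag_entry a c j \<ge> 0" for j by (simp add: diag_entry_def)
  have finE: "finite E" by (simp add: E_def finite_sym_entries)
  define B where "B = precision_const a * (- ln (X 1)) * c powr (4 * a / (a + 2))"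
  \<comment> \<open>The worst case is treated as one perturbation: the derivatives for single
    entries are combined with weights d into one solution of the linearised problem. Bounding them
    one by one would cost a factor growing with n.\<close>
  have direction: "X j > 0 \<and> \<bar>\<Sum>e\<in>E. d e * Ye e j\<bar> \<le> B * X j" if d: "\<And>e. e \<in> E \<Longrightarrow> \<bar>d e\<bar> \<le> 1" for d
  proof -
    define Y where "Y i = (\<Sum>e\<in>E. d e * Ye e i)" for i
    define D where "D = (\<Sum>e\<in>E. d e * De e)"
    define U where "U i = (\<Sum>e\<in>E. d e * u e i)" for i
    define V where "V i = (\<Sum>e\<in>E. d e * w e i)" for i
    define g where "g i = U i * X i + V i * X (Suc i) + V (i - 1) * X (i - 1)" for i
    have Urec: "Y (Suc i) = (lam - diag_entry a c i) * Y i - Y (i - 1) + (D * X i - g i)" if i: "1 \<le> i" "i \<le> n" for i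
      unfolding Y_def D_def g_def U_def V_def Yrec[OF i]
      by (simp add: sum_distrib_left sum_distrib_right sum.distrib sum_subtractf algebra_simps)
    have Uabs: "\<bar>U i\<bar> \<le> diag_entry a c i" for i
    proof (cases "1 \<le> i")
      case True
      have "\<bar>U i\<bar> \<le> \<bar>diag_entry a c i\<bar>" unfolding U_def
        by (rule sum_entries_delta[where ?e0.0="(i - 1, i - 1)"]) (use d finE True in \<open>auto simp: u_def entry_perturbation.u_def[OF ep]\<close>)
      then show ?thesis using dpos[of i] by simp
    qed (use dpos in \<open>simp add: U_def u_def entry_perturbation.u_def[OF ep]\<close>)
    have Vabs: "\<bar>V i\<bar> \<le> 1" for i
    proof (cases "1 \<le> i")
      case True
      have "\<bar>V i\<bar> \<le> \<bar>1\<bar>" unfolding V_def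
        by (rule sum_entries_delta[where ?e0.0="(i - 1, i)"]) (use d finE True in \<open>auto simp: w_def entry_perturbation.w_def[OF ep]\<close>)
      then show ?thesis by simp
    qed (simp add: V_def w_def entry_perturbation.w_def[OF ep])
    have g_le: "\<bar>g i\<bar> \<le> diag_entry a c i * \<bar>X i\<bar> + \<bar>X (Suc i)\<bar> + \<bar>X (i - 1)\<bar>" for i
    proof -
      have "\<bar>g i\<bar> \<le> \<bar>U i\<bar> * \<bar>X i\<bar> + \<bar>V i\<bar> * \<bar>X (Suc i)\<bar> + \<bar>V (i - 1)\<bar> * \<bar>X (i - 1)\<bar>"
        unfolding g_def abs_mult[symmetric] by linarith
      also have "\<dots> \<le> diag_entry a c i * \<bar>X i\<bar> + 1 * \<bar>X (Suc i)\<bar> + 1 * \<bar>X (i - 1)\<bar>"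
        by (intro add_mono mult_right_mono Uabs Vabs) auto
      finally show ?thesis by simp
    qed
    have Yend: "Y 0 = 0" "Y (Suc n) = 0" by (simp_all add: Y_def Y0)
    have orth: "(\<Sum>i=1..n. X i * Y i) = 0"
    proof -
      have "(\<Sum>i=1..n. X i * Y i) = (\<Sum>i=1..n. \<Sum>e\<in>E. d e * (X i * Ye e i))"
        by (simp add: Y_def sum_distrib_left mult_ac)
      also have "\<dots> = (\<Sum>e\<in>E. d e * (\<Sum>i=1..n. X i * Ye e i))"
        by (subst sum.swap) (simp add: sum_distrib_left)
      also have "\<dots> = 0" unfolding Yorth by simp
      finally show ?thesis .
    qed
    interpret eig_problem a c lam n k X Y "\<lambda>i. D * X i - g i"
    proof
      show "X (Suc j) = (lam - (2 + 2 * (real j / c) powr a)) * X j - X (j - 1)" if "1 \<le> j" "j \<le> n" for j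
        using recX[OF that] by (simp add: diag_entry_def)
      show "Y (Suc j) = (lam - (2 + 2 * (real j / c) powr a)) * Y j - Y (j - 1) + (D * X j - g j)" if "1 \<le> j" "j \<le> n" for j
        using Urec[OF that] by (simp add: diag_entry_def)
      show "\<bar>D * X j - g j\<bar> \<le> 3 * lam * \<bar>X j\<bar> + 2 * (\<bar>X (j - 1)\<bar> + \<bar>X (Suc j)\<bar>)" if "1 \<le> j" "j \<le> n" for j
        using eigenvalue_derivative_bound[OF X0 Yend recX Urec normX g_le dpos lam4 that] .
      show "4 + 2 * (real k / c) powr a < lam" "lam \<le> 4 + 2 * (real (k + 1) / c) powr a"
        using lam by (auto simp: diag_entry_def)
    qed (use a1 c1 k X0 X1 v0 normX Yend orth in auto)
    have "X j > 0" using left_pos[of j] q_ge(1) j by auto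
    moreover have "\<bar>Y j\<bar> \<le> B * X j" using pointwise_bound[of j] j by (simp add: B_def precision_const_def)
    ultimately show ?thesis by (simp add: Y_def)
  qed
  have Xj: "X j > 0" using direction[of "\<lambda>_. 0"] by simp
  have vj: "v $ (j - 1) = X j" using j k by (auto simp: X_def coord_def)
  have "\<epsilon> * (SUP d\<in>{d. \<forall>e\<in>E. \<bar>d e\<bar> \<le> 1}. \<bar>\<Sum>e\<in>E. d e * Ye e j\<bar>) / \<bar>X j\<bar> \<le> \<epsilon> * B"
  proof -
    have "(SUP d\<in>{d. \<forall>e\<in>E. \<bar>d e\<bar> \<le> 1}. \<bar>\<Sum>e\<in>E. d e * Ye e j\<bar>) \<le> B * X j"
    proof (rule cSUP_least)
      show "{d. \<forall>e\<in>E. \<bar>d e\<bar> \<le> (1::real)} \<noteq> {}" by (auto intro: exI[of _ "\<lambda>_. 0"])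
    qed (use direction in auto)
    then have "\<epsilon> * (SUP d\<in>{d. \<forall>e\<in>E. \<bar>d e\<bar> \<le> 1}. \<bar>\<Sum>e\<in>E. d e * Ye e j\<bar>) \<le> \<epsilon> * (B * X j)"
      using eps by (intro mult_left_mono) auto
    then show ?thesis using Xj by (simp add: divide_le_eq)
  qed
  moreover have "\<forall>e\<in>E. ((\<lambda>t. perturbed_eigenvector A lam ((\<lambda>_. 0)(e := t)) $ (j - 1)) has_real_derivative Ye e j) (at 0)"
    using Yder j k by auto
  ultimately show ?thesis
    unfolding defined_to_rel_precision_def A_def[symmetric] E_def[symmetric] vj
    using Xj X1 by (intro conjI exI[of _ "\<lambda>e. Ye e j"]) (auto simp: B_def mult_ac)
qed

theorem theorem1:
  fixes a :: real
    and n k :: "real \<Rightarrow> nat"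
    and l :: "real \<Rightarrow> real"
    and X :: "real \<Rightarrow> real vec"
  assumes "a \<ge> 1"
    and "\<And>c. c \<ge> 1 \<Longrightarrow> real (n c) > c"
    and "\<And>c. c > 1 \<Longrightarrow> eigenvalue (tridiag_mat a c (n c)) (l c)"
    and "\<And>c. c > 1 \<Longrightarrow> 1 < k c \<and> k c < n c"
    and "\<And>c. c > 1 \<Longrightarrow> 2 + diag_entry a c (k c) < l c \<and> l c \<le> 2 + diag_entry a c (k c + 1)"
    and "\<And>c. c > 1 \<Longrightarrow> unit_eigenvector (tridiag_mat a c (n c)) (X c) (l c)"
  shows "\<exists>f g :: real \<Rightarrow> real.
           f \<in> O[at_top](\<lambda>c. - ln (X c $ 0)) \<and>
           g \<in> O[at_top](\<lambda>c. c powr (4 * a / (a + 2))) \<and>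
           (\<forall>\<epsilon>>0. \<exists>R :: real \<Rightarrow> real.
              (\<forall>c>1. \<forall>j\<in>{1..k c}.
                 defined_to_rel_precision \<epsilon> (tridiag_mat a c (n c)) (l c) (X c) (j - 1) (R c)) \<and>
              (\<forall>\<^sub>F c in at_top. R c \<le> \<epsilon> * f c * g c))"
proof (intro exI conjI allI impI ballI)
  show "(\<lambda>c. precision_const a * (- ln (X c $ 0))) \<in> O[at_top](\<lambda>c. - ln (X c $ 0))" by simp
  show "(\<lambda>c. c powr (4 * a / (a + 2))) \<in> O[at_top](\<lambda>c. c powr (4 * a / (a + 2)))" by simp
  fix \<epsilon> :: real assume "\<epsilon> > 0"
  \<comment> \<open>The witness for R is the bound of \<open>coordinate_precision\<close> itself, so
    the asymptotic inequality is an equality.\<close>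
  show "defined_to_rel_precision \<epsilon> (tridiag_mat a c (n c)) (l c) (X c) (j - 1)
      (\<epsilon> * (precision_const a * (- ln (X c $ 0))) * c powr (4 * a / (a + 2)))"
    if "c > 1" "j \<in> {1..k c}" for c j
    using assms(1) assms(4-6)[OF that(1)] that \<open>\<epsilon> > 0\<close>
    by (intro coordinate_precision[where k="k c"]) auto
qed simp

end
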